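(* Let $N\ge 2$, $\alpha\in(0,2)$, $C_1,C_2\ge 1$, $\hat c>0$. There exists a constant $\gamma>1$ depending only on $C_1,C_2,N,\alpha,\hat c$ such that the following holds. Let $E\subset\mathbb{R}^N$ be a bounded domain and let $\mu(x,dy)=K(x,y)\,dy$, where $K:\mathbb{R}^N\times\mathbb{R}^N\to[0,\infty)$ is measurable with $K(x,y)=K(y,x)$ for all $x,y\in\mathbb{R}^N$, be such that $\mu$ is symmetric, satisfies the Poincaré inequality in $E$ with constant $C_1$, satisfies the decay estimate with constant $C_2$, and $K$ satisfies the UJS inequality with constant $\hat c$. Let $B_R(x_0)\subset E$ and let $u$ be a local weak solution of $\mathscr{L}u=0$ in $E$ such that $u\ge0$ in $B_R(x_0)$. Then, for any $0<r<R/32$, $$\sup_{B_r(x_0)}u\le\gamma\inf_{B_r(x_0)}u+\gamma\left(\frac rR\right)^\alpha\mathrm{Tail}(u_-;x_0,\tfrac78R,R).$$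
   Context: $B_r(x_0)$ is the ball of radius $r$ centred at $x_0$ in $\mathbb{R}^N$; $E\subset\mathbb{R}^N$ is a bounded domain; $\alpha\in(0,2)$; $u_-=\max\{-u,0\}$. A set is $\mu$-measurable if it is $\mu(x,dy)$-measurable for all $x\in\mathbb{R}^N$. The operator is $\mathscr{L}u(x)=\text{p.v.}\int_{\mathbb{R}^N}(u(x)-u(y))\,\mu(x,dy)$, understood weakly as below. Symmetric: for all disjoint $\mu$-measurable sets $\Omega_1,\Omega_2$, the functions $x\mapsto\int_{\Omega_i}\mu(x,dy)$, $i=1,2$, are Lebesgue measurable and $\int_{\Omega_1}\int_{\Omega_2}\mu(x,dy)dx=\int_{\Omega_2}\int_{\Omega_1}\mu(x,dy)dx$. For open $D\subseteq\mathbb{R}^N$ put $\mathcal{E}_D^\mu(u,\varphi)=\int_D\int_D(u(y)-u(x))(\varphi(y)-\varphi(x))\,\mu(x,dy)dx$ and $\mathcal{E}^\mu=\mathcal{E}^\mu_{\mathbb{R}^N}$. $H^\mu_{\rm loc}(E)$ is the set of functions $u$ such that, for every open $D$ with $\overline{D}\subseteq E$, $u\in L^2(D)$ and $\mathcal{E}_D^\mu(u,u)<\infty$. $H^\mu(\mathbb{R}^N)$ is the space of $u\in L^2(\mathbb{R}^N)$ with $\mathcal{E}^\mu(u,u)<\infty$. Poincaré inequality in $E$ with constant $C_1$: for every ball $B_\rho(x_0)\subset E$ and every $v\in H^\mu_{\rm loc}(E)$, $\int_{B_\rho(x_0)}(v-[v]_{B_\rho(x_0)})^2dx\le C_1\rho^\alpha\mathcal{E}^\mu_{B_\rho(x_0)}(v,v)$,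 where $[v]_{B}$ is the average of $v$ over $B$. Decay estimate with constant $C_2$: for every $x_0\in\mathbb{R}^N$, $r>0$, $\int_{\mathbb{R}^N\setminus B_r(x_0)}\mu(x_0,dy)\le C_2r^{-\alpha}$. UJS inequality with constant $\hat c$: for every $x,y\in\mathbb{R}^N$ and every $0<r\le\frac{|x-y|}{2}$, $K(x,y)\le\hat c\,\frac{1}{|B_r(x)|}\int_{B_r(x)}K(z,y)\,dz$. Local weak sub(super)-solution of $\mathscr{L}u=0$ in $E$: a Lebesgue measurable $u:\mathbb{R}^N\to\mathbb{R}$ with $u\in H^\mu_{\rm loc}(E)$, $\sup_{x\in B_{\frac78R}(x_0)}\int_{\mathbb{R}^N\setminus B_R(x_0)}|u(y)|\,\mu(x,dy)<\infty$ for every $B_R(x_0)\subset E$, and $\mathcal{E}^\mu(u,\varphi)\le0$ (resp. $\ge0$) for every non-negative $\varphi\in H^\mu(\mathbb{R}^N)$ with $\operatorname{supp}\varphi\subseteq E$. A local weak solution is both a sub- and a super-solution. Tail: $\mathrm{Tail}(u;x_0,r_1,r_2)=r_2^\alpha\sup_{x\in B_{r_1}(x_0)}\int_{\mathbb{R}^N\setminus B_{r_2}(x_0)}u(y)\,\mu(x,dy)$. Suprema and infima of $u$ over balls are essential ones (Lebesgue measure). *)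

theory Defs
  imports "HOL-Analysis.Analysis" "HOL-Probability.Essential_Supremum"
begin

definition neg_part :: "('a \<Rightarrow> real) \<Rightarrow> 'a \<Rightarrow> real" where
  "neg_part u x = max (- u x) 0"

definition ess_sup_on :: "'a::euclidean_space set \<Rightarrow> ('a \<Rightarrow> real) \<Rightarrow> ereal" where
  "ess_sup_on A u = esssup (lebesgue_on A) (\<lambda>x. ereal (u x))"

definition ess_inf_on :: "'a::euclidean_space set \<Rightarrow> ('a \<Rightarrow> real) \<Rightarrow> ereal" where
  "ess_inf_on A u = - esssup (lebesgue_on A) (\<lambda>x. - ereal (u x))"

text \<open>A jump kernel assigns to each point \<open>x\<close> the measure \<open>\<mu>(x,dy)\<close>. The following
  one is \<open>\<mu>(x,dy) = K(x,y) dy\<close>; it is meaningful when all sections \<open>K x\<close> are Lebesgue measurable.\<close>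

definition kernel_of :: "('a::euclidean_space \<Rightarrow> 'a \<Rightarrow> real) \<Rightarrow> 'a \<Rightarrow> 'a measure" where
  "kernel_of K x = density lebesgue (\<lambda>y. ennreal (K x y))"

definition mu_measurable :: "('a \<Rightarrow> 'a measure) \<Rightarrow> 'a set \<Rightarrow> bool" where
  "mu_measurable \<mu> A \<longleftrightarrow> (\<forall>x. A \<in> sets (\<mu> x))"

definition symmetric_kernel :: "('a::euclidean_space \<Rightarrow> 'a measure) \<Rightarrow> bool" where
  "symmetric_kernel \<mu> \<longleftrightarrow>
    (\<forall>A B. mu_measurable \<mu> A \<and> mu_measurable \<mu> B \<and> A \<inter> B = {} \<longrightarrow>
       (\<lambda>x. emeasure (\<mu> x) A) \<in> borel_measurable lebesgue \<and>
       (\<lambda>x. emeasure (\<mu> x) B) \<in> borel_measurable lebesgue \<and>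
       (\<integral>\<^sup>+x\<in>A. emeasure (\<mu> x) B \<partial>lebesgue) = (\<integral>\<^sup>+x\<in>B. emeasure (\<mu> x) A \<partial>lebesgue))"

text \<open>The bilinear form \<open>\<E>\<^sub>D(u,\<phi>)\<close> is rendered twice: \<open>energy_form\<close> is the
  signed iterated integral, while \<open>energy D \<mu> u\<close> is \<open>\<E>\<^sub>D(u,u)\<close> as an element of
  \<open>[0,\<infinity>]\<close>, so that infinite energy is not confused with the value 0 that the
  Bochner integral assigns to non-integrable functions. In the definition of sub- and
  supersolutions, the tail condition together with the decay estimate makes the signed
  double integral absolutely convergent.\<close>

definition energy_form ::
  "'a::euclidean_space set \<Rightarrow> ('a \<Rightarrow> 'a measure) \<Rightarrow> ('a \<Rightarrow> real) \<Rightarrow> ('a \<Rightarrow> real) \<Rightarrow> real" where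
  "energy_form D \<mu> u \<phi> =
    (LINT x:D|lebesgue. (LINT y:D|\<mu> x. (u y - u x) * (\<phi> y - \<phi> x)))"

definition energy :: "'a::euclidean_space set \<Rightarrow> ('a \<Rightarrow> 'a measure) \<Rightarrow> ('a \<Rightarrow> real) \<Rightarrow> ennreal" where
  "energy D \<mu> u =
    (\<integral>\<^sup>+x\<in>D. (\<integral>\<^sup>+y\<in>D. ennreal ((u y - u x) * (u y - u x)) \<partial>\<mu> x) \<partial>lebesgue)"

definition L2_on :: "'a::euclidean_space set \<Rightarrow> ('a \<Rightarrow> real) set" where
  "L2_on D = {u. u \<in> borel_measurable (lebesgue_on D) \<and>
                 (\<integral>\<^sup>+x\<in>D. ennreal ((u x)\<^sup>2) \<partial>lebesgue) < \<infinity>}"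

definition H_loc :: "('a::euclidean_space \<Rightarrow> 'a measure) \<Rightarrow> 'a set \<Rightarrow> ('a \<Rightarrow> real) set" where
  "H_loc \<mu> E = {u. \<forall>D. open D \<and> closure D \<subseteq> E \<longrightarrow> u \<in> L2_on D \<and> energy D \<mu> u < \<infinity>}"

definition H_space :: "('a::euclidean_space \<Rightarrow> 'a measure) \<Rightarrow> ('a \<Rightarrow> real) set" where
  "H_space \<mu> = {u. u \<in> L2_on UNIV \<and> energy UNIV \<mu> u < \<infinity>}"

definition avg_on :: "'a::euclidean_space set \<Rightarrow> ('a \<Rightarrow> real) \<Rightarrow> real" where
  "avg_on B v = (LINT x:B|lebesgue. v x) / measure lebesgue B"

text \<open>A ball contained in \<open>E\<close> may touch the boundary of \<open>E\<close>, so the energy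
  on the right may be infinite; the inequality is then void.\<close>

definition poincare_inequality ::
  "('a::euclidean_space \<Rightarrow> 'a measure) \<Rightarrow> real \<Rightarrow> 'a set \<Rightarrow> real \<Rightarrow> bool" where
  "poincare_inequality \<mu> \<alpha> E C \<longleftrightarrow>
    (\<forall>x\<^sub>0 \<rho>. \<rho> > 0 \<and> ball x\<^sub>0 \<rho> \<subseteq> E \<longrightarrow> (\<forall>v\<in>H_loc \<mu> E.
       (\<integral>\<^sup>+x\<in>ball x\<^sub>0 \<rho>. ennreal ((v x - avg_on (ball x\<^sub>0 \<rho>) v)\<^sup>2) \<partial>lebesgue)
         \<le> ennreal (C * \<rho> powr \<alpha>) * energy (ball x\<^sub>0 \<rho>) \<mu> v))"

definition decay_estimate ::
  "('a::euclidean_space \<Rightarrow> 'a measure) \<Rightarrow> real \<Rightarrow> real \<Rightarrow> bool" where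
  "decay_estimate \<mu> \<alpha> C \<longleftrightarrow>
    (\<forall>x\<^sub>0 r. r > 0 \<longrightarrow> emeasure (\<mu> x\<^sub>0) (- ball x\<^sub>0 r) \<le> ennreal (C * r powr (- \<alpha>)))"

definition UJS :: "('a::euclidean_space \<Rightarrow> 'a \<Rightarrow> real) \<Rightarrow> real \<Rightarrow> bool" where
  "UJS K c \<longleftrightarrow>
    (\<forall>x y r. 0 < r \<and> r \<le> norm (x - y) / 2 \<longrightarrow>
       ennreal (K x y) \<le>
         ennreal c * ((\<integral>\<^sup>+z\<in>ball x r. ennreal (K z y) \<partial>lebesgue) / emeasure lebesgue (ball x r)))"

definition finite_tails ::
  "('a::euclidean_space \<Rightarrow> 'a measure) \<Rightarrow> 'a set \<Rightarrow> ('a \<Rightarrow> real) \<Rightarrow> bool" where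
  "finite_tails \<mu> E u \<longleftrightarrow>
    (\<forall>x\<^sub>0 R. R > 0 \<and> ball x\<^sub>0 R \<subseteq> E \<longrightarrow>
       (SUP x\<in>ball x\<^sub>0 (7/8 * R). \<integral>\<^sup>+y\<in>- ball x\<^sub>0 R. ennreal \<bar>u y\<bar> \<partial>\<mu> x) < \<infinity>)"

definition test_functions :: "('a::euclidean_space \<Rightarrow> 'a measure) \<Rightarrow> 'a set \<Rightarrow> ('a \<Rightarrow> real) set" where
  "test_functions \<mu> E = {\<phi>\<in>H_space \<mu>. (\<forall>x. 0 \<le> \<phi> x) \<and> closure {x. \<phi> x \<noteq> 0} \<subseteq> E}"

definition local_weak_subsolution ::
  "('a::euclidean_space \<Rightarrow> 'a measure) \<Rightarrow> 'a set \<Rightarrow> ('a \<Rightarrow> real) \<Rightarrow> bool" where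
  "local_weak_subsolution \<mu> E u \<longleftrightarrow>
     u \<in> borel_measurable lebesgue \<and> u \<in> H_loc \<mu> E \<and> finite_tails \<mu> E u \<and>
     (\<forall>\<phi>\<in>test_functions \<mu> E. energy_form UNIV \<mu> u \<phi> \<le> 0)"

definition local_weak_supersolution ::
  "('a::euclidean_space \<Rightarrow> 'a measure) \<Rightarrow> 'a set \<Rightarrow> ('a \<Rightarrow> real) \<Rightarrow> bool" where
  "local_weak_supersolution \<mu> E u \<longleftrightarrow>
     u \<in> borel_measurable lebesgue \<and> u \<in> H_loc \<mu> E \<and> finite_tails \<mu> E u \<and>
     (\<forall>\<phi>\<in>test_functions \<mu> E. energy_form UNIV \<mu> u \<phi> \<ge> 0)"

definition local_weak_solution ::
  "('a::euclidean_space \<Rightarrow> 'a measure) \<Rightarrow> 'a set \<Rightarrow> ('a \<Rightarrow> real) \<Rightarrow> bool" where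
  "local_weak_solution \<mu> E u \<longleftrightarrow>
     local_weak_subsolution \<mu> E u \<and> local_weak_supersolution \<mu> E u"

text \<open>Nonlocal tail of a non-negative function; the supremum over \<open>x\<close> is a genuine
  (not an essential) one.\<close>

definition Tail ::
  "('a::euclidean_space \<Rightarrow> 'a measure) \<Rightarrow> real \<Rightarrow> ('a \<Rightarrow> ennreal) \<Rightarrow> 'a \<Rightarrow> real \<Rightarrow> real \<Rightarrow> ennreal" where
  "Tail \<mu> \<alpha> u x\<^sub>0 r\<^sub>1 r\<^sub>2 =
     ennreal (r\<^sub>2 powr \<alpha>) * (SUP x\<in>ball x\<^sub>0 r\<^sub>1. \<integral>\<^sup>+y\<in>- ball x\<^sub>0 r\<^sub>2. u y \<partial>\<mu> x)"

end

theory Submission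
  imports Defs
begin

text \<open>Testing the equation with \<open>\<eta>\<^sup>2 (u - k)\<^sub>+\<close> gives a Caccioppoli inequality and, with the Faber-Krahn
  inequality that follows from the Poincare inequality, a De Giorgi lemma for \<open>u\<close> and for \<open>-u\<close>.
  Testing with \<open>\<eta>\<^sup>2 / u\<close> bounds the form of \<open>log u\<close> on \<open>B\<^sub>\<rho>\<close> and, at the same time, the integral of
  \<open>u\<^sub>+(y) / u(x)\<close> over \<open>x \<in> B\<^sub>\<rho>\<close> and \<open>y\<close> far away. The first bound turns largeness of \<open>u\<close> on a fixed
  portion of \<open>B\<^sub>\<rho>\<close> into a pointwise lower bound on \<open>B\<^sub>2\<^sub>\<rho>\<close>, with a loss of a factor \<open>2\<^sup>-\<^sup>D\<close> when that
  portion is everything; the second one, with UJS, bounds the tail of \<open>u\<^sub>+\<close> by the local supremum.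

  Adding a constant \<open>\<tau>\<close> slightly larger than \<open>(r/R)\<^sup>\<alpha> Tail(u\<^sub>-)\<close> to \<open>u\<close> makes the tail of the negative
  part harmless. Let \<open>S\<close> be the supremum of \<open>(2r - \<bar>x - x\<^sub>0\<bar>)\<^sup>D u(x)\<close> over \<open>B\<^sub>2\<^sub>r\<close>, nearly attained at
  \<open>x\<^sub>1\<close>. In a ball around \<open>x\<^sub>1\<close> with radius comparable to \<open>2r - \<bar>x\<^sub>1 - x\<^sub>0\<bar>\<close> the function is bounded by a
  multiple of its size at \<open>x\<^sub>1\<close>, so the De Giorgi lemma shows that it is comparably large on a fixed
  portion of that ball. Expanding this positivity up to radius \<open>3r\<close> costs exactly the weight, hence
  \<open>u \<ge> c S r\<^sup>-\<^sup>D \<ge> c sup u\<close> on \<open>B\<^sub>r\<close>.\<close>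

section \<open>Jump forms and the Faber-Krahn inequality\<close>

text \<open>No pointwise lower bound on K is assumed, so positivity cannot be read off from single
  jumps: it can spread only through the Poincare inequality. This is why the passage from a fraction
  of a ball to a pointwise bound goes through log u, and why the gain in the De Giorgi iteration is
  a shrinking Faber-Krahn radius instead of a Sobolev exponent. The obstacle on the other side is
  the upper bound. De Giorgi's lemma for u involves the tail of \<open>u\<^sub>+\<close>, while only
  the tail of \<open>u\<^sub>-\<close> is allowed in the result. At an individual point x that tail
  is not controlled; UJS replaces x by an average over nearby points, and only for such averages
  does the test function \<eta>^2/u give a bound. It is a bound relative to u, hence useful only
  where the local supremum is comparable to a known size of u. A near-maximum point of a weighted u
  has exactly this property, so no integral crossover between positive and negative powers of u is
  required. Since \<gamma> must not depend on E and K, every quantitative step fixes its constant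
  first and is then stated for all J and E.\<close>

definition form_on :: "('a::euclidean_space \<times> 'a) measure \<Rightarrow> 'a set \<Rightarrow> ('a \<Rightarrow> real) \<Rightarrow> ennreal" where
  "form_on J D v = (\<integral>\<^sup>+p. ennreal ((v (fst p) - v (snd p))\<^sup>2) * indicator (D \<times> D) p \<partial>J)"

text \<open>Counterpart of \<open>H_loc\<close> for Borel representatives: increments of
  \<open>v\<close> are then measurable on the product space, and one measure \<open>J\<close> can
  carry all the forms.\<close>

definition loc_space :: "('a::euclidean_space \<times> 'a) measure \<Rightarrow> 'a set \<Rightarrow> ('a \<Rightarrow> real) \<Rightarrow> bool" where
  "loc_space J E v \<longleftrightarrow> v \<in> borel_measurable borel \<and>
     (\<forall>D. open D \<and> closure D \<subseteq> E \<longrightarrow>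
        (\<integral>\<^sup>+x\<in>D. ennreal ((v x)\<^sup>2) \<partial>lborel) < \<infinity> \<and> form_on J D v < \<infinity>)"

section \<open>Cutoff functions and elementary integration\<close>

definition cutoff :: "'a::euclidean_space \<Rightarrow> real \<Rightarrow> real \<Rightarrow> 'a \<Rightarrow> real" where
  "cutoff x\<^sub>0 a b x = max 0 (min 1 ((b - dist x\<^sub>0 x) / (b - a)))"

lemma cutoff_measurable [measurable]: "cutoff x\<^sub>0 a b \<in> borel_measurable borel"
  unfolding cutoff_def by measurable

lemma ball_measurable [measurable]: "ball x r \<in> sets borel"
  by simp

text \<open>The centre of the ball moves with the variable of integration; Tonelli requires this in
  \<open>faber_krahn\<close>, where balls are integrated over their centres.\<close>

lemma indicator_ball_measurable [measurable]:
  fixes f g :: "'b \<Rightarrow> 'a::euclidean_space"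
  assumes [measurable]: "f \<in> borel_measurable M" "g \<in> borel_measurable M"
  shows "(\<lambda>x. indicator (ball (f x) s) (g x) :: ennreal) \<in> borel_measurable M"
proof -
  have "(\<lambda>x. indicator (ball (f x) s) (g x) :: ennreal) = (\<lambda>x. indicator {..<s} (dist (f x) (g x)))"
    by (auto simp: fun_eq_iff split: split_indicator)
  then show ?thesis by simp
qed

lemma cutoff_range: "0 \<le> cutoff x\<^sub>0 a b x" "cutoff x\<^sub>0 a b x \<le> 1"
  unfolding cutoff_def by auto

lemma cutoff_eq_1: "a < b \<Longrightarrow> dist x\<^sub>0 x \<le> a \<Longrightarrow> cutoff x\<^sub>0 a b x = 1"
  unfolding cutoff_def by (auto simp: min_def max_def field_simps)

lemma cutoff_eq_0: "a < b \<Longrightarrow> b \<le> dist x\<^sub>0 x \<Longrightarrow> cutoff x\<^sub>0 a b x = 0"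
  unfolding cutoff_def by (auto simp: min_def max_def field_simps)

text \<open>Quadratic near the diagonal and bounded away from it: this is the shape that a jump
  measure of order \<alpha> < 2 can integrate, see \<open>decay_square\<close>.\<close>

lemma cutoff_diff_square:
  assumes "a < b"
  shows "(cutoff x\<^sub>0 a b x - cutoff x\<^sub>0 a b y)\<^sup>2 \<le> min 1 ((dist x y / (b - a))\<^sup>2)"
proof -
  let ?g = "\<lambda>x. (b - dist x\<^sub>0 x) / (b - a)"
  have "\<bar>dist x\<^sub>0 x - dist x\<^sub>0 y\<bar> \<le> dist x y"
    by (metis abs_dist_diff_le dist_commute)
  moreover have "?g x - ?g y = (dist x\<^sub>0 y - dist x\<^sub>0 x) / (b - a)"
    by (simp add: diff_divide_distrib)
  ultimately have "\<bar>?g x - ?g y\<bar> \<le> dist x y / (b - a)"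
    using assms by (simp add: abs_divide divide_right_mono)
  moreover have "\<bar>cutoff x\<^sub>0 a b x - cutoff x\<^sub>0 a b y\<bar> \<le> \<bar>?g x - ?g y\<bar>"
    unfolding cutoff_def by (auto simp: min_def max_def abs_if)
  ultimately have "\<bar>cutoff x\<^sub>0 a b x - cutoff x\<^sub>0 a b y\<bar> \<le> dist x y / (b - a)" by linarith
  then have "(cutoff x\<^sub>0 a b x - cutoff x\<^sub>0 a b y)\<^sup>2 \<le> (dist x y / (b - a))\<^sup>2"
    by (meson abs_ge_zero order_trans power2_le_iff_abs_le)
  moreover have "\<bar>cutoff x\<^sub>0 a b x - cutoff x\<^sub>0 a b y\<bar> \<le> 1"
    using cutoff_range[of x\<^sub>0 a b x] cutoff_range[of x\<^sub>0 a b y] by linarith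
  then have "(cutoff x\<^sub>0 a b x - cutoff x\<^sub>0 a b y)\<^sup>2 \<le> 1"
    by (simp add: abs_square_le_1)
  ultimately show ?thesis by simp
qed

text \<open>Turns a tested equation into an estimate. If the integral of \<open>U\<close> is
  infinite the claim is trivial; otherwise \<open>U - P\<close> is integrable, dominates
  \<open>Q\<close> and has the same integral as \<open>U\<close>. Finiteness of the integral of
  \<open>Q\<close> is a consequence and need not be known beforehand.\<close>

lemma nn_integral_le_of_integral_zero:
  fixes P Q U :: "'b \<Rightarrow> real"
  assumes P: "integrable M P" "integral\<^sup>L M P = 0"
    and [measurable]: "Q \<in> borel_measurable M" "U \<in> borel_measurable M"
    and Q0: "\<And>x. 0 \<le> Q x" and U0: "\<And>x. 0 \<le> U x" and le: "\<And>x. P x \<le> U x - Q x"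
  shows "(\<integral>\<^sup>+x. ennreal (Q x) \<partial>M) \<le> (\<integral>\<^sup>+x. ennreal (U x) \<partial>M)"
proof (cases "(\<integral>\<^sup>+x. ennreal (U x) \<partial>M) < \<infinity>")
  case True
  then have U: "integrable M U"
    by (intro integrableI_nonneg) (auto simp: U0)
  have UP: "integrable M (\<lambda>x. U x - P x)" using U P(1) by simp
  have ge: "0 \<le> U x - P x" for x using le[of x] Q0[of x] by linarith
  have "(\<integral>\<^sup>+x. ennreal (Q x) \<partial>M) \<le> (\<integral>\<^sup>+x. ennreal (U x - P x) \<partial>M)"
    by (intro nn_integral_mono ennreal_leI) (use le in \<open>auto simp: algebra_simps\<close>)
  also have "\<dots> = ennreal (integral\<^sup>L M (\<lambda>x. U x - P x))"
    by (rule nn_integral_eq_integral[OF UP]) (use ge in simp)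
  also have "integral\<^sup>L M (\<lambda>x. U x - P x) = integral\<^sup>L M U"
    using U P by simp
  also have "ennreal \<dots> = (\<integral>\<^sup>+x. ennreal (U x) \<partial>M)"
    by (rule nn_integral_eq_integral[symmetric, OF U]) (auto simp: U0)
  finally show ?thesis .
next
  case False
  then show ?thesis by (simp add: less_top[symmetric])
qed

lemma form_on_UNIV: "form_on J UNIV v = (\<integral>\<^sup>+p. ennreal ((v (fst p) - v (snd p))\<^sup>2) \<partial>J)"
  unfolding form_on_def by simp

lemma emeasure_ball_eq:
  fixes x :: "'a::euclidean_space"
  assumes "r \<ge> 0"
  shows "emeasure lborel (ball x r) = ennreal (unit_ball_vol (DIM('a)) * r ^ DIM('a))"
  using emeasure_ball[OF assms] .

text \<open>The sum of the geometric series of ratio \<open>2 powr (\<alpha> - 2)\<close> produced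
  by the dyadic layers in \<open>decay_square\<close>; it blows up as \<alpha> tends to 2.\<close>

definition decay_const :: "real \<Rightarrow> real \<Rightarrow> real" where
  "decay_const \<alpha> C = C * 2 powr \<alpha> / (1 - 2 powr (\<alpha> - 2))"

lemma decay_const_pos: "0 < \<alpha> \<Longrightarrow> \<alpha> < 2 \<Longrightarrow> 1 \<le> C \<Longrightarrow> 0 < decay_const \<alpha> C"
  unfolding decay_const_def by (simp add: powr_less_one)

text \<open>\<open>J\<close> plays the role of \<open>K(x,y) dx dy\<close>, so that the local forms \<open>\<E>\<^sub>D\<close> become integrals
  over \<open>D \<times> D\<close>. The assumption \<open>upper\<close> is the bound \<open>K(x,y) \<le> C r\<^sup>-\<^sup>\<alpha>\<^sup>-\<^sup>N\<close> for \<open>\<bar>x - y\<bar> \<ge> r\<close> and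
  \<open>ujs\<close> is the UJS inequality for \<open>x \<in> ball x\<^sub>1 \<rho>\<close> and \<open>y \<notin> ball x\<^sub>1 (6\<rho>)\<close>, both tested against
  products \<open>f(x) g(y)\<close>. In \<open>poincare\<close> the mean value may be replaced by any constant.\<close>

locale jump_form =
  fixes J :: "('a::euclidean_space \<times> 'a) measure" and \<alpha> C :: real and E :: "'a set"
  assumes sets_J [measurable_cong]: "sets J = sets (borel \<Otimes>\<^sub>M borel)"
    and sigma_finite_J: "sigma_finite_measure J"
    and swap: "\<And>F :: 'a \<times> 'a \<Rightarrow> ennreal. F \<in> borel_measurable (borel \<Otimes>\<^sub>M borel) \<Longrightarrow>
        (\<integral>\<^sup>+p. F (snd p, fst p) \<partial>J) = (\<integral>\<^sup>+p. F p \<partial>J)"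
    and AE_fst: "\<And>P. (AE x in lborel. P x) \<Longrightarrow> (AE p in J. P (fst p))"
    and bounded_E: "bounded E"
    and \<alpha>: "0 < \<alpha>" "\<alpha> < 2" and C: "1 \<le> C"
    and decay: "\<And>(f :: 'a \<Rightarrow> ennreal) r. f \<in> borel_measurable borel \<Longrightarrow> 0 < r \<Longrightarrow>
        (\<integral>\<^sup>+p. f (fst p) * indicator {p. r \<le> dist (fst p) (snd p)} p \<partial>J)
          \<le> ennreal (C * r powr (-\<alpha>)) * (\<integral>\<^sup>+x. f x \<partial>lborel)"
    and upper: "\<And>(f :: 'a \<Rightarrow> ennreal) (g :: 'a \<Rightarrow> ennreal) r.
        f \<in> borel_measurable borel \<Longrightarrow> g \<in> borel_measurable borel \<Longrightarrow> 0 < r \<Longrightarrow>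
        (\<integral>\<^sup>+p. f (fst p) * g (snd p) * indicator {p. r \<le> dist (fst p) (snd p)} p \<partial>J)
          \<le> ennreal (C * r powr (-\<alpha>) / r ^ DIM('a)) * ((\<integral>\<^sup>+x. f x \<partial>lborel) * (\<integral>\<^sup>+x. g x \<partial>lborel))"
    and ujs: "\<And>(f :: 'a \<Rightarrow> ennreal) (g :: 'a \<Rightarrow> ennreal) x\<^sub>1 \<rho>.
        f \<in> borel_measurable borel \<Longrightarrow> g \<in> borel_measurable borel \<Longrightarrow> 0 < \<rho> \<Longrightarrow>
        (\<integral>\<^sup>+p. f (fst p) * g (snd p) * indicator (ball x\<^sub>1 \<rho> \<times> - ball x\<^sub>1 (6 * \<rho>)) p \<partial>J)
          \<le> ennreal (C / \<rho> ^ DIM('a)) * ((\<integral>\<^sup>+x. f x \<partial>lborel) *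
             (\<integral>\<^sup>+p. g (snd p) * indicator (ball x\<^sub>1 (2 * \<rho>) \<times> - ball x\<^sub>1 (6 * \<rho>)) p \<partial>J))"
    and poincare: "\<And>x\<^sub>1 \<rho> v. 0 < \<rho> \<Longrightarrow> ball x\<^sub>1 \<rho> \<subseteq> E \<Longrightarrow> loc_space J E v \<Longrightarrow>
        \<exists>c::real. (\<integral>\<^sup>+x\<in>ball x\<^sub>1 \<rho>. ennreal ((v x - c)\<^sup>2) \<partial>lborel)
          \<le> ennreal (C * \<rho> powr \<alpha>) * form_on J (ball x\<^sub>1 \<rho>) v"
begin

abbreviation Cq :: real where "Cq \<equiv> decay_const \<alpha> C"

lemma Cq_pos: "Cq > 0"
  using \<alpha> C by (rule decay_const_pos)

text \<open>At distance about r / 2^i the square gains 4^-i whereas the decay estimate loses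
  2^(\<alpha> i); the layers are summable because \<alpha> < 2.\<close>

lemma decay_square:
  fixes f :: "'a \<Rightarrow> ennreal"
  assumes [measurable]: "f \<in> borel_measurable borel" and r: "0 < r"
  shows "(\<integral>\<^sup>+p. f (fst p) * ennreal (min 1 ((dist (fst p) (snd p) / r)\<^sup>2)) \<partial>J)
          \<le> ennreal (Cq * r powr (-\<alpha>)) * (\<integral>\<^sup>+x. f x \<partial>lborel)"
proof -
  let ?I = "\<lambda>i p. indicator {p. r / 2 ^ Suc i \<le> dist (fst p) (snd p)} (p :: 'a \<times> 'a) :: ennreal"
  have pw: "ennreal (min 1 ((dist (fst p) (snd p) / r)\<^sup>2)) \<le> (\<Sum>i. ennreal ((1/4) ^ i) * ?I i p)" for p :: "'a \<times> 'a"
  proof (cases "dist (fst p) (snd p) = 0")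
    case False
    define d where "d = dist (fst p) (snd p)"
    have d: "d > 0" using False unfolding d_def by simp
    have ex: "\<exists>i. r / 2 ^ Suc i \<le> d"
    proof -
      obtain i where "r / d < 2 ^ i" using real_arch_pow[of 2 "r/d"] by auto
      then have "r < d * 2 ^ i" using d by (simp add: divide_less_eq mult.commute)
      moreover have "0 \<le> d * 2 ^ i" using d by simp
      ultimately have "r \<le> d * 2 ^ Suc i" by (simp add: mult.left_commute)
      then show ?thesis by (intro exI[of _ i]) (simp add: field_simps)
    qed
    \<comment> \<open>The first layer containing the pair. Minimality gives
      \<open>d < r / 2 ^ i\<close> when \<open>i > 0\<close>, so this single term of the series
      already dominates the left-hand side.\<close>
    define i where "i = (LEAST i. r / 2 ^ Suc i \<le> d)"
    have i1: "r / 2 ^ Suc i \<le> d" unfolding i_def using ex by (rule LeastI_ex)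
    have "min 1 ((d / r)\<^sup>2) \<le> (1/4) ^ i"
    proof (cases i)
      case (Suc j)
      have "\<not> r / 2 ^ Suc j \<le> d" using not_less_Least[of j "\<lambda>i. r / 2 ^ Suc i \<le> d"] Suc i_def by simp
      then have "d / r \<le> (1/2) ^ i" using r Suc by (simp add: field_simps power_one_over)
      then have "(d / r)\<^sup>2 \<le> ((1/2) ^ i)\<^sup>2" using d r by (intro power_mono) auto
      also have "\<dots> = (1/4) ^ i" by (simp add: power2_eq_square flip: power_mult_distrib)
      finally show ?thesis by simp
    qed simp
    then have "ennreal (min 1 ((d / r)\<^sup>2)) \<le> ennreal ((1/4) ^ i) * ?I i p"
      using i1 by (simp add: d_def ennreal_leI)
    also have "\<dots> \<le> (\<Sum>i. ennreal ((1/4) ^ i) * ?I i p)"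
    proof -
      define g where "g = (\<lambda>i. ennreal ((1/4) ^ i) * ?I i p)"
      have "g i \<le> suminf g" using sum_le_suminf[of g "{i}"] by simp
      then show ?thesis unfolding g_def .
    qed
    finally show ?thesis unfolding d_def .
  qed simp
  define q where "q = 2 powr (\<alpha> - 2)"
  have q: "0 < q" "q < 1" unfolding q_def using \<alpha> by (auto simp: powr_less_one)
  have "(\<integral>\<^sup>+p. f (fst p) * ennreal (min 1 ((dist (fst p) (snd p) / r)\<^sup>2)) \<partial>J)
     \<le> (\<integral>\<^sup>+p. (\<Sum>i. ennreal ((1/4) ^ i) * (f (fst p) * ?I i p)) \<partial>J)"
  proof (intro nn_integral_mono)
    fix p :: "'a \<times> 'a"
    have "f (fst p) * ennreal (min 1 ((dist (fst p) (snd p) / r)\<^sup>2)) \<le> f (fst p) * (\<Sum>i. ennreal ((1/4) ^ i) * ?I i p)"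
      by (intro mult_left_mono pw) simp
    also have "\<dots> = (\<Sum>i. f (fst p) * (ennreal ((1/4) ^ i) * ?I i p))"
      by (rule ennreal_suminf_cmult[symmetric])
    finally show "f (fst p) * ennreal (min 1 ((dist (fst p) (snd p) / r)\<^sup>2)) \<le> (\<Sum>i. ennreal ((1/4) ^ i) * (f (fst p) * ?I i p))"
      by (simp add: mult.left_commute)
  qed
  also have "\<dots> = (\<Sum>i. \<integral>\<^sup>+p. ennreal ((1/4) ^ i) * (f (fst p) * ?I i p) \<partial>J)"
    by (rule nn_integral_suminf) measurable
  also have "\<dots> = (\<Sum>i. ennreal ((1/4) ^ i) * (\<integral>\<^sup>+p. (f (fst p) * ?I i p) \<partial>J))"
    by (intro suminf_cong nn_integral_cmult) measurable
  also have "\<dots> \<le> (\<Sum>i. ennreal (C * 2 powr \<alpha> * r powr (-\<alpha>) * q ^ i) * (\<integral>\<^sup>+x. f x \<partial>lborel))"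
  proof (intro suminf_le)
    fix i :: nat
    have "ennreal ((1/4) ^ i) * (\<integral>\<^sup>+p. (f (fst p) * ?I i p) \<partial>J)
       \<le> ennreal ((1/4) ^ i) * (ennreal (C * (r / 2 ^ Suc i) powr (-\<alpha>)) * (\<integral>\<^sup>+x. f x \<partial>lborel))"
      by (intro mult_left_mono decay) (use r in auto)
    also have "\<dots> = ennreal ((1/4) ^ i * (C * (r / 2 ^ Suc i) powr (-\<alpha>))) * (\<integral>\<^sup>+x. f x \<partial>lborel)"
      by (subst (2) ennreal_mult) (use C in \<open>auto simp: mult.assoc\<close>)
    also have "(1/4) ^ i * (C * (r / 2 ^ Suc i) powr (-\<alpha>)) = C * 2 powr \<alpha> * r powr (-\<alpha>) * q ^ i"
    proof -
      have "(r / 2 ^ Suc i) powr (-\<alpha>) = r powr (-\<alpha>) * 2 powr (\<alpha> * Suc i)"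
        using r by (simp add: powr_divide powr_minus field_simps powr_realpow[symmetric] powr_powr del: power_Suc)
      moreover have "q ^ i = 2 powr ((\<alpha> - 2) * i)"
        unfolding q_def by (simp add: powr_realpow[symmetric] powr_powr)
      moreover have "(1/4::real) ^ i = 2 powr (-2 * real i)"
      proof -
        have "2 powr (-2 * real i) = (2 powr (-2)) powr real i" by (simp only: powr_powr)
        also have "2 powr (-2) = (1/4::real)" by (simp add: powr_minus)
        also have "(1/4::real) powr real i = (1/4) ^ i" by (rule powr_realpow) simp
        finally show ?thesis ..
      qed
      ultimately show ?thesis by (simp add: powr_add[symmetric] algebra_simps)
    qed
    finally show "ennreal ((1/4) ^ i) * (\<integral>\<^sup>+p. (f (fst p) * ?I i p) \<partial>J) \<le> ennreal (C * 2 powr \<alpha> * r powr (-\<alpha>) * q ^ i) * (\<integral>\<^sup>+x. f x \<partial>lborel)" .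
  qed auto
  also have "\<dots> = (\<Sum>i. ennreal (C * 2 powr \<alpha> * r powr (-\<alpha>) * q ^ i)) * (\<integral>\<^sup>+x. f x \<partial>lborel)"
    by simp
  also have "(\<Sum>i. ennreal (C * 2 powr \<alpha> * r powr (-\<alpha>) * q ^ i)) = ennreal (Cq * r powr (-\<alpha>))"
  proof (rule suminf_ennreal_eq)
    show "0 \<le> C * 2 powr \<alpha> * r powr (-\<alpha>) * q ^ i" for i using C q by simp
    have "(\<lambda>i. C * 2 powr \<alpha> * r powr (-\<alpha>) * q ^ i) sums (C * 2 powr \<alpha> * r powr (-\<alpha>) * (1 / (1 - q)))"
      using q by (intro sums_mult geometric_sums) simp
    then show "(\<lambda>i. C * 2 powr \<alpha> * r powr (-\<alpha>) * q ^ i) sums (Cq * r powr (-\<alpha>))"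
      by (simp add: decay_const_def q_def mult_ac)
  qed
  finally show ?thesis .
qed

lemma decay_cutoff:
  fixes f :: "'a \<Rightarrow> ennreal"
  assumes [measurable]: "f \<in> borel_measurable borel" and ab: "a < b"
  shows "(\<integral>\<^sup>+p. f (fst p) * ennreal ((cutoff x\<^sub>0 a b (fst p) - cutoff x\<^sub>0 a b (snd p))\<^sup>2) \<partial>J)
          \<le> ennreal (Cq * (b - a) powr (-\<alpha>)) * (\<integral>\<^sup>+x. f x \<partial>lborel)"
proof -
  have "(\<integral>\<^sup>+p. f (fst p) * ennreal ((cutoff x\<^sub>0 a b (fst p) - cutoff x\<^sub>0 a b (snd p))\<^sup>2) \<partial>J)
     \<le> (\<integral>\<^sup>+p. f (fst p) * ennreal (min 1 ((dist (fst p) (snd p) / (b - a))\<^sup>2)) \<partial>J)"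
    by (intro nn_integral_mono mult_left_mono ennreal_leI cutoff_diff_square ab) simp
  also have "\<dots> \<le> ennreal (Cq * (b - a) powr (-\<alpha>)) * (\<integral>\<^sup>+x. f x \<partial>lborel)"
    using ab by (intro decay_square) auto
  finally show ?thesis .
qed

text \<open>On \<open>Z\<close> the integrand of the Poincare inequality equals
  \<open>c\<^sup>2\<close>, so the size of \<open>Z\<close> controls \<open>c\<^sup>2\<close> on the
  whole ball; then v^2 <= 2 (v - c)^2 + 2 c^2.\<close>

lemma poincare_vanishing:
  assumes v: "loc_space J E v" and \<rho>: "0 < \<rho>" and B: "ball x\<^sub>1 \<rho> \<subseteq> E"
    and Z: "Z \<in> sets borel" "Z \<subseteq> ball x\<^sub>1 \<rho>" "\<And>x. x \<in> Z \<Longrightarrow> v x = 0"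
    and \<mu>: "0 < \<mu>" "\<mu> \<le> 1" and ZB: "ennreal \<mu> * emeasure lborel (ball x\<^sub>1 \<rho>) \<le> emeasure lborel Z"
  shows "(\<integral>\<^sup>+x\<in>ball x\<^sub>1 \<rho>. ennreal ((v x)\<^sup>2) \<partial>lborel)
          \<le> ennreal (4 / \<mu> * C * \<rho> powr \<alpha>) * form_on J (ball x\<^sub>1 \<rho>) v"
proof -
  obtain c where c: "(\<integral>\<^sup>+x\<in>ball x\<^sub>1 \<rho>. ennreal ((v x - c)\<^sup>2) \<partial>lborel)
          \<le> ennreal (C * \<rho> powr \<alpha>) * form_on J (ball x\<^sub>1 \<rho>) v" (is "?I \<le> ?R")
    using poincare[OF \<rho> B v] by blast
  have [measurable]: "v \<in> borel_measurable borel" using v by (simp add: loc_space_def)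
  note [measurable] = Z(1)
  have "ennreal (c\<^sup>2) * emeasure lborel Z = (\<integral>\<^sup>+x. ennreal (c\<^sup>2) * indicator Z x \<partial>lborel)"
    by (subst nn_integral_cmult_indicator) auto
  also have "\<dots> \<le> ?I"
    by (intro nn_integral_mono) (use Z in \<open>auto split: split_indicator\<close>)
  finally have cZ: "ennreal (c\<^sup>2) * emeasure lborel Z \<le> ?I" .
  have "ennreal (c\<^sup>2) * emeasure lborel (ball x\<^sub>1 \<rho>) = ennreal (1/\<mu>) * (ennreal (c\<^sup>2) * (ennreal \<mu> * emeasure lborel (ball x\<^sub>1 \<rho>)))"
    using \<mu> by (simp add: mult.assoc[symmetric] ennreal_mult[symmetric])
  also have "\<dots> \<le> ennreal (1/\<mu>) * ?I"
    by (intro mult_left_mono order_trans[OF mult_left_mono[OF ZB] cZ]) auto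
  finally have cB: "ennreal (c\<^sup>2) * emeasure lborel (ball x\<^sub>1 \<rho>) \<le> ennreal (1/\<mu>) * ?I" .
  have "(\<integral>\<^sup>+x\<in>ball x\<^sub>1 \<rho>. ennreal ((v x)\<^sup>2) \<partial>lborel)
      \<le> (\<integral>\<^sup>+x. 2 * (ennreal ((v x - c)\<^sup>2) * indicator (ball x\<^sub>1 \<rho>) x) + 2 * (ennreal (c\<^sup>2) * indicator (ball x\<^sub>1 \<rho>) x) \<partial>lborel)"
  proof (intro nn_integral_mono)
    fix x
    have "(v x)\<^sup>2 \<le> 2 * (v x - c)\<^sup>2 + 2 * c\<^sup>2"
      using zero_le_power2[of "v x - 2 * c"] by (simp add: power2_eq_square algebra_simps)
    then have "ennreal ((v x)\<^sup>2) \<le> ennreal (2 * (v x - c)\<^sup>2 + 2 * c\<^sup>2)" by (rule ennreal_leI)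
    also have "\<dots> = 2 * ennreal ((v x - c)\<^sup>2) + 2 * ennreal (c\<^sup>2)"
      by (simp add: ennreal_plus ennreal_mult)
    finally show "ennreal ((v x)\<^sup>2) * indicator (ball x\<^sub>1 \<rho>) x \<le> 2 * (ennreal ((v x - c)\<^sup>2) * indicator (ball x\<^sub>1 \<rho>) x) + 2 * (ennreal (c\<^sup>2) * indicator (ball x\<^sub>1 \<rho>) x)"
      by (auto split: split_indicator)
  qed
  also have "\<dots> = 2 * ?I + 2 * (ennreal (c\<^sup>2) * emeasure lborel (ball x\<^sub>1 \<rho>))"
    by (simp add: nn_integral_add nn_integral_cmult nn_integral_cmult_indicator)
  also have "\<dots> \<le> 2 * ?I + 2 * (ennreal (1/\<mu>) * ?I)"
    by (intro add_left_mono mult_left_mono cB) simp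
  also have "\<dots> = ennreal (2 + 2/\<mu>) * ?I"
  proof -
    have "ennreal (2 + 2/\<mu>) = 2 + 2 * ennreal (1/\<mu>)"
      using \<mu> ennreal_mult[of 2 "1/\<mu>"] by simp
    then show ?thesis by (simp add: distrib_right mult.assoc)
  qed
  also have "\<dots> \<le> ennreal (4/\<mu>) * ?R"
    using \<mu> by (intro mult_mono c ennreal_leI) (auto simp: field_simps)
  also have "\<dots> = ennreal (4 / \<mu> * C * \<rho> powr \<alpha>) * form_on J (ball x\<^sub>1 \<rho>) v"
    using \<mu> C by (simp add: mult.assoc[symmetric] ennreal_mult[symmetric])
  finally show ?thesis .
qed

lemma form_on_mono: "D \<subseteq> D' \<Longrightarrow> form_on J D v \<le> form_on J D' v"
  unfolding form_on_def by (intro nn_integral_mono mult_left_mono) (auto split: split_indicator)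

lemma loc_spaceI:
  assumes "v \<in> borel_measurable borel" "(\<integral>\<^sup>+x. ennreal ((v x)\<^sup>2) \<partial>lborel) < \<infinity>" "form_on J UNIV v < \<infinity>"
  shows "loc_space J E v"
  unfolding loc_space_def
proof (intro conjI allI impI)
  fix D
  have "(\<integral>\<^sup>+x\<in>D. ennreal ((v x)\<^sup>2) \<partial>lborel) \<le> (\<integral>\<^sup>+x. ennreal ((v x)\<^sup>2) \<partial>lborel)"
    by (intro nn_integral_mono) (auto split: split_indicator)
  then show "(\<integral>\<^sup>+x\<in>D. ennreal ((v x)\<^sup>2) \<partial>lborel) < \<infinity>" using assms(2) by (rule le_less_trans)
  show "form_on J D v < \<infinity>" using form_on_mono[of D UNIV v] assms(3) by (meson le_less_trans subset_UNIV)
qed (use assms in auto)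

text \<open>The Poincare inequalities on the balls \<open>ball z s\<close>, on each of which \<open>v\<close> vanishes on at
  least half of the volume, are integrated over all centres \<open>z\<close>; this replaces a covering argument.\<close>

lemma faber_krahn:
  assumes [measurable]: "v \<in> borel_measurable borel"
    and v2: "(\<integral>\<^sup>+x. ennreal ((v x)\<^sup>2) \<partial>lborel) < \<infinity>" and vf: "form_on J UNIV v < \<infinity>"
    and supp: "\<And>x. x \<notin> ball x\<^sub>1 \<rho> \<Longrightarrow> v x = 0" and s: "0 < s" and E: "ball x\<^sub>1 (\<rho> + 2 * s) \<subseteq> E"
    and small: "2 * emeasure lborel {x. v x \<noteq> 0} \<le> emeasure lborel (ball (0::'a) s)"
  shows "(\<integral>\<^sup>+x. ennreal ((v x)\<^sup>2) \<partial>lborel) \<le> ennreal (8 * C * s powr \<alpha>) * form_on J UNIV v"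
proof -
  interpret J: sigma_finite_measure J by (rule sigma_finite_J)
  have ps1: "pair_sigma_finite (lborel :: 'a measure) J"
    by (intro pair_sigma_finite.intro sigma_finite_lborel sigma_finite_J)
  have v_loc: "loc_space J E v" by (rule loc_spaceI) (use v2 vf in auto)
  define V where "V = unit_ball_vol (DIM('a)) * s ^ DIM('a)"
  have V: "V > 0" unfolding V_def using s by simp
  have eB: "emeasure lborel (ball z s) = ennreal V" for z :: 'a
    unfolding V_def using s by (intro emeasure_ball_eq) simp
  \<comment> \<open>Balls centred in \<open>ball x\<^sub>1 (\<rho> + s)\<close> stay in
    \<open>E\<close>, which is the origin of the radius \<open>\<rho> + 2 * s\<close>; all other
    balls of radius \<open>s\<close> miss the region where \<open>v\<close> is nonzero.\<close>
  have z: "(\<integral>\<^sup>+x\<in>ball z s. ennreal ((v x)\<^sup>2) \<partial>lborel) \<le> ennreal (8 * C * s powr \<alpha>) * form_on J (ball z s) v" for z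
  proof (cases "z \<in> ball x\<^sub>1 (\<rho> + s)")
    case True
    have "ball z s \<subseteq> ball x\<^sub>1 (\<rho> + 2 * s)"
    proof
      fix x assume "x \<in> ball z s"
      then show "x \<in> ball x\<^sub>1 (\<rho> + 2 * s)" using True dist_triangle[of x\<^sub>1 x z] by (simp)
    qed
    then have BE: "ball z s \<subseteq> E" using E by blast
    define A where "A = {x\<in>ball z s. v x \<noteq> 0}"
    define Z where "Z = {x\<in>ball z s. v x = 0}"
    have [measurable]: "A \<in> sets borel" "Z \<in> sets borel" unfolding A_def Z_def by measurable
    have "emeasure lborel A \<le> emeasure lborel {x. v x \<noteq> 0}"
      unfolding A_def by (intro emeasure_mono) auto
    then have "2 * emeasure lborel A \<le> ennreal V" using small eB
      by (metis (no_types, lifting) mult_left_mono order_trans zero_le)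
    moreover have "ennreal V = emeasure lborel A + emeasure lborel Z"
      unfolding eB[of z, symmetric]
      by (subst plus_emeasure) (auto simp: A_def Z_def intro!: arg_cong[where f="emeasure lborel"])
    ultimately have "ennreal (1/2) * emeasure lborel (ball z s) \<le> emeasure lborel Z"
    proof -
      assume a: "2 * emeasure lborel A \<le> ennreal V" and b: "ennreal V = emeasure lborel A + emeasure lborel Z"
      have "emeasure lborel A \<noteq> \<infinity>" "emeasure lborel Z \<noteq> \<infinity>" using b by (auto simp: top_unique dest: sym)
      then obtain p q where p: "emeasure lborel A = ennreal p" "p \<ge> 0" and q: "emeasure lborel Z = ennreal q" "q \<ge> 0"
        by (metis ennreal_cases infinity_ennreal_def)
      have "V = p + q" using b p q V by (metis add_nonneg_nonneg ennreal_inj ennreal_plus less_eq_real_def)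
      moreover have "2 * p \<le> V"
      proof -
        have "ennreal (2 * p) \<le> ennreal V" using a p by (simp add: ennreal_mult)
        then show ?thesis using V by (simp add: ennreal_le_iff)
      qed
      ultimately have "ennreal (1/2 * V) \<le> ennreal q" by (intro ennreal_leI) simp
      moreover have "ennreal (1/2 * V) = ennreal (1/2) * ennreal V"
        by (rule ennreal_mult) (use V in auto)
      ultimately show ?thesis unfolding eB q(1) by (simp only:)
    qed
    then have "(\<integral>\<^sup>+x\<in>ball z s. ennreal ((v x)\<^sup>2) \<partial>lborel) \<le> ennreal (4 / (1/2) * C * s powr \<alpha>) * form_on J (ball z s) v"
      by (intro poincare_vanishing[where Z = Z] v_loc s BE) (auto simp: Z_def)
    then show ?thesis by simp
  next
    case False
    have "v x = 0" if "x \<in> ball z s" for x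
    proof (rule supp)
      show "x \<notin> ball x\<^sub>1 \<rho>" using that False dist_triangle[of x\<^sub>1 z x] by (auto simp: dist_commute)
    qed
    then have "(\<integral>\<^sup>+x\<in>ball z s. ennreal ((v x)\<^sup>2) \<partial>lborel) = (\<integral>\<^sup>+x. 0 \<partial>(lborel::'a measure))"
      by (intro nn_integral_cong) (auto split: split_indicator)
    then show ?thesis by simp
  qed
  \<comment> \<open>A point x is covered by the balls whose centres fill \<open>ball x s\<close>, of
    volume \<open>V\<close>. On the side of the form, a pair p lies in \<open>ball z s\<close> only
    for centres in \<open>ball (fst p) s\<close>, again of volume \<open>V\<close>, so that the two
    factors cancel at the end.\<close>
  have "ennreal V * (\<integral>\<^sup>+x. ennreal ((v x)\<^sup>2) \<partial>lborel)
     = (\<integral>\<^sup>+x. (\<integral>\<^sup>+z. ennreal ((v x)\<^sup>2) * indicator (ball z s) x \<partial>lborel) \<partial>lborel)"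
  proof -
    have "(\<integral>\<^sup>+z. ennreal ((v x)\<^sup>2) * indicator (ball z s) x \<partial>lborel) = ennreal ((v x)\<^sup>2) * ennreal V" for x
    proof -
      have "(\<integral>\<^sup>+z. ennreal ((v x)\<^sup>2) * indicator (ball z s) x \<partial>lborel) = (\<integral>\<^sup>+z. ennreal ((v x)\<^sup>2) * indicator (ball x s) z \<partial>lborel)"
        by (intro nn_integral_cong) (auto split: split_indicator simp: dist_commute)
      then show ?thesis by (simp add: nn_integral_cmult_indicator eB)
    qed
    then show ?thesis by (simp add: nn_integral_multc) (rule mult.commute)
  qed
  also have "\<dots> = (\<integral>\<^sup>+z. (\<integral>\<^sup>+x. ennreal ((v x)\<^sup>2) * indicator (ball z s) x \<partial>lborel) \<partial>lborel)"
    by (rule lborel_pair.Fubini') measurable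
  also have "\<dots> \<le> (\<integral>\<^sup>+z. ennreal (8 * C * s powr \<alpha>) * form_on J (ball z s) v \<partial>lborel)"
    by (intro nn_integral_mono z)
  also have "\<dots> = ennreal (8 * C * s powr \<alpha>) * (\<integral>\<^sup>+z. (\<integral>\<^sup>+p. ennreal ((v (fst p) - v (snd p))\<^sup>2) * (indicator (ball z s) (fst p) * indicator (ball z s) (snd p)) \<partial>J) \<partial>lborel)"
    unfolding form_on_def indicator_times
    by (rule nn_integral_cmult) measurable
  also have "(\<integral>\<^sup>+z. (\<integral>\<^sup>+p. ennreal ((v (fst p) - v (snd p))\<^sup>2) * (indicator (ball z s) (fst p) * indicator (ball z s) (snd p)) \<partial>J) \<partial>lborel)
     = (\<integral>\<^sup>+p. (\<integral>\<^sup>+z. ennreal ((v (fst p) - v (snd p))\<^sup>2) * (indicator (ball z s) (fst p) * indicator (ball z s) (snd p)) \<partial>lborel) \<partial>J)"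
    by (rule pair_sigma_finite.Fubini'[OF ps1, symmetric]) measurable
  also have "\<dots> \<le> (\<integral>\<^sup>+p. ennreal ((v (fst p) - v (snd p))\<^sup>2) * ennreal V \<partial>J)"
  proof (intro nn_integral_mono)
    fix p :: "'a \<times> 'a"
    have "(\<integral>\<^sup>+z. ennreal ((v (fst p) - v (snd p))\<^sup>2) * (indicator (ball z s) (fst p) * indicator (ball z s) (snd p)) \<partial>lborel)
       \<le> (\<integral>\<^sup>+z. ennreal ((v (fst p) - v (snd p))\<^sup>2) * indicator (ball (fst p) s) z \<partial>lborel)"
      by (intro nn_integral_mono mult_left_mono) (auto split: split_indicator simp: dist_commute)
    then show "(\<integral>\<^sup>+z. ennreal ((v (fst p) - v (snd p))\<^sup>2) * (indicator (ball z s) (fst p) * indicator (ball z s) (snd p)) \<partial>lborel) \<le> ennreal ((v (fst p) - v (snd p))\<^sup>2) * ennreal V"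
      by (simp add: nn_integral_cmult_indicator eB)
  qed
  also have "\<dots> = ennreal V * form_on J UNIV v"
    unfolding form_on_UNIV by (subst nn_integral_multc) (auto simp: mult.commute)
  finally have "ennreal V * (\<integral>\<^sup>+x. ennreal ((v x)\<^sup>2) \<partial>lborel) \<le> ennreal V * (ennreal (8 * C * s powr \<alpha>) * form_on J UNIV v)"
    by (simp add: mult.left_commute mult_left_mono)
  then show ?thesis using V by (simp add: ennreal_mult_le_mult_iff)
qed

end

section \<open>Weak solutions and the Caccioppoli inequality\<close>

text \<open>Tested version of the statement that the integral of \<open>g\<close> over
  \<open>B\<close> against \<mu>(x,dy) is at most \<open>T\<close> for x in \<open>A\<close>. The
  measure \<open>J\<close> cannot see single points x, so a supremum over x has to be expressed
  through test functions \<open>f\<close>.\<close>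

definition tail_le ::
  "('a::euclidean_space \<times> 'a) measure \<Rightarrow> ('a \<Rightarrow> real) \<Rightarrow> 'a set \<Rightarrow> 'a set \<Rightarrow> real \<Rightarrow> bool" where
  "tail_le J g A B T \<longleftrightarrow> (\<forall>f :: 'a \<Rightarrow> ennreal. f \<in> borel_measurable borel \<longrightarrow>
     (\<integral>\<^sup>+p. f (fst p) * ennreal (g (snd p)) * indicator (A \<times> B) p \<partial>J) \<le> ennreal T * (\<integral>\<^sup>+x. f x \<partial>lborel))"

text \<open>Integrability over \<open>J\<close> is a premise on the test function: in that case the
  iterated integral of \<open>energy_form\<close> is an integral over \<open>J\<close>. For the test
  functions that occur below it is verified in \<open>weak_sol_test\<close>. Equality is demanded
  because sub- and supersolution inequalities are both present.\<close>

definition weak_sol :: "('a::euclidean_space \<times> 'a) measure \<Rightarrow> 'a set \<Rightarrow> ('a \<Rightarrow> real) \<Rightarrow> bool" where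
  "weak_sol J E w \<longleftrightarrow> loc_space J E w \<and>
     (\<forall>x R. 0 < R \<and> ball x R \<subseteq> E \<longrightarrow>
        (\<exists>T. tail_le J (\<lambda>y. \<bar>w y\<bar>) (ball x (7/8 * R)) (- ball x R) T)) \<and>
     (\<forall>\<phi>\<in>borel_measurable borel. (\<forall>x. 0 \<le> \<phi> x) \<and> (\<integral>\<^sup>+x. ennreal ((\<phi> x)\<^sup>2) \<partial>lborel) < \<infinity> \<and>
        form_on J UNIV \<phi> < \<infinity> \<and> closure {x. \<phi> x \<noteq> 0} \<subseteq> E \<and>
        integrable J (\<lambda>p. (w (fst p) - w (snd p)) * (\<phi> (fst p) - \<phi> (snd p))) \<longrightarrow>
        (LINT p|J. (w (fst p) - w (snd p)) * (\<phi> (fst p) - \<phi> (snd p))) = 0)"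

abbreviation far :: "real \<Rightarrow> ('a::metric_space \<times> 'a) set" where
  "far r \<equiv> {p. r \<le> dist (fst p) (snd p)}"

lemma power2_sum_le: "(a + b)\<^sup>2 \<le> 2 * a\<^sup>2 + 2 * b\<^sup>2" for a b :: real
  using zero_le_power2[of "a - b"] by (simp add: power2_sum power2_diff)

lemma Lipschitz_power2_le:
  fixes F :: "real \<Rightarrow> real"
  assumes "\<And>s t. \<bar>F s - F t\<bar> \<le> L * \<bar>s - t\<bar>"
  shows "(F t)\<^sup>2 \<le> 2 * (F 0)\<^sup>2 + 2 * L\<^sup>2 * t\<^sup>2"
proof -
  have "\<bar>F t\<bar> \<le> \<bar>F 0\<bar> + L * \<bar>t\<bar>" using assms[of t 0] by simp
  then have "(F t)\<^sup>2 \<le> (\<bar>F 0\<bar> + L * \<bar>t\<bar>)\<^sup>2" by (rule abs_le_square_iff[THEN iffD1, OF order_trans]) simp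
  also have "\<dots> \<le> 2 * \<bar>F 0\<bar>\<^sup>2 + 2 * (L * \<bar>t\<bar>)\<^sup>2" by (rule power2_sum_le)
  finally show ?thesis by (simp add: power_mult_distrib)
qed

lemma abs_mult_le_power2_add: "\<bar>a * b\<bar> \<le> a\<^sup>2 + b\<^sup>2" for a b :: real
proof -
  have "2 * \<bar>a * b\<bar> \<le> a\<^sup>2 + b\<^sup>2"
    using zero_le_power2[of "\<bar>a\<bar> - \<bar>b\<bar>"] by (simp add: power2_diff abs_mult)
  moreover have "0 \<le> \<bar>a * b\<bar>" by simp
  ultimately show ?thesis by linarith
qed

lemma ennreal_mult_indicat_real: "ennreal (a * indicat_real A x) = ennreal a * indicator A x"
  by (auto split: split_indicator)

lemma tail_leD:
  assumes "tail_le J g A B T" and [measurable]: "f \<in> borel_measurable borel" and f: "\<And>x. 0 \<le> f x"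
  shows "(\<integral>\<^sup>+p. ennreal (f (fst p) * g (snd p) * indicat_real (A \<times> B) p) \<partial>J)
     \<le> ennreal T * (\<integral>\<^sup>+x. ennreal (f x) \<partial>lborel)"
proof -
  have [measurable]: "(\<lambda>x. ennreal (f x)) \<in> borel_measurable borel" by measurable
  have "(\<integral>\<^sup>+p. ennreal (f (fst p)) * ennreal (g (snd p)) * indicator (A \<times> B) p \<partial>J) \<le> ennreal T * (\<integral>\<^sup>+x. ennreal (f x) \<partial>lborel)"
    using assms(1) unfolding tail_le_def by (elim allE[of _ "\<lambda>x. ennreal (f x)"] impE) measurable
  then show ?thesis using f by (simp add: ennreal_mult_indicat_real ennreal_mult')
qed

section \<open>Admissible test functions built from cutoffs\<close>

context jump_form
begin

lemma decay_fst:
  assumes [measurable]: "g \<in> borel_measurable borel" and r: "0 < r"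
  shows "(\<integral>\<^sup>+p. ennreal (g (fst p) * indicat_real (far r) p) \<partial>J)
     \<le> ennreal (C * r powr (-\<alpha>)) * (\<integral>\<^sup>+x. ennreal (g x) \<partial>lborel)"
  unfolding ennreal_mult_indicat_real by (rule decay) (use r in measurable)

lemma decay_snd:
  assumes [measurable]: "g \<in> borel_measurable borel" and r: "0 < r"
  shows "(\<integral>\<^sup>+p. ennreal (g (snd p) * indicat_real (far r) p) \<partial>J)
     \<le> ennreal (C * r powr (-\<alpha>)) * (\<integral>\<^sup>+x. ennreal (g x) \<partial>lborel)"
proof -
  have "(\<integral>\<^sup>+p. ennreal (g (snd p) * indicat_real (far r) p) \<partial>J)
      = (\<integral>\<^sup>+p. ennreal (g (fst p) * indicat_real (far r) p) \<partial>J)"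
    by (subst swap[symmetric]) (auto simp: dist_commute intro!: nn_integral_cong arg_cong[where f = ennreal] split: split_indicator)
  then show ?thesis using decay_fst[OF assms] by simp
qed

lemma decay_cutoff_real:
  assumes [measurable]: "f \<in> borel_measurable borel" and ab: "a < b" and f: "\<And>x. 0 \<le> f x"
  shows "(\<integral>\<^sup>+p. ennreal (f (fst p) * (cutoff x\<^sub>0 a b (fst p) - cutoff x\<^sub>0 a b (snd p))\<^sup>2) \<partial>J)
          \<le> ennreal (Cq * (b - a) powr (-\<alpha>)) * (\<integral>\<^sup>+x. ennreal (f x) \<partial>lborel)"
  using decay_cutoff[of "\<lambda>x. ennreal (f x)" a b x\<^sub>0] ab f by (simp add: ennreal_mult)

lemma Lipschitz_borel:
  assumes "\<And>s t. \<bar>F s - F t\<bar> \<le> L * \<bar>s - t\<bar>"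
  shows "(F :: real \<Rightarrow> real) \<in> borel_measurable borel"
proof -
  have "0 \<le> L" using order_trans[OF abs_ge_zero assms[of 0 1]] by simp
  then have "L-lipschitz_on UNIV F"
    using assms by (intro lipschitz_onI) (auto simp: dist_real_def)
  then show ?thesis
    by (intro borel_measurable_continuous_onI lipschitz_on_continuous_on)
qed

text \<open>\<open>\<zeta>\<close> will be the cutoff or its square, whence the factor 2. Pairs
  inside the slightly larger ball \<open>D\<close> are treated with the product rule; if one point
  lies in \<open>ball x\<^sub>0 b\<close> and the other outside \<open>D\<close>, their distance is
  bounded below and the decay estimate applies.\<close>

lemma cutoff_times_finite:
  assumes w: "loc_space J E w" and F: "\<And>s t. \<bar>F s - F t\<bar> \<le> L * \<bar>s - t\<bar>"
    and ab: "0 < a" "a < b" and E: "ball x\<^sub>0 (5/4 * b) \<subseteq> E"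
    and \<zeta>[measurable]: "\<zeta> \<in> borel_measurable borel" and \<zeta>01: "\<And>x. 0 \<le> \<zeta> x" "\<And>x. \<zeta> x \<le> 1"
    and \<zeta>0: "\<And>x. x \<notin> ball x\<^sub>0 b \<Longrightarrow> \<zeta> x = 0"
    and \<zeta>L: "\<And>x y. \<bar>\<zeta> x - \<zeta> y\<bar> \<le> 2 * \<bar>cutoff x\<^sub>0 a b x - cutoff x\<^sub>0 a b y\<bar>"
  defines "\<phi> \<equiv> \<lambda>x. \<zeta> x * F (w x)"
  shows "(\<integral>\<^sup>+x. ennreal ((\<phi> x)\<^sup>2) \<partial>lborel) < \<infinity>" "form_on J UNIV \<phi> < \<infinity>"
proof -
  have Lpos: "0 \<le> L" using order_trans[OF abs_ge_zero F[of 0 1]] by simp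
  define D where "D = ball x\<^sub>0 (8/7 * b)"
  have "closure D \<subseteq> cball x\<^sub>0 (8/7 * b)" unfolding D_def by (rule closure_minimal) auto
  also have "\<dots> \<subseteq> ball x\<^sub>0 (5/4 * b)" using ab by (auto simp: subset_iff)
  finally have clD: "closure D \<subseteq> E" using E by blast
  have [measurable]: "D \<in> sets borel" unfolding D_def by simp
  have [measurable]: "w \<in> borel_measurable borel" using w by (simp add: loc_space_def)
  have [measurable]: "F \<in> borel_measurable borel" by (rule Lipschitz_borel[OF F])
  have [measurable]: "\<phi> \<in> borel_measurable borel" unfolding \<phi>_def by measurable
  have w2: "(\<integral>\<^sup>+x\<in>D. ennreal ((w x)\<^sup>2) \<partial>lborel) < \<infinity>" and wf: "form_on J D w < \<infinity>"
    using w clD unfolding loc_space_def D_def by auto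
  have bD: "ball x\<^sub>0 b \<subseteq> D" unfolding D_def using ab by auto
  let ?f = "\<lambda>x. (F (w x))\<^sup>2 * indicat_real D x"
  have f2: "(\<integral>\<^sup>+x. ennreal (?f x) \<partial>lborel) < \<infinity>"
  proof -
    have "(\<integral>\<^sup>+x. ennreal (?f x) \<partial>lborel) \<le> (\<integral>\<^sup>+x. ennreal (2 * (F 0)\<^sup>2) * indicator D x + ennreal (2 * L\<^sup>2) * (ennreal ((w x)\<^sup>2) * indicator D x) \<partial>lborel)"
    proof (rule nn_integral_mono)
      fix x
      have "(F (w x))\<^sup>2 \<le> 2 * (F 0)\<^sup>2 + 2 * L\<^sup>2 * (w x)\<^sup>2" by (rule Lipschitz_power2_le[OF F])
      then have "ennreal ((F (w x))\<^sup>2) \<le> ennreal (2 * (F 0)\<^sup>2 + 2 * L\<^sup>2 * (w x)\<^sup>2)" by (rule ennreal_leI)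
      also have "\<dots> = ennreal (2 * (F 0)\<^sup>2) + ennreal (2 * L\<^sup>2) * ennreal ((w x)\<^sup>2)"
        by (simp add: ennreal_plus ennreal_mult[symmetric])
      finally show "ennreal (?f x) \<le> ennreal (2 * (F 0)\<^sup>2) * indicator D x + ennreal (2 * L\<^sup>2) * (ennreal ((w x)\<^sup>2) * indicator D x)"
        by (auto split: split_indicator)
    qed
    also have "\<dots> = ennreal (2 * (F 0)\<^sup>2) * emeasure lborel D + ennreal (2 * L\<^sup>2) * (\<integral>\<^sup>+x\<in>D. ennreal ((w x)\<^sup>2) \<partial>lborel)"
      by (simp add: nn_integral_add nn_integral_cmult nn_integral_cmult_indicator)
    also have "\<dots> < \<infinity>"
      using w2 ab by (simp add: D_def emeasure_ball_eq ennreal_mult_less_top ennreal_mult[symmetric])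
    finally show ?thesis .
  qed
  have \<phi>f: "(\<phi> x)\<^sup>2 \<le> ?f x" for x
  proof (cases "x \<in> ball x\<^sub>0 b")
    case True
    then have "x \<in> D" using bD by blast
    then show ?thesis using \<zeta>01[of x] mult_right_mono[of "(\<zeta> x)\<^sup>2" 1 "(F (w x))\<^sup>2"]
      by (simp add: \<phi>_def power_mult_distrib power_le_one)
  qed (simp add: \<phi>_def \<zeta>0)
  have "(\<integral>\<^sup>+x. ennreal ((\<phi> x)\<^sup>2) \<partial>lborel) \<le> (\<integral>\<^sup>+x. ennreal (?f x) \<partial>lborel)"
    by (intro nn_integral_mono ennreal_leI \<phi>f)
  then show \<phi>2: "(\<integral>\<^sup>+x. ennreal ((\<phi> x)\<^sup>2) \<partial>lborel) < \<infinity>" using f2 by (rule le_less_trans)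
  let ?c = "cutoff x\<^sub>0 a b"
  let ?B1 = "\<lambda>p. 2 * L\<^sup>2 * ((w (fst p) - w (snd p))\<^sup>2 * indicat_real (D \<times> D) p)"
  let ?B2 = "\<lambda>p. 8 * (?f (fst p) * (?c (fst p) - ?c (snd p))\<^sup>2)"
  let ?B3 = "\<lambda>p. (\<phi> (fst p))\<^sup>2 * indicat_real (far (b/7)) p"
  let ?B4 = "\<lambda>p. (\<phi> (snd p))\<^sup>2 * indicat_real (far (b/7)) p"
  have farp: "b/7 \<le> dist x y" if "x \<in> ball x\<^sub>0 b" "y \<notin> D" for x y
    using that dist_triangle[of x\<^sub>0 y x] by (auto simp: D_def)
  have pw: "(\<phi> (fst p) - \<phi> (snd p))\<^sup>2 \<le> ?B1 p + ?B2 p + ?B3 p + ?B4 p" for p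
  proof -
    obtain x y where p: "p = (x, y)" by fastforce
    consider "x \<in> D" "y \<in> D" | "x \<in> ball x\<^sub>0 b" "y \<notin> D" | "x \<notin> D" "y \<in> ball x\<^sub>0 b" | "x \<notin> ball x\<^sub>0 b" "y \<notin> ball x\<^sub>0 b"
      using bD by blast
    then show ?thesis
    proof cases
      case 1
      have "\<phi> x - \<phi> y = \<zeta> y * (F (w x) - F (w y)) + F (w x) * (\<zeta> x - \<zeta> y)"
        by (simp add: \<phi>_def algebra_simps)
      then have "(\<phi> x - \<phi> y)\<^sup>2 \<le> 2 * (\<zeta> y * (F (w x) - F (w y)))\<^sup>2 + 2 * (F (w x) * (\<zeta> x - \<zeta> y))\<^sup>2"
        using power2_sum_le by presburger
      moreover have "(\<zeta> y * (F (w x) - F (w y)))\<^sup>2 \<le> L\<^sup>2 * (w x - w y)\<^sup>2"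
      proof -
        have "\<bar>\<zeta> y * (F (w x) - F (w y))\<bar> \<le> 1 * (L * \<bar>w x - w y\<bar>)"
          unfolding abs_mult by (intro mult_mono F) (use \<zeta>01[of y] in auto)
        then have "\<bar>\<zeta> y * (F (w x) - F (w y))\<bar>\<^sup>2 \<le> (L * \<bar>w x - w y\<bar>)\<^sup>2" by (intro power_mono) auto
        then show ?thesis by (simp add: power_mult_distrib)
      qed
      moreover have "(F (w x) * (\<zeta> x - \<zeta> y))\<^sup>2 \<le> (F (w x))\<^sup>2 * (4 * (?c x - ?c y)\<^sup>2)"
      proof -
        have "\<bar>\<zeta> x - \<zeta> y\<bar>\<^sup>2 \<le> (2 * \<bar>?c x - ?c y\<bar>)\<^sup>2" by (intro power_mono \<zeta>L) auto
        then show ?thesis unfolding power_mult_distrib by (intro mult_left_mono) (auto simp: power_mult_distrib)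
      qed
      ultimately have "(\<phi> x - \<phi> y)\<^sup>2 \<le> ?B1 p + ?B2 p" using 1 p by simp
      moreover have "0 \<le> ?B3 p" "0 \<le> ?B4 p" by auto
      ultimately have "(\<phi> x - \<phi> y)\<^sup>2 \<le> ?B1 p + ?B2 p + ?B3 p + ?B4 p" by linarith
      then show ?thesis using p by simp
    next
      case 2
      then have "y \<notin> ball x\<^sub>0 b" using bD by blast
      then have "\<phi> y = 0" by (simp add: \<phi>_def \<zeta>0)
      then show ?thesis using 2 farp[of x y] p Lpos by (auto simp: indicator_def)
    next
      case 3
      then have "x \<notin> ball x\<^sub>0 b" using bD by blast
      then have "\<phi> x = 0" by (simp add: \<phi>_def \<zeta>0)
      then show ?thesis using 3 farp[of y x] p Lpos by (auto simp: indicator_def dist_commute)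
    next
      case 4
      then have "\<phi> x = 0" "\<phi> y = 0" by (auto simp: \<phi>_def \<zeta>0)
      then show ?thesis using p by auto
    qed
  qed
  have "form_on J UNIV \<phi> \<le> (\<integral>\<^sup>+p. ennreal (?B1 p) + ennreal (?B2 p) + ennreal (?B3 p) + ennreal (?B4 p) \<partial>J)"
    unfolding form_on_UNIV
  proof (rule nn_integral_mono)
    fix p
    have "ennreal ((\<phi> (fst p) - \<phi> (snd p))\<^sup>2) \<le> ennreal (?B1 p + ?B2 p + ?B3 p + ?B4 p)"
      by (rule ennreal_leI[OF pw])
    also have "\<dots> = ennreal (?B1 p) + ennreal (?B2 p) + ennreal (?B3 p) + ennreal (?B4 p)"
      by (subst ennreal_plus, simp, simp)+ simp
    finally show "ennreal ((\<phi> (fst p) - \<phi> (snd p))\<^sup>2) \<le> ennreal (?B1 p) + ennreal (?B2 p) + ennreal (?B3 p) + ennreal (?B4 p)" .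
  qed
  also have "\<dots> = (\<integral>\<^sup>+p. ennreal (?B1 p) \<partial>J) + (\<integral>\<^sup>+p. ennreal (?B2 p) \<partial>J) + (\<integral>\<^sup>+p. ennreal (?B3 p) \<partial>J) + (\<integral>\<^sup>+p. ennreal (?B4 p) \<partial>J)"
    by (simp add: nn_integral_add)
  also have "\<dots> < \<infinity>"
  proof -
    have "(\<integral>\<^sup>+p. ennreal (?B1 p) \<partial>J) = ennreal (2 * L\<^sup>2) * form_on J D w"
      unfolding form_on_def
      by (subst nn_integral_cmult[symmetric]) (measurable, auto simp: ennreal_mult ennreal_mult_indicat_real intro!: nn_integral_cong)
    then have 1: "(\<integral>\<^sup>+p. ennreal (?B1 p) \<partial>J) < \<infinity>" using wf by (simp add: ennreal_mult_less_top)
    have "(\<integral>\<^sup>+p. ennreal (?B2 p) \<partial>J) = 8 * (\<integral>\<^sup>+p. ennreal (?f (fst p) * (?c (fst p) - ?c (snd p))\<^sup>2) \<partial>J)"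
      by (subst nn_integral_cmult[symmetric]) (measurable, auto simp: ennreal_mult intro!: nn_integral_cong)
    also have "\<dots> \<le> 8 * (ennreal (Cq * (b - a) powr (-\<alpha>)) * (\<integral>\<^sup>+x. ennreal (?f x) \<partial>lborel))"
      by (intro mult_left_mono decay_cutoff_real[where f = ?f] ab) simp_all
    also have "\<dots> < \<infinity>" using f2 by (simp add: ennreal_mult_less_top)
    finally have 2: "(\<integral>\<^sup>+p. ennreal (?B2 p) \<partial>J) < \<infinity>" .
    have "(\<integral>\<^sup>+p. ennreal (?B3 p) \<partial>J) \<le> ennreal (C * (b/7) powr (-\<alpha>)) * (\<integral>\<^sup>+x. ennreal ((\<phi> x)\<^sup>2) \<partial>lborel)"
      by (rule decay_fst) (use ab in auto)
    also have "\<dots> < \<infinity>" using \<phi>2 by (simp add: ennreal_mult_less_top)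
    finally have 3: "(\<integral>\<^sup>+p. ennreal (?B3 p) \<partial>J) < \<infinity>" .
    have "(\<integral>\<^sup>+p. ennreal (?B4 p) \<partial>J) \<le> ennreal (C * (b/7) powr (-\<alpha>)) * (\<integral>\<^sup>+x. ennreal ((\<phi> x)\<^sup>2) \<partial>lborel)"
      by (rule decay_snd) (use ab in auto)
    also have "\<dots> < \<infinity>" using \<phi>2 by (simp add: ennreal_mult_less_top)
    finally have 4: "(\<integral>\<^sup>+p. ennreal (?B4 p) \<partial>J) < \<infinity>" .
    show ?thesis using 1 2 3 4 by simp
  qed
  finally show "form_on J UNIV \<phi> < \<infinity>" .
qed

text \<open>The point is integrability over \<open>J\<close>. Inside \<open>D\<close> it follows
  from the finite forms of \<open>w\<close> and \<open>\<phi>\<close>. For pairs that leave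
  \<open>D\<close>, the part with |w(x)| \<phi>(x) is controlled by decay and the part with |w(y)|
  \<phi>(x) by the tail condition on solutions.\<close>

lemma weak_sol_test:
  assumes w: "weak_sol J E w" and F: "\<And>s t. \<bar>F s - F t\<bar> \<le> L * \<bar>s - t\<bar>" and F0: "\<And>t. 0 \<le> F t"
    and ab: "0 < a" "a < b" and E: "ball x\<^sub>0 (5/4 * b) \<subseteq> E"
  defines "\<phi> \<equiv> \<lambda>x. (cutoff x\<^sub>0 a b x)\<^sup>2 * F (w x)"
  shows "integrable J (\<lambda>p. (w (fst p) - w (snd p)) * (\<phi> (fst p) - \<phi> (snd p)))" (is "integrable J ?P")
    and "(LINT p|J. (w (fst p) - w (snd p)) * (\<phi> (fst p) - \<phi> (snd p))) = 0"
proof -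
  let ?c = "cutoff x\<^sub>0 a b"
  have wl: "loc_space J E w" using w by (simp add: weak_sol_def)
  have c0: "?c x = 0" if "x \<notin> ball x\<^sub>0 b" for x using that ab by (intro cutoff_eq_0) auto
  have c2: "\<bar>(?c x)\<^sup>2 - (?c y)\<^sup>2\<bar> \<le> 2 * \<bar>?c x - ?c y\<bar>" for x y
  proof -
    have "\<bar>(?c x)\<^sup>2 - (?c y)\<^sup>2\<bar> = \<bar>?c x + ?c y\<bar> * \<bar>?c x - ?c y\<bar>"
      by (simp add: power2_eq_square algebra_simps flip: abs_mult)
    also have "\<dots> \<le> 2 * \<bar>?c x - ?c y\<bar>"
      using cutoff_range[of x\<^sub>0 a b x] cutoff_range[of x\<^sub>0 a b y] by (intro mult_right_mono) auto
    finally show ?thesis .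
  qed
  have fin: "(\<integral>\<^sup>+x. ennreal ((\<phi> x)\<^sup>2) \<partial>lborel) < \<infinity>" "form_on J UNIV \<phi> < \<infinity>"
    unfolding \<phi>_def
    by (atomize(full), intro conjI cutoff_times_finite[OF wl F ab E] c2)
      (simp_all add: power_le_one cutoff_range c0)
  define D where "D = ball x\<^sub>0 (8/7 * b)"
  have "closure D \<subseteq> cball x\<^sub>0 (8/7 * b)" unfolding D_def by (rule closure_minimal) auto
  also have "\<dots> \<subseteq> ball x\<^sub>0 (5/4 * b)" using ab by (auto simp: subset_iff)
  finally have clD: "closure D \<subseteq> E" using E by blast
  have [measurable]: "D \<in> sets borel" unfolding D_def by simp
  have [measurable]: "w \<in> borel_measurable borel" using wl by (simp add: loc_space_def)
  have [measurable]: "F \<in> borel_measurable borel" by (rule Lipschitz_borel[OF F])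
  have [measurable]: "\<phi> \<in> borel_measurable borel" unfolding \<phi>_def by measurable
  have w2: "(\<integral>\<^sup>+x\<in>D. ennreal ((w x)\<^sup>2) \<partial>lborel) < \<infinity>" and wf: "form_on J D w < \<infinity>"
    using wl clD unfolding loc_space_def D_def by auto
  have bD: "ball x\<^sub>0 b \<subseteq> D" unfolding D_def using ab by auto
  have \<phi>0: "0 \<le> \<phi> x" for x unfolding \<phi>_def using F0 by simp
  have \<phi>out: "\<phi> x = 0" if "x \<notin> ball x\<^sub>0 b" for x unfolding \<phi>_def using c0[OF that] by simp
  \<comment> \<open>The radius \<open>8/7 * b\<close> of \<open>D\<close> is chosen so that
    \<open>7/8\<close> of it equals \<open>b\<close>: the tail condition then covers exactly the
    ball outside which \<open>\<phi>\<close> vanishes.\<close>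
  have "D \<subseteq> E" using clD closure_subset by blast
  then obtain T where T: "tail_le J (\<lambda>y. \<bar>w y\<bar>) (ball x\<^sub>0 (7/8 * (8/7 * b))) (- D) T"
    using w ab unfolding weak_sol_def D_def by (meson divide_pos_pos mult_pos_pos zero_less_numeral less_trans)
  then have T: "tail_le J (\<lambda>y. \<bar>w y\<bar>) (ball x\<^sub>0 b) (- D) T" by simp
  let ?B1 = "\<lambda>p. (w (fst p) - w (snd p))\<^sup>2 * indicat_real (D \<times> D) p"
  let ?B2 = "\<lambda>p. (\<phi> (fst p) - \<phi> (snd p))\<^sup>2"
  let ?B3 = "\<lambda>p. (\<bar>w (fst p)\<bar> * \<phi> (fst p)) * indicat_real (far (b/7)) p"
  let ?B4 = "\<lambda>p. (\<bar>w (snd p)\<bar> * \<phi> (snd p)) * indicat_real (far (b/7)) p"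
  let ?B5 = "\<lambda>p. \<phi> (fst p) * \<bar>w (snd p)\<bar> * indicat_real (ball x\<^sub>0 b \<times> - D) p"
  let ?B6 = "\<lambda>p. \<phi> (snd p) * \<bar>w (fst p)\<bar> * indicat_real ((- D) \<times> ball x\<^sub>0 b) p"
  have farp: "b/7 \<le> dist x y" if "x \<in> ball x\<^sub>0 b" "y \<notin> D" for x y
    using that dist_triangle[of x\<^sub>0 y x] by (auto simp: D_def)
  have pw: "\<bar>?P p\<bar> \<le> ?B1 p + ?B2 p + ?B3 p + ?B4 p + ?B5 p + ?B6 p" for p
  proof -
    obtain x y where p: "p = (x, y)" by fastforce
    have nn: "0 \<le> ?B1 p" "0 \<le> ?B2 p" "0 \<le> ?B3 p" "0 \<le> ?B4 p" "0 \<le> ?B5 p" "0 \<le> ?B6 p"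
      using \<phi>0 by auto
    consider "x \<in> D" "y \<in> D" | "x \<in> ball x\<^sub>0 b" "y \<notin> D" | "x \<notin> D" "y \<in> ball x\<^sub>0 b" | "x \<notin> ball x\<^sub>0 b" "y \<notin> ball x\<^sub>0 b"
      using bD by blast
    then show ?thesis
    proof cases
      case 1
      have "\<bar>?P p\<bar> \<le> ?B1 p + ?B2 p"
        using 1 p abs_mult_le_power2_add by simp
      then show ?thesis using nn by linarith
    next
      case 2
      then have "y \<notin> ball x\<^sub>0 b" using bD by blast
      then have "\<phi> y = 0" by (rule \<phi>out)
      then have "\<bar>?P p\<bar> = \<bar>w x - w y\<bar> * \<phi> x" using p \<phi>0[of x] by (simp add: abs_mult)
      also have "\<dots> \<le> (\<bar>w x\<bar> + \<bar>w y\<bar>) * \<phi> x" by (intro mult_right_mono \<phi>0) auto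
      also have "\<dots> = ?B3 p + ?B5 p" using 2 p farp[of x y] by (simp add: algebra_simps)
      finally show ?thesis using nn by linarith
    next
      case 3
      then have "x \<notin> ball x\<^sub>0 b" using bD by blast
      then have "\<phi> x = 0" by (rule \<phi>out)
      then have "\<bar>?P p\<bar> = \<bar>w x - w y\<bar> * \<phi> y" using p \<phi>0[of y] by (simp add: abs_mult)
      also have "\<dots> \<le> (\<bar>w x\<bar> + \<bar>w y\<bar>) * \<phi> y" by (intro mult_right_mono \<phi>0) auto
      also have "\<dots> = ?B4 p + ?B6 p" using 3 p farp[of y x] by (simp add: algebra_simps dist_commute)
      finally show ?thesis using nn by linarith
    next
      case 4
      then have "\<phi> x = 0" "\<phi> y = 0" by (auto simp: \<phi>out)
      then show ?thesis using p nn by auto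
    qed
  qed
  have i\<phi>: "(\<integral>\<^sup>+x. ennreal (\<phi> x) \<partial>lborel) < \<infinity>"
  proof -
    have "(\<integral>\<^sup>+x. ennreal (\<phi> x) \<partial>lborel) \<le> (\<integral>\<^sup>+x. indicator D x + ennreal ((\<phi> x)\<^sup>2) \<partial>lborel)"
    proof (rule nn_integral_mono)
      fix x
      have "\<phi> x \<le> indicat_real D x + (\<phi> x)\<^sup>2"
      proof (cases "x \<in> ball x\<^sub>0 b")
        case True
        then have "x \<in> D" using bD by auto
        then show ?thesis using zero_le_power2[of "\<phi> x - 1"] \<phi>0[of x] unfolding power2_diff by simp
      qed (simp add: \<phi>out)
      then have "ennreal (\<phi> x) \<le> ennreal (indicat_real D x + (\<phi> x)\<^sup>2)" by (rule ennreal_leI)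
      then show "ennreal (\<phi> x) \<le> indicator D x + ennreal ((\<phi> x)\<^sup>2)" by (simp add: ennreal_plus ennreal_indicator)
    qed
    also have "\<dots> = emeasure lborel D + (\<integral>\<^sup>+x. ennreal ((\<phi> x)\<^sup>2) \<partial>lborel)"
      by (simp add: nn_integral_add)
    also have "\<dots> < \<infinity>" using fin(1) ab by (simp add: D_def emeasure_ball_eq)
    finally show ?thesis .
  qed
  have iw\<phi>: "(\<integral>\<^sup>+x. ennreal (\<bar>w x\<bar> * \<phi> x) \<partial>lborel) < \<infinity>"
  proof -
    have "(\<integral>\<^sup>+x. ennreal (\<bar>w x\<bar> * \<phi> x) \<partial>lborel) \<le> (\<integral>\<^sup>+x. ennreal ((w x)\<^sup>2) * indicator D x + ennreal ((\<phi> x)\<^sup>2) \<partial>lborel)"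
    proof (rule nn_integral_mono)
      fix x
      have "\<bar>w x\<bar> * \<phi> x \<le> (w x)\<^sup>2 * indicat_real D x + (\<phi> x)\<^sup>2"
      proof (cases "x \<in> ball x\<^sub>0 b")
        case True
        then have "x \<in> D" using bD by auto
        moreover have "2 * (\<bar>w x\<bar> * \<phi> x) \<le> (w x)\<^sup>2 + (\<phi> x)\<^sup>2"
          using zero_le_power2[of "\<bar>w x\<bar> - \<phi> x"] unfolding power2_diff by (simp add: mult.assoc)
        moreover have "0 \<le> \<bar>w x\<bar> * \<phi> x" using \<phi>0[of x] by simp
        ultimately show ?thesis by simp
      qed (simp add: \<phi>out)
      then have "ennreal (\<bar>w x\<bar> * \<phi> x) \<le> ennreal ((w x)\<^sup>2 * indicat_real D x + (\<phi> x)\<^sup>2)" by (rule ennreal_leI)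
      then show "ennreal (\<bar>w x\<bar> * \<phi> x) \<le> ennreal ((w x)\<^sup>2) * indicator D x + ennreal ((\<phi> x)\<^sup>2)"
        by (simp add: ennreal_plus ennreal_mult_indicat_real)
    qed
    also have "\<dots> = (\<integral>\<^sup>+x\<in>D. ennreal ((w x)\<^sup>2) \<partial>lborel) + (\<integral>\<^sup>+x. ennreal ((\<phi> x)\<^sup>2) \<partial>lborel)"
      by (simp add: nn_integral_add)
    also have "\<dots> < \<infinity>" using fin(1) w2 by simp
    finally show ?thesis .
  qed
  show int: "integrable J ?P"
  proof (rule integrableI_bounded)
    show "?P \<in> borel_measurable J" by measurable
    have "(\<integral>\<^sup>+p. ennreal (norm (?P p)) \<partial>J) \<le> (\<integral>\<^sup>+p. ennreal (?B1 p) + ennreal (?B2 p) + ennreal (?B3 p) + ennreal (?B4 p) + ennreal (?B5 p) + ennreal (?B6 p) \<partial>J)"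
    proof (rule nn_integral_mono)
      fix p
      have "ennreal (norm (?P p)) \<le> ennreal (?B1 p + ?B2 p + ?B3 p + ?B4 p + ?B5 p + ?B6 p)"
        using pw[of p] by (intro ennreal_leI) simp
      also have "\<dots> = ennreal (?B1 p) + ennreal (?B2 p) + ennreal (?B3 p) + ennreal (?B4 p) + ennreal (?B5 p) + ennreal (?B6 p)"
        using \<phi>0 by (subst ennreal_plus, simp, simp)+ simp
      finally show "ennreal (norm (?P p)) \<le> ennreal (?B1 p) + ennreal (?B2 p) + ennreal (?B3 p) + ennreal (?B4 p) + ennreal (?B5 p) + ennreal (?B6 p)" .
    qed
    also have "\<dots> = (\<integral>\<^sup>+p. ennreal (?B1 p) \<partial>J) + (\<integral>\<^sup>+p. ennreal (?B2 p) \<partial>J) + (\<integral>\<^sup>+p. ennreal (?B3 p) \<partial>J) + (\<integral>\<^sup>+p. ennreal (?B4 p) \<partial>J) + (\<integral>\<^sup>+p. ennreal (?B5 p) \<partial>J) + (\<integral>\<^sup>+p. ennreal (?B6 p) \<partial>J)"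
      by (simp add: nn_integral_add)
    also have "\<dots> < \<infinity>"
    proof -
      have 1: "(\<integral>\<^sup>+p. ennreal (?B1 p) \<partial>J) < \<infinity>" using wf unfolding form_on_def ennreal_mult_indicat_real .
      have 2: "(\<integral>\<^sup>+p. ennreal (?B2 p) \<partial>J) < \<infinity>" using fin(2) unfolding form_on_UNIV .
      have "(\<integral>\<^sup>+p. ennreal (?B3 p) \<partial>J) \<le> ennreal (C * (b/7) powr (-\<alpha>)) * (\<integral>\<^sup>+x. ennreal (\<bar>w x\<bar> * \<phi> x) \<partial>lborel)"
        by (rule decay_fst) (use ab in auto)
      also have "\<dots> < \<infinity>" using iw\<phi> by (simp add: ennreal_mult_less_top)
      finally have 3: "(\<integral>\<^sup>+p. ennreal (?B3 p) \<partial>J) < \<infinity>" .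
      have "(\<integral>\<^sup>+p. ennreal (?B4 p) \<partial>J) \<le> ennreal (C * (b/7) powr (-\<alpha>)) * (\<integral>\<^sup>+x. ennreal (\<bar>w x\<bar> * \<phi> x) \<partial>lborel)"
        by (rule decay_snd) (use ab in auto)
      also have "\<dots> < \<infinity>" using iw\<phi> by (simp add: ennreal_mult_less_top)
      finally have 4: "(\<integral>\<^sup>+p. ennreal (?B4 p) \<partial>J) < \<infinity>" .
      have "(\<integral>\<^sup>+p. ennreal (?B5 p) \<partial>J) \<le> ennreal T * (\<integral>\<^sup>+x. ennreal (\<phi> x) \<partial>lborel)"
        by (rule tail_leD[OF T]) (use \<phi>0 in auto)
      also have "\<dots> < \<infinity>" using i\<phi> by (simp add: ennreal_mult_less_top)
      finally have 5: "(\<integral>\<^sup>+p. ennreal (?B5 p) \<partial>J) < \<infinity>" .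
      have "(\<integral>\<^sup>+p. ennreal (?B6 p) \<partial>J) = (\<integral>\<^sup>+p. ennreal (?B5 p) \<partial>J)"
        by (subst swap[symmetric], measurable)
          (auto intro!: nn_integral_cong arg_cong[where f = ennreal] split: split_indicator)
      then have 6: "(\<integral>\<^sup>+p. ennreal (?B6 p) \<partial>J) < \<infinity>" using 5 by simp
      show ?thesis using 1 2 3 4 5 6 by simp
    qed
    finally show "(\<integral>\<^sup>+p. ennreal (norm (?P p)) \<partial>J) < \<infinity>" .
  qed
  have "closure {x. \<phi> x \<noteq> 0} \<subseteq> closure D"
    by (rule closure_mono) (use \<phi>out bD in blast)
  then have "closure {x. \<phi> x \<noteq> 0} \<subseteq> E" using clD by blast
  then show "(LINT p|J. ?P p) = 0"
    using w fin int \<phi>0 unfolding weak_sol_def by simp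
qed

text \<open>The right-hand side carries the product of both values of \<open>v\<close>, not their
  squares. It vanishes as soon as one point lies below the level, nothing has to be absorbed into
  the left-hand side, and distant points are already included.\<close>

lemma caccioppoli:
  fixes k :: real
  assumes w: "weak_sol J E w" and ab: "0 < a" "a < b" and E: "ball x\<^sub>0 (5/4 * b) \<subseteq> E"
  defines "v \<equiv> \<lambda>x. max (w x - k) 0"
  shows "form_on J UNIV (\<lambda>x. cutoff x\<^sub>0 a b x * v x)
     \<le> (\<integral>\<^sup>+p. ennreal (v (fst p) * v (snd p) * (cutoff x\<^sub>0 a b (fst p) - cutoff x\<^sub>0 a b (snd p))\<^sup>2) \<partial>J)"
proof -
  let ?c = "cutoff x\<^sub>0 a b"
  have [measurable]: "w \<in> borel_measurable borel" using w by (simp add: loc_space_def weak_sol_def)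
  have F: "\<bar>max (s - k) 0 - max (t - k) 0\<bar> \<le> 1 * \<bar>s - t\<bar>" for s t :: real by auto
  note test = weak_sol_test[OF w F _ ab E, simplified]
  let ?P = "\<lambda>p. (w (fst p) - w (snd p)) * ((?c (fst p))\<^sup>2 * max (w (fst p) - k) 0 - (?c (snd p))\<^sup>2 * max (w (snd p) - k) 0)"
  \<comment> \<open>An equality when \<open>a\<close> and \<open>b\<close> are non-negative. For
    opposite signs the surplus is \<open>- (a * b)\<close> times a square and has the favourable
    sign.\<close>
  have alg: "(s * max a 0 - t * max b 0)\<^sup>2 - max a 0 * max b 0 * (s - t)\<^sup>2 \<le> (a - b) * (s\<^sup>2 * max a 0 - t\<^sup>2 * max b 0)" for a b s t :: real
  proof -
    have *: "0 \<le> - (b * a) * s\<^sup>2" if "0 \<le> a" "b \<le> 0" for a b s :: real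
      using that by (metis minus_mult_left mult_nonneg_nonneg neg_0_le_iff_le zero_le_power2)
    consider "a \<ge> 0" "b \<ge> 0" | "a \<ge> 0" "b \<le> 0" | "a \<le> 0" "b \<ge> 0" | "a \<le> 0" "b \<le> 0" by linarith
    then show ?thesis
    proof cases
      case 2 then show ?thesis using *[of a b s] by (simp add: max_def power2_eq_square algebra_simps)
    next
      case 3 then show ?thesis using *[of b a t] by (simp add: max_def power2_eq_square algebra_simps)
    qed (simp_all add: max_def power2_eq_square algebra_simps)
  qed
  show ?thesis unfolding form_on_UNIV
  proof (rule nn_integral_le_of_integral_zero[where P = "\<lambda>p. - ?P p"])
    show "integrable J (\<lambda>p. - ?P p)" using test(1) by simp
    show "(LINT p|J. - ?P p) = 0" using test(2) by simp
    fix p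
    show "- ?P p \<le> v (fst p) * v (snd p) * (?c (fst p) - ?c (snd p))\<^sup>2 - (?c (fst p) * v (fst p) - ?c (snd p) * v (snd p))\<^sup>2"
      using alg[of "?c (fst p)" "w (fst p) - k" "?c (snd p)" "w (snd p) - k"] by (simp add: v_def)
  qed (auto simp: v_def)
qed

end

section \<open>De Giorgi iteration\<close>

lemma tail_le_subset:
  assumes "tail_le J g A B T" "A' \<subseteq> A" "B' \<subseteq> B" "T \<le> T'" "\<And>y. y \<in> B' \<Longrightarrow> g' y \<le> g y"
  shows "tail_le J g' A' B' T'"
  unfolding tail_le_def
proof (intro allI impI)
  fix f :: "'a \<Rightarrow> ennreal" assume f: "f \<in> borel_measurable borel"
  have "(\<integral>\<^sup>+p. f (fst p) * ennreal (g' (snd p)) * indicator (A' \<times> B') p \<partial>J)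
      \<le> (\<integral>\<^sup>+p. f (fst p) * ennreal (g (snd p)) * indicator (A \<times> B) p \<partial>J)"
    using assms(2,3,5) by (intro nn_integral_mono) (auto split: split_indicator intro!: mult_left_mono ennreal_leI)
  also have "\<dots> \<le> ennreal T * (\<integral>\<^sup>+x. f x \<partial>lborel)" using assms(1) f by (simp add: tail_le_def)
  also have "\<dots> \<le> ennreal T' * (\<integral>\<^sup>+x. f x \<partial>lborel)" by (intro mult_right_mono ennreal_leI assms) simp
  finally show "(\<integral>\<^sup>+p. f (fst p) * ennreal (g' (snd p)) * indicator (A' \<times> B') p \<partial>J) \<le> ennreal T' * (\<integral>\<^sup>+x. f x \<partial>lborel)" .
qed

context jump_form
begin

lemma nn_integral_swap:
  assumes "F \<in> borel_measurable (borel \<Otimes>\<^sub>M borel)" "\<And>p. G p = F (snd p, fst p)"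
  shows "(\<integral>\<^sup>+p. G p \<partial>J) = (\<integral>\<^sup>+p. F p \<partial>J)"
  using swap[OF assms(1)] assms(2) by simp

text \<open>Caccioppoli bounds the form of the truncated function, and Faber-Krahn at scale
  \<open>s\<close> converts this into a bound on its square integral with the factor
  \<open>s powr \<alpha>\<close>. All the gain of the step sits in that factor: the smaller the
  level set, the smaller \<open>s\<close> may be taken.\<close>

lemma de_giorgi_step:
  fixes k :: real
  assumes w: "weak_sol J E w" and \<rho>: "0 < \<rho>" and E: "ball x\<^sub>1 (3/2 * \<rho>) \<subseteq> E"
    and ab: "0 < a" "a < b" "b \<le> \<rho>" and s: "0 < s" "s \<le> \<rho> / 4"
  defines "v \<equiv> \<lambda>x. max (w x - k) 0" and "g \<equiv> (b - a) / 2"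
  assumes T: "tail_le J v (ball x\<^sub>1 \<rho>) (- ball x\<^sub>1 (3/2 * \<rho>)) T" "0 \<le> T"
    and I1: "(\<integral>\<^sup>+x\<in>ball x\<^sub>1 (3/2 * \<rho>). ennreal (v x) \<partial>lborel) \<le> ennreal I1" "0 \<le> I1"
    and I2: "(\<integral>\<^sup>+x\<in>ball x\<^sub>1 b. ennreal (v x) \<partial>lborel) \<le> ennreal I2" "0 \<le> I2"
    and I3: "(\<integral>\<^sup>+x\<in>ball x\<^sub>1 b. ennreal ((v x)\<^sup>2) \<partial>lborel) \<le> ennreal I3" "0 \<le> I3"
    and small: "2 * emeasure lborel {x\<in>ball x\<^sub>1 b. 0 < v x} \<le> emeasure lborel (ball (0::'a) s)"
  shows "(\<integral>\<^sup>+x\<in>ball x\<^sub>1 a. ennreal ((v x)\<^sup>2) \<partial>lborel)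
    \<le> ennreal (8 * C * s powr \<alpha> * (Cq * g powr (-\<alpha>) * I3 + 2 * (C * g powr (-\<alpha>) / g ^ DIM('a) * I1 * I2 + T * I2)))"
proof -
  \<comment> \<open>The cutoff uses only the inner half of the gap. The outer half keeps its support
    at distance \<open>g\<close> from the complement of \<open>ball x\<^sub>1 b\<close>, so that the
    kernel bound \<open>upper\<close> is available there.\<close>
  define m where "m = (a + b) / 2"
  have m: "a < m" "m < b" "m - a = g" "b - m = g" "0 < g" using ab unfolding m_def g_def by (auto simp: field_simps)
  have mE: "ball x\<^sub>1 (5/4 * m) \<subseteq> E"
    by (rule subset_trans[OF subset_ball E]) (use ab m in auto)
  have wl: "loc_space J E w" using w by (simp add: weak_sol_def)
  have [measurable]: "w \<in> borel_measurable borel" using wl by (simp add: loc_space_def)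
  have [measurable]: "v \<in> borel_measurable borel" unfolding v_def by measurable
  have v0: "0 \<le> v x" for x unfolding v_def by simp
  have mb: "ball x\<^sub>1 m \<subseteq> ball x\<^sub>1 b" by (rule subset_ball) (use m in auto)
  let ?c = "cutoff x\<^sub>1 a m"
  have c0: "?c x = 0" if "x \<notin> ball x\<^sub>1 m" for x using that m by (intro cutoff_eq_0) auto
  define z where "z = (\<lambda>x. ?c x * v x)"
  have [measurable]: "z \<in> borel_measurable borel" unfolding z_def by measurable
  have F: "\<bar>max (s - k) 0 - max (t - k) 0\<bar> \<le> 1 * \<bar>s - t\<bar>" for s t :: real by auto
  have fin: "(\<integral>\<^sup>+x. ennreal ((z x)\<^sup>2) \<partial>lborel) < \<infinity>" "form_on J UNIV z < \<infinity>"
    unfolding z_def v_def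
    by (atomize(full), intro conjI cutoff_times_finite[OF wl F ab(1) m(1) mE]) (simp_all add: cutoff_range c0)
  have zs: "{x. z x \<noteq> 0} \<subseteq> {x\<in>ball x\<^sub>1 b. 0 < v x}"
    using c0 v0 m(2) unfolding z_def by (force simp: less_le)
  have "(\<integral>\<^sup>+x\<in>ball x\<^sub>1 a. ennreal ((v x)\<^sup>2) \<partial>lborel) \<le> (\<integral>\<^sup>+x. ennreal ((z x)\<^sup>2) \<partial>lborel)"
    using m by (intro nn_integral_mono) (auto split: split_indicator simp: z_def cutoff_eq_1)
  also have "\<dots> \<le> ennreal (8 * C * s powr \<alpha>) * form_on J UNIV z"
  proof (rule faber_krahn[OF _ fin _ s(1)])
    show "z x = 0" if "x \<notin> ball x\<^sub>1 \<rho>" for x using c0[of x] that m ab unfolding z_def by auto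
    show "ball x\<^sub>1 (\<rho> + 2 * s) \<subseteq> E" by (rule subset_trans[OF subset_ball E]) (use s in auto)
    have "emeasure lborel {x. z x \<noteq> 0} \<le> emeasure lborel {x\<in>ball x\<^sub>1 b. 0 < v x}"
      by (intro emeasure_mono zs) measurable
    then show "2 * emeasure lborel {x. z x \<noteq> 0} \<le> emeasure lborel (ball (0::'a) s)"
      using small by (meson mult_left_mono order_trans zero_le)
  qed simp
  also have "form_on J UNIV z \<le> ennreal (Cq * g powr (-\<alpha>) * I3 + 2 * (C * g powr (-\<alpha>) / g ^ DIM('a) * I1 * I2 + T * I2))"
  proof -
    let ?f = "\<lambda>x. (v x)\<^sup>2 / 2 * indicat_real (ball x\<^sub>1 b) x"
    let ?h = "\<lambda>x. v x * indicat_real (ball x\<^sub>1 b) x"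
    let ?e = "\<lambda>x. v x * indicat_real (ball x\<^sub>1 (3/2 * \<rho>)) x"
    let ?A = "ball x\<^sub>1 \<rho>" and ?O = "- ball x\<^sub>1 (3/2 * \<rho>)"
    \<comment> \<open>\<open>?B1\<close> and \<open>?B2\<close> serve pairs inside
      \<open>ball x\<^sub>1 b\<close>; \<open>?B3\<close> and \<open>?B4\<close> pairs with one
      point there and the other at distance at least \<open>g\<close> but within radius
      \<open>3/2 * \<rho>\<close>; \<open>?B5\<close> and \<open>?B6\<close> pairs whose second
      point lies beyond that radius. The even ones are mirror images of the odd ones.\<close>
    let ?B1 = "\<lambda>p. ?f (fst p) * (?c (fst p) - ?c (snd p))\<^sup>2"
    let ?B2 = "\<lambda>p. ?f (snd p) * (?c (snd p) - ?c (fst p))\<^sup>2"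
    let ?B3 = "\<lambda>p. ?h (fst p) * ?e (snd p) * indicat_real (far g) p"
    let ?B4 = "\<lambda>p. ?h (snd p) * ?e (fst p) * indicat_real (far g) p"
    let ?B5 = "\<lambda>p. ?h (fst p) * v (snd p) * indicat_real (?A \<times> ?O) p"
    let ?B6 = "\<lambda>p. ?h (snd p) * v (fst p) * indicat_real (?O \<times> ?A) p"
    have c1: "(?c x - ?c y)\<^sup>2 \<le> 1" for x y
      using cutoff_range[of x\<^sub>1 a m x] cutoff_range[of x\<^sub>1 a m y] by (intro abs_square_le_1[THEN iffD2]) auto
    have out: "v x * v y * (?c x - ?c y)\<^sup>2 \<le> ?h x * ?e y * indicat_real (far g) (x, y) + ?h x * v y * indicat_real (?A \<times> ?O) (x, y)"
      if "x \<in> ball x\<^sub>1 m" "y \<notin> ball x\<^sub>1 b" for x y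
    proof -
      have "g \<le> dist x y" using that dist_triangle[of x\<^sub>1 y x] m by auto
      moreover have "v x * v y * (?c x - ?c y)\<^sup>2 \<le> v x * v y"
        using mult_left_mono[OF c1, of "v x * v y"] v0 by simp
      ultimately show ?thesis using that m ab by (auto split: split_indicator)
    qed
    have pw: "v (fst p) * v (snd p) * (?c (fst p) - ?c (snd p))\<^sup>2 \<le> ?B1 p + ?B2 p + ?B3 p + ?B4 p + ?B5 p + ?B6 p" for p
    proof -
      obtain x y where p: "p = (x, y)" by fastforce
      have nn: "0 \<le> ?B1 p" "0 \<le> ?B2 p" "0 \<le> ?B3 p" "0 \<le> ?B4 p" "0 \<le> ?B5 p" "0 \<le> ?B6 p"
        using v0 by auto
      consider "x \<in> ball x\<^sub>1 b" "y \<in> ball x\<^sub>1 b" | "x \<in> ball x\<^sub>1 m" "y \<notin> ball x\<^sub>1 b" | "x \<notin> ball x\<^sub>1 b" "y \<in> ball x\<^sub>1 m" | "x \<notin> ball x\<^sub>1 m" "y \<notin> ball x\<^sub>1 m"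
        using mb by blast
      then show ?thesis
      proof cases
        case 1
        have "v x * v y \<le> (v x)\<^sup>2 / 2 + (v y)\<^sup>2 / 2"
          using zero_le_power2[of "v x - v y"] by (simp add: power2_diff)
        then have "v x * v y * (?c x - ?c y)\<^sup>2 \<le> ((v x)\<^sup>2 / 2 + (v y)\<^sup>2 / 2) * (?c x - ?c y)\<^sup>2"
          by (intro mult_right_mono) auto
        also have "\<dots> = ?B1 p + ?B2 p" using 1 p by (simp add: algebra_simps power2_commute)
        finally have "v x * v y * (?c x - ?c y)\<^sup>2 \<le> ?B1 p + ?B2 p + ?B3 p + ?B4 p + ?B5 p + ?B6 p" using nn by linarith
        then show ?thesis using p by simp
      next
        case 2
        then have "v x * v y * (?c x - ?c y)\<^sup>2 \<le> ?B3 p + ?B5 p" using out[of x y] p by simp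
        then have "v x * v y * (?c x - ?c y)\<^sup>2 \<le> ?B1 p + ?B2 p + ?B3 p + ?B4 p + ?B5 p + ?B6 p" using nn by linarith
        then show ?thesis using p by simp
      next
        case 3
        have "indicat_real (?A \<times> ?O) (y, x) = indicat_real (?O \<times> ?A) p"
          "indicat_real (far g) (y, x) = indicat_real (far g) p" using p by (auto simp: indicator_def dist_commute)
        then have "v x * v y * (?c x - ?c y)\<^sup>2 \<le> ?B4 p + ?B6 p" using out[of y x] 3 p
          by (simp add: power2_commute mult.commute dist_commute)
        then have "v x * v y * (?c x - ?c y)\<^sup>2 \<le> ?B1 p + ?B2 p + ?B3 p + ?B4 p + ?B5 p + ?B6 p" using nn by linarith
        then show ?thesis using p by simp
      next
        case 4
        then have "v x * v y * (?c x - ?c y)\<^sup>2 \<le> ?B1 p + ?B2 p + ?B3 p + ?B4 p + ?B5 p + ?B6 p" using nn c0 by simp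
        then show ?thesis using p by simp
      qed
    qed
    have i2: "(\<integral>\<^sup>+x. ennreal (?h x) \<partial>lborel) \<le> ennreal I2" using I2(1) by (simp add: ennreal_mult_indicat_real)
    have i1: "(\<integral>\<^sup>+x. ennreal (?e x) \<partial>lborel) \<le> ennreal I1" using I1(1) by (simp add: ennreal_mult_indicat_real)
    have i3: "(\<integral>\<^sup>+x. ennreal (?f x) \<partial>lborel) \<le> ennreal (I3 / 2)"
    proof -
      have "(\<integral>\<^sup>+x. ennreal (?f x) \<partial>lborel) = (\<integral>\<^sup>+x. ennreal (1/2) * (ennreal ((v x)\<^sup>2) * indicator (ball x\<^sub>1 b) x) \<partial>lborel)"
        by (intro nn_integral_cong) (auto split: split_indicator simp: ennreal_mult[symmetric] simp del: ennreal_half)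
      also have "\<dots> = ennreal (1/2) * (\<integral>\<^sup>+x\<in>ball x\<^sub>1 b. ennreal ((v x)\<^sup>2) \<partial>lborel)"
        by (rule nn_integral_cmult) measurable
      also have "\<dots> \<le> ennreal (1/2) * ennreal I3" by (intro mult_left_mono I3) simp
      also have "\<dots> = ennreal (I3 / 2)" by (subst ennreal_mult[symmetric]) (use I3 in auto)
      finally show ?thesis .
    qed
    have "form_on J UNIV z \<le> (\<integral>\<^sup>+p. ennreal (v (fst p) * v (snd p) * (?c (fst p) - ?c (snd p))\<^sup>2) \<partial>J)"
      unfolding z_def v_def by (rule caccioppoli[OF w ab(1) m(1) mE])
    also have "\<dots> \<le> (\<integral>\<^sup>+p. ennreal (?B1 p) + ennreal (?B2 p) + ennreal (?B3 p) + ennreal (?B4 p) + ennreal (?B5 p) + ennreal (?B6 p) \<partial>J)"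
    proof (rule nn_integral_mono)
      fix p
      have "ennreal (v (fst p) * v (snd p) * (?c (fst p) - ?c (snd p))\<^sup>2) \<le> ennreal (?B1 p + ?B2 p + ?B3 p + ?B4 p + ?B5 p + ?B6 p)"
        by (rule ennreal_leI[OF pw])
      also have "\<dots> = ennreal (?B1 p) + ennreal (?B2 p) + ennreal (?B3 p) + ennreal (?B4 p) + ennreal (?B5 p) + ennreal (?B6 p)"
        using v0 by (subst ennreal_plus, simp, simp)+ simp
      finally show "ennreal (v (fst p) * v (snd p) * (?c (fst p) - ?c (snd p))\<^sup>2) \<le> ennreal (?B1 p) + ennreal (?B2 p) + ennreal (?B3 p) + ennreal (?B4 p) + ennreal (?B5 p) + ennreal (?B6 p)" .
    qed
    also have "\<dots> = (\<integral>\<^sup>+p. ennreal (?B1 p) \<partial>J) + (\<integral>\<^sup>+p. ennreal (?B2 p) \<partial>J) + (\<integral>\<^sup>+p. ennreal (?B3 p) \<partial>J) + (\<integral>\<^sup>+p. ennreal (?B4 p) \<partial>J) + (\<integral>\<^sup>+p. ennreal (?B5 p) \<partial>J) + (\<integral>\<^sup>+p. ennreal (?B6 p) \<partial>J)"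
      by (simp add: nn_integral_add)
    also have "(\<integral>\<^sup>+p. ennreal (?B2 p) \<partial>J) = (\<integral>\<^sup>+p. ennreal (?B1 p) \<partial>J)"
      by (rule nn_integral_swap) simp_all
    also have "(\<integral>\<^sup>+p. ennreal (?B4 p) \<partial>J) = (\<integral>\<^sup>+p. ennreal (?B3 p) \<partial>J)"
      by (rule nn_integral_swap)
        (auto intro!: arg_cong[where f = ennreal] split: split_indicator simp: dist_commute)
    also have "(\<integral>\<^sup>+p. ennreal (?B6 p) \<partial>J) = (\<integral>\<^sup>+p. ennreal (?B5 p) \<partial>J)"
      by (rule nn_integral_swap) (auto intro!: arg_cong[where f = ennreal] split: split_indicator)
    also have "(\<integral>\<^sup>+p. ennreal (?B1 p) \<partial>J) \<le> ennreal (Cq * g powr (-\<alpha>) * (I3 / 2))"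
    proof -
      have "(\<integral>\<^sup>+p. ennreal (?B1 p) \<partial>J) \<le> ennreal (Cq * (m - a) powr (-\<alpha>)) * (\<integral>\<^sup>+x. ennreal (?f x) \<partial>lborel)"
        by (intro decay_cutoff_real[where f = ?f] m) simp_all
      also have "\<dots> \<le> ennreal (Cq * g powr (-\<alpha>)) * ennreal (I3 / 2)"
        unfolding m(3) by (intro mult_left_mono i3) simp
      also have "\<dots> = ennreal (Cq * g powr (-\<alpha>) * (I3 / 2))"
        by (rule ennreal_mult[symmetric]) (use I3 Cq_pos in auto)
      finally show ?thesis .
    qed
    also have "(\<integral>\<^sup>+p. ennreal (?B3 p) \<partial>J) \<le> ennreal (C * g powr (-\<alpha>) / g ^ DIM('a) * I1 * I2)"
    proof -
      have "(\<integral>\<^sup>+p. ennreal (?B3 p) \<partial>J) = (\<integral>\<^sup>+p. ennreal (?h (fst p)) * ennreal (?e (snd p)) * indicator (far g) p \<partial>J)"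
        by (intro nn_integral_cong, unfold ennreal_mult_indicat_real[of _ "far g"], subst ennreal_mult) (use v0 in auto)
      also have "\<dots> \<le> ennreal (C * g powr (-\<alpha>) / g ^ DIM('a)) * ((\<integral>\<^sup>+x. ennreal (?h x) \<partial>lborel) * (\<integral>\<^sup>+x. ennreal (?e x) \<partial>lborel))"
        by (rule upper[where f = "\<lambda>x. ennreal (?h x)" and g = "\<lambda>x. ennreal (?e x)"]) (use m in auto)
      also have "\<dots> \<le> ennreal (C * g powr (-\<alpha>) / g ^ DIM('a)) * (ennreal I2 * ennreal I1)"
        by (intro mult_left_mono mult_mono i1 i2) auto
      also have "\<dots> = ennreal (C * g powr (-\<alpha>) / g ^ DIM('a) * (I2 * I1))"
        using I1 I2 C m by (simp add: ennreal_mult[symmetric])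
      finally show ?thesis by (simp add: mult_ac)
    qed
    also have "(\<integral>\<^sup>+p. ennreal (?B5 p) \<partial>J) \<le> ennreal (T * I2)"
    proof -
      have "(\<integral>\<^sup>+p. ennreal (?B5 p) \<partial>J) \<le> ennreal T * (\<integral>\<^sup>+x. ennreal (?h x) \<partial>lborel)"
        by (rule tail_leD[OF T(1), where f = ?h]) (use v0 in auto)
      also have "\<dots> \<le> ennreal T * ennreal I2" by (intro mult_left_mono i2) simp
      also have "\<dots> = ennreal (T * I2)" using T I2 by (simp add: ennreal_mult)
      finally show ?thesis .
    qed
    finally have *: "form_on J UNIV z \<le> ennreal (Cq * g powr (-\<alpha>) * (I3 / 2)) + ennreal (Cq * g powr (-\<alpha>) * (I3 / 2))
       + ennreal (C * g powr (-\<alpha>) / g ^ DIM('a) * I1 * I2) + ennreal (C * g powr (-\<alpha>) / g ^ DIM('a) * I1 * I2) + ennreal (T * I2) + ennreal (T * I2)"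
      by (simp add: add_mono)
    have nn: "0 \<le> Cq * g powr (-\<alpha>) * (I3 / 2)" "0 \<le> C * g powr (-\<alpha>) / g ^ DIM('a) * I1 * I2" "0 \<le> T * I2"
      using Cq_pos I1 I2 I3 T C m by auto
    have "ennreal (Cq * g powr (-\<alpha>) * (I3 / 2)) + ennreal (Cq * g powr (-\<alpha>) * (I3 / 2))
       + ennreal (C * g powr (-\<alpha>) / g ^ DIM('a) * I1 * I2) + ennreal (C * g powr (-\<alpha>) / g ^ DIM('a) * I1 * I2) + ennreal (T * I2) + ennreal (T * I2)
       = ennreal (Cq * g powr (-\<alpha>) * (I3 / 2) + Cq * g powr (-\<alpha>) * (I3 / 2) + C * g powr (-\<alpha>) / g ^ DIM('a) * I1 * I2 + C * g powr (-\<alpha>) / g ^ DIM('a) * I1 * I2 + T * I2 + T * I2)"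
      using nn by (simp only: ennreal_plus add_nonneg_nonneg)
    also have "Cq * g powr (-\<alpha>) * (I3 / 2) + Cq * g powr (-\<alpha>) * (I3 / 2) + C * g powr (-\<alpha>) / g ^ DIM('a) * I1 * I2 + C * g powr (-\<alpha>) / g ^ DIM('a) * I1 * I2 + T * I2 + T * I2
       = Cq * g powr (-\<alpha>) * I3 + 2 * (C * g powr (-\<alpha>) / g ^ DIM('a) * I1 * I2 + T * I2)" by simp
    finally show ?thesis using * by simp
  qed
  finally have "(\<integral>\<^sup>+x\<in>ball x\<^sub>1 a. ennreal ((v x)\<^sup>2) \<partial>lborel)
    \<le> ennreal (8 * C * s powr \<alpha>) * ennreal (Cq * g powr (-\<alpha>) * I3 + 2 * (C * g powr (-\<alpha>) / g ^ DIM('a) * I1 * I2 + T * I2))"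
    by (simp add: mult_left_mono)
  also have "\<dots> = ennreal (8 * C * s powr \<alpha> * (Cq * g powr (-\<alpha>) * I3 + 2 * (C * g powr (-\<alpha>) / g ^ DIM('a) * I1 * I2 + T * I2)))"
    using Cq_pos I1 I2 I3 T C m by (intro ennreal_mult[symmetric]) auto
  finally show ?thesis .
qed

text \<open>The iteration runs at a prescribed rate \<open>q\<close> with Faber-Krahn radii
  shrinking like \<open>\<theta> ^ j\<close>, instead of through a superlinear recursion. By
  Chebyshev the level sets are small enough for these radii. The resulting factor
  \<open>(\<theta> powr \<alpha>) ^ j\<close> pays for the shrinking gaps between radii and levels,
  \<open>\<kappa>\<close> pays for the fixed constants, and \<open>\<nu>\<close> is the initial
  smallness that \<open>\<kappa>\<close> demands.\<close>

lemma de_giorgi_iteration: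
  fixes k h \<rho> \<Lambda> \<theta> \<kappa> :: real
  defines "N \<equiv> DIM('a)"
  defines "q \<equiv> \<theta> ^ N / 4" and "\<nu> \<equiv> unit_ball_vol N * \<kappa> ^ N / 8"
    and "Q \<equiv> 64 * Cq + 4 * \<Lambda> * (C * 8 ^ (N + 2) + 1)"
  assumes \<theta>: "0 < \<theta>" "\<theta> \<le> 1" "2 ^ (N + 3) * \<theta> powr \<alpha> \<le> 1"
    and \<kappa>: "0 < \<kappa>" "\<kappa> \<le> 1/4" "8 * C * \<kappa> powr \<alpha> * Q \<le> q" and \<Lambda>: "0 \<le> \<Lambda>"
    and w: "weak_sol J E w" and \<rho>: "0 < \<rho>" and E: "ball x\<^sub>1 (3/2 * \<rho>) \<subseteq> E" and h: "0 < h"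
    and small: "(\<integral>\<^sup>+x\<in>ball x\<^sub>1 \<rho>. ennreal ((max (w x - k) 0)\<^sup>2) \<partial>lborel) \<le> ennreal (\<nu> * h\<^sup>2 * \<rho> ^ N)"
    and mean: "(\<integral>\<^sup>+x\<in>ball x\<^sub>1 (3/2 * \<rho>). ennreal (max (w x - k) 0) \<partial>lborel) \<le> ennreal (\<Lambda> * h * \<rho> ^ N)"
    and tail: "tail_le J (\<lambda>x. max (w x - k) 0) (ball x\<^sub>1 \<rho>) (- ball x\<^sub>1 (3/2 * \<rho>)) (\<Lambda> * h * \<rho> powr (-\<alpha>))"
  shows "AE x in lborel. x \<in> ball x\<^sub>1 (\<rho>/2) \<longrightarrow> w x \<le> k + h"
proof -
  have [measurable]: "w \<in> borel_measurable borel" using w by (simp add: loc_space_def weak_sol_def)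
  have \<nu>: "0 < \<nu>" unfolding \<nu>_def using \<kappa> by simp
  have q: "0 < q" unfolding q_def using \<theta> by simp
  define R where "R = (\<lambda>j::nat. \<rho>/2 * (1 + 1/2^j))"
  define l where "l = (\<lambda>j::nat. k + h * (1 - 1/2^j))"
  define y where "y = (\<lambda>j::nat. \<nu> * h\<^sup>2 * \<rho> ^ N * q ^ j)"
  have y: "0 \<le> y j" for j unfolding y_def using \<nu> q \<rho> by simp
  let ?v = "\<lambda>j x. max (w x - l j) 0"
  have R_diff: "R j - R (Suc j) = \<rho> / 2 ^ (j + 2)" for j unfolding R_def by (simp add: field_simps)
  have l_diff: "l (Suc j) - l j = h / 2 ^ Suc j" for j unfolding l_def by (simp add: field_simps)
  have lk: "k \<le> l j" for j unfolding l_def using h by simp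
  have Rpos: "0 < R j" for j unfolding R_def using \<rho> by (simp add: add_pos_pos)
  have R\<rho>: "R j \<le> \<rho>" for j
  proof -
    have "(1::real) / 2 ^ j \<le> 1" by simp
    then have "\<rho>/2 * (1 + 1/2^j) \<le> \<rho>/2 * 2" using \<rho> by (intro mult_left_mono) auto
    then show ?thesis unfolding R_def by simp
  qed
  have main: "(\<integral>\<^sup>+x\<in>ball x\<^sub>1 (R j). ennreal ((?v j x)\<^sup>2) \<partial>lborel) \<le> ennreal (y j)" for j
  proof (induction j)
    case 0
    show ?case using small by (simp add: R_def l_def y_def)
  next
    case (Suc j)
    \<comment> \<open>\<open>s\<close> is tuned so that the Chebyshev bound for twice the volume of
      the next level set is equal to the volume of \<open>ball 0 s\<close>.\<close>
    define a b g s where "a = R (Suc j)" and "b = R j" and "g = (b - a) / 2" and "s = \<rho> * \<kappa> * \<theta> ^ j"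
    define v where "v = ?v (Suc j)"
    have [measurable]: "v \<in> borel_measurable borel" unfolding v_def by measurable
    have g: "g = \<rho> / 2 ^ (j + 3)" unfolding g_def a_def b_def R_diff by (simp add: power_add)
    have gpos: "0 < g" using g \<rho> by simp
    have ab: "0 < a" "a < b" "b \<le> \<rho>" using Rpos R\<rho> gpos unfolding a_def b_def g_def by auto
    have s: "0 < s" "s \<le> \<rho> / 4"
    proof -
      show "0 < s" unfolding s_def using \<rho> \<kappa> \<theta> by simp
      have "\<theta> ^ j \<le> 1" using \<theta> by (simp add: power_le_one)
      then have "\<kappa> * \<theta> ^ j \<le> 1/4 * 1" using \<kappa> \<theta> by (intro mult_mono) auto
      then have "\<rho> * (\<kappa> * \<theta> ^ j) \<le> \<rho> * (1/4)" using \<rho> by (intro mult_left_mono) auto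
      then show "s \<le> \<rho> / 4" unfolding s_def by (simp add: mult.assoc)
    qed
    define d where "d = h / 2 ^ Suc j"
    have d: "0 < d" unfolding d_def using h by simp
    have four: "(2::real) ^ j * 2 ^ j = 4 ^ j" by (simp flip: power_mult_distrib)
    have vd: "?v (Suc j) x \<le> ?v j x" and vd2: "0 < ?v (Suc j) x \<Longrightarrow> d \<le> ?v j x" for x
      using l_diff[of j] d unfolding d_def by auto
    have I3: "(\<integral>\<^sup>+x\<in>ball x\<^sub>1 b. ennreal ((v x)\<^sup>2) \<partial>lborel) \<le> ennreal (y j)"
    proof -
      have "(\<integral>\<^sup>+x\<in>ball x\<^sub>1 b. ennreal ((v x)\<^sup>2) \<partial>lborel) \<le> (\<integral>\<^sup>+x\<in>ball x\<^sub>1 (R j). ennreal ((?v j x)\<^sup>2) \<partial>lborel)"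
        unfolding v_def b_def by (intro nn_integral_mono mult_right_mono ennreal_leI power_mono vd) auto
      then show ?thesis using Suc.IH by (rule order_trans)
    qed
    \<comment> \<open>Where the higher truncation is positive, the lower one is at least
      \<open>d\<close>; division by \<open>d\<close> trades a square for a first power, and division
      by \<open>d\<^sup>2\<close> below bounds the level set.\<close>
    have I2: "(\<integral>\<^sup>+x\<in>ball x\<^sub>1 b. ennreal (v x) \<partial>lborel) \<le> ennreal (y j / d)"
    proof -
      have "(\<integral>\<^sup>+x\<in>ball x\<^sub>1 b. ennreal (v x) \<partial>lborel) \<le> (\<integral>\<^sup>+x. ennreal (1/d) * (ennreal ((?v j x)\<^sup>2) * indicator (ball x\<^sub>1 (R j)) x) \<partial>lborel)"
      proof (rule nn_integral_mono)
        fix x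
        have "v x \<le> 1/d * (?v j x)\<^sup>2"
        proof (cases "0 < v x")
          case True
          then have "v x * d \<le> ?v j x * ?v j x"
            using vd[of x] vd2[of x] d unfolding v_def by (intro mult_mono) auto
          then show ?thesis using d by (simp add: field_simps power2_eq_square)
        next
          case False
          then have "v x \<le> 0" by simp
          also have "0 \<le> 1/d * (?v j x)\<^sup>2" using d by simp
          finally show ?thesis .
        qed
        then have "ennreal (v x) \<le> ennreal (1/d) * ennreal ((?v j x)\<^sup>2)"
          using d by (simp add: ennreal_mult[symmetric] ennreal_leI)
        then show "ennreal (v x) * indicator (ball x\<^sub>1 b) x \<le> ennreal (1/d) * (ennreal ((?v j x)\<^sup>2) * indicator (ball x\<^sub>1 (R j)) x)"
          unfolding b_def by (auto split: split_indicator)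
      qed
      also have "\<dots> = ennreal (1/d) * (\<integral>\<^sup>+x\<in>ball x\<^sub>1 (R j). ennreal ((?v j x)\<^sup>2) \<partial>lborel)"
        by (rule nn_integral_cmult) measurable
      also have "\<dots> \<le> ennreal (1/d) * ennreal (y j)" by (intro mult_left_mono Suc.IH) simp
      also have "\<dots> = ennreal (y j / d)" using d y by (simp add: ennreal_mult[symmetric])
      finally show ?thesis .
    qed
    have A: "2 * emeasure lborel {x\<in>ball x\<^sub>1 b. 0 < v x} \<le> emeasure lborel (ball (0::'a) s)"
    proof -
      have "emeasure lborel {x\<in>ball x\<^sub>1 b. 0 < v x} = (\<integral>\<^sup>+x. indicator {x\<in>ball x\<^sub>1 b. 0 < v x} x \<partial>lborel)"
        by (rule nn_integral_indicator[symmetric]) measurable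
      also have "\<dots> \<le> (\<integral>\<^sup>+x. ennreal (1/d\<^sup>2) * (ennreal ((?v j x)\<^sup>2) * indicator (ball x\<^sub>1 (R j)) x) \<partial>lborel)"
      proof (rule nn_integral_mono)
        fix x
        show "indicator {x\<in>ball x\<^sub>1 b. 0 < v x} x \<le> ennreal (1/d\<^sup>2) * (ennreal ((?v j x)\<^sup>2) * indicator (ball x\<^sub>1 (R j)) x)"
        proof (cases "x \<in> ball x\<^sub>1 b \<and> 0 < v x")
          case True
          then have "d\<^sup>2 \<le> (?v j x)\<^sup>2" using vd2[of x] d unfolding v_def by (intro power_mono) auto
          then have "1 \<le> 1/d\<^sup>2 * (?v j x)\<^sup>2" using d by (simp add: field_simps)
          then have "ennreal 1 \<le> ennreal (1/d\<^sup>2) * ennreal ((?v j x)\<^sup>2)"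
            by (subst ennreal_mult[symmetric]) (auto intro: ennreal_leI)
          then show ?thesis using True unfolding b_def by simp
        qed auto
      qed
      also have "\<dots> = ennreal (1/d\<^sup>2) * (\<integral>\<^sup>+x\<in>ball x\<^sub>1 (R j). ennreal ((?v j x)\<^sup>2) \<partial>lborel)"
        by (rule nn_integral_cmult) measurable
      also have "\<dots> \<le> ennreal (1/d\<^sup>2) * ennreal (y j)" by (intro mult_left_mono Suc.IH) simp
      also have "\<dots> = ennreal (y j / d\<^sup>2)" using y by (simp add: ennreal_mult[symmetric])
      finally have "2 * emeasure lborel {x\<in>ball x\<^sub>1 b. 0 < v x} \<le> 2 * ennreal (y j / d\<^sup>2)" by (rule mult_left_mono) simp
      also have "\<dots> = ennreal (2 * (y j / d\<^sup>2))" by (subst ennreal_mult) (use y in auto)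
      also have "2 * (y j / d\<^sup>2) = unit_ball_vol N * s ^ N"
      proof -
        have "1 / d\<^sup>2 = 4 * 4 ^ j / h\<^sup>2"
          unfolding d_def using h four by (simp add: power2_eq_square field_simps)
        moreover have "q ^ j = (\<theta> ^ j) ^ N / 4 ^ j"
          unfolding q_def power_divide by (metis mult.commute power_mult)
        moreover have "2 * (y j / d\<^sup>2) = 2 * (\<nu> * h\<^sup>2 * \<rho> ^ N * q ^ j) * (1 / d\<^sup>2)"
          unfolding y_def by simp
        ultimately have "2 * (y j / d\<^sup>2) = 2 * (\<nu> * h\<^sup>2 * \<rho> ^ N * ((\<theta> ^ j) ^ N / 4 ^ j)) * (4 * 4 ^ j / h\<^sup>2)"
          by presburger
        also have "\<dots> = 8 * \<nu> * \<rho> ^ N * (\<theta> ^ j) ^ N" using h by simp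
        also have "\<dots> = unit_ball_vol N * s ^ N"
          unfolding s_def \<nu>_def power_mult_distrib by simp
        finally show ?thesis .
      qed
      also have "ennreal (unit_ball_vol N * s ^ N) = emeasure lborel (ball (0::'a) s)"
        using s by (simp add: emeasure_ball_eq N_def)
      finally show ?thesis .
    qed
    have T: "tail_le J v (ball x\<^sub>1 \<rho>) (- ball x\<^sub>1 (3/2 * \<rho>)) (\<Lambda> * h * \<rho> powr (-\<alpha>))"
      unfolding v_def by (rule tail_le_subset[OF tail]) (use lk[of "Suc j"] in auto)
    have I1: "(\<integral>\<^sup>+x\<in>ball x\<^sub>1 (3/2 * \<rho>). ennreal (v x) \<partial>lborel) \<le> ennreal (\<Lambda> * h * \<rho> ^ N)"
    proof (rule order_trans[OF _ mean], intro nn_integral_mono mult_right_mono ennreal_leI)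
      show "v x \<le> max (w x - k) 0" for x unfolding v_def using lk[of "Suc j"] by auto
    qed simp
    have "(\<integral>\<^sup>+x\<in>ball x\<^sub>1 a. ennreal ((v x)\<^sup>2) \<partial>lborel)
      \<le> ennreal (8 * C * s powr \<alpha> * (Cq * g powr (-\<alpha>) * y j + 2 * (C * g powr (-\<alpha>) / g ^ DIM('a) * (\<Lambda> * h * \<rho> ^ N) * (y j / d) + \<Lambda> * h * \<rho> powr (-\<alpha>) * (y j / d))))"
      unfolding v_def g_def
      by (rule de_giorgi_step[OF w \<rho> E ab s])
        (use T I1 I2 I3 A y d \<Lambda> h \<rho> in \<open>simp_all add: v_def\<close>)
    also have "\<dots> \<le> ennreal (y (Suc j))"
    proof (rule ennreal_leI)
      have gp: "g powr (-\<alpha>) \<le> \<rho> powr (-\<alpha>) * (64 * 4 ^ j)"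
      proof -
        have "g powr (-\<alpha>) = \<rho> powr (-\<alpha>) * (2 ^ (j + 3)) powr \<alpha>"
          unfolding g using \<rho> by (simp add: powr_divide powr_minus field_simps)
        also have "(2 ^ (j + 3)) powr \<alpha> \<le> (2 ^ (j + 3)) powr (2::real)" using \<alpha> by (intro powr_mono) auto
        also have "(2 ^ (j + 3)) powr (2::real) = 64 * 4 ^ j"
          using four by (simp add: power_add power2_eq_square)
        finally show ?thesis using \<rho> by (simp add: mult_left_mono)
      qed
      have gN: "1 / g ^ N = 2 ^ (j * N) * 8 ^ N / \<rho> ^ N"
      proof -
        have "1 / g ^ N = (2 ^ (j + 3)) ^ N / \<rho> ^ N" unfolding g by (simp add: power_divide)
        also have "((2::real) ^ (j + 3)) ^ N = 2 ^ (j * N) * 8 ^ N"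
          by (simp add: power_add power_mult_distrib power_mult)
        finally show ?thesis .
      qed
      have hd: "h / d = 2 * 2 ^ j" unfolding d_def using h by simp
      \<comment> \<open>The worst growth per step: \<open>2 ^ N\<close> from
        \<open>1 / g ^ N\<close>, at most 4 from \<open>g powr (-\<alpha>)\<close> and 2 from
        \<open>h / d\<close>. The condition on \<open>\<theta>\<close> makes
        \<open>B * \<theta> powr \<alpha>\<close> at most 1.\<close>
      define B where "B = (2::real) ^ (N + 3)"
      have Bj: "B ^ j = 2 ^ (j * N) * 8 ^ j"
      proof -
        have "B ^ j = (2 ^ N) ^ j * 8 ^ j" unfolding B_def by (simp add: power_add power_mult_distrib)
        also have "((2::real) ^ N) ^ j = 2 ^ (j * N)" by (metis mult.commute power_mult)
        finally show ?thesis .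
      qed
      have one: "(1::real) \<le> 2 ^ (j * N)" by simp
      have B4: "4 ^ j \<le> B ^ j"
      proof -
        have "(4::real) ^ j \<le> 8 ^ j" by (intro power_mono) auto
        also have "\<dots> \<le> 2 ^ (j * N) * 8 ^ j" using mult_right_mono[OF one, of "8 ^ j"] by simp
        finally show ?thesis unfolding Bj .
      qed
      have B2: "2 ^ j \<le> B ^ j"
      proof -
        have "(2::real) ^ j \<le> 4 ^ j" by (intro power_mono) auto
        then show ?thesis using B4 by simp
      qed
      let ?\<rho> = "\<rho> powr (-\<alpha>)"
      have t1: "Cq * g powr (-\<alpha>) * y j \<le> ?\<rho> * y j * B ^ j * (64 * Cq)"
      proof -
        have "g powr (-\<alpha>) \<le> ?\<rho> * (64 * B ^ j)"
          by (rule order_trans[OF gp]) (use B4 \<rho> in \<open>auto intro!: mult_left_mono\<close>)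
        then have "(Cq * y j) * g powr (-\<alpha>) \<le> (Cq * y j) * (?\<rho> * (64 * B ^ j))"
          by (rule mult_left_mono) (use Cq_pos y[of j] in simp)
        then show ?thesis by (simp add: mult_ac)
      qed
      have t2: "C * g powr (-\<alpha>) / g ^ N * (\<Lambda> * h * \<rho> ^ N) * (y j / d) \<le> ?\<rho> * y j * B ^ j * (2 * \<Lambda> * C * 8 ^ (N + 2))"
      proof -
        have "C * g powr (-\<alpha>) / g ^ N * (\<Lambda> * h * \<rho> ^ N) * (y j / d)
            = (C * \<Lambda> * y j * \<rho> ^ N) * (1 / g ^ N) * (h / d) * g powr (-\<alpha>)" by simp
        also have "\<dots> = (C * \<Lambda> * y j) * (2 ^ (j * N) * 8 ^ N) * (2 * 2 ^ j) * g powr (-\<alpha>)"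
          unfolding gN hd using \<rho> by simp
        also have "\<dots> \<le> (C * \<Lambda> * y j) * (2 ^ (j * N) * 8 ^ N) * (2 * 2 ^ j) * (?\<rho> * (64 * 4 ^ j))"
          by (rule mult_left_mono[OF gp]) (use C \<Lambda> y[of j] in simp)
        also have "\<dots> = ?\<rho> * y j * (2 ^ (j * N) * (2 ^ j * 4 ^ j)) * (2 * \<Lambda> * C * (8 ^ N * 64))"
          by (simp add: mult_ac)
        also have "2 ^ j * 4 ^ j = (8::real) ^ j" by (simp flip: power_mult_distrib)
        also have "(8::real) ^ N * 64 = 8 ^ (N + 2)" by (simp add: power_add)
        finally show ?thesis unfolding Bj by simp
      qed
      have t3: "\<Lambda> * h * ?\<rho> * (y j / d) \<le> ?\<rho> * y j * B ^ j * (2 * \<Lambda>)"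
      proof -
        have "\<Lambda> * h * ?\<rho> * (y j / d) = (?\<rho> * y j * \<Lambda>) * (h / d)" by simp
        also have "\<dots> \<le> (?\<rho> * y j * \<Lambda>) * (2 * B ^ j)"
          unfolding hd by (rule mult_left_mono) (use B2 y[of j] \<Lambda> in auto)
        finally show ?thesis by (simp add: mult_ac)
      qed
      have "Cq * g powr (-\<alpha>) * y j + 2 * (C * g powr (-\<alpha>) / g ^ N * (\<Lambda> * h * \<rho> ^ N) * (y j / d) + \<Lambda> * h * ?\<rho> * (y j / d))
          \<le> ?\<rho> * y j * B ^ j * (64 * Cq) + 2 * (?\<rho> * y j * B ^ j * (2 * \<Lambda> * C * 8 ^ (N + 2)) + ?\<rho> * y j * B ^ j * (2 * \<Lambda>))"
        by (intro add_mono mult_left_mono t1 t2 t3) simp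
      also have "\<dots> = ?\<rho> * y j * B ^ j * Q" unfolding Q_def by (simp add: algebra_simps)
      finally have br: "Cq * g powr (-\<alpha>) * y j + 2 * (C * g powr (-\<alpha>) / g ^ N * (\<Lambda> * h * \<rho> ^ N) * (y j / d) + \<Lambda> * h * ?\<rho> * (y j / d))
          \<le> ?\<rho> * y j * B ^ j * Q" .
      have Q: "0 \<le> Q" unfolding Q_def using Cq_pos \<Lambda> C by simp
      have sp: "s powr \<alpha> = \<rho> powr \<alpha> * \<kappa> powr \<alpha> * (\<theta> powr \<alpha>) ^ j"
      proof -
        have "(\<theta> ^ j) powr \<alpha> = (\<theta> powr \<alpha>) ^ j"
          using \<theta> by (simp add: powr_powr mult.commute flip: powr_realpow)
        then show ?thesis unfolding s_def using \<rho> \<kappa> \<theta> by (simp add: powr_mult)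
      qed
      have "8 * C * s powr \<alpha> * (Cq * g powr (-\<alpha>) * y j + 2 * (C * g powr (-\<alpha>) / g ^ N * (\<Lambda> * h * \<rho> ^ N) * (y j / d) + \<Lambda> * h * ?\<rho> * (y j / d)))
          \<le> 8 * C * s powr \<alpha> * (?\<rho> * y j * B ^ j * Q)"
        by (rule mult_left_mono[OF br]) (use C in simp)
      also have "\<dots> = (\<rho> powr \<alpha> * ?\<rho>) * ((8 * C * \<kappa> powr \<alpha> * Q) * y j * (B * \<theta> powr \<alpha>) ^ j)"
        unfolding sp by (simp add: power_mult_distrib mult_ac)
      also have "\<rho> powr \<alpha> * ?\<rho> = 1" using \<rho> by (simp add: powr_minus)
      also have "1 * ((8 * C * \<kappa> powr \<alpha> * Q) * y j * (B * \<theta> powr \<alpha>) ^ j) \<le> 1 * (q * y j * 1)"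
        using \<theta> \<kappa>(3) y[of j] C Q q
        by (intro mult_left_mono mult_mono power_le_one) (auto simp: B_def)
      also have "\<dots> = y (Suc j)" unfolding y_def by simp
      finally show "8 * C * s powr \<alpha> * (Cq * g powr (-\<alpha>) * y j + 2 * (C * g powr (-\<alpha>) / g ^ DIM('a) * (\<Lambda> * h * \<rho> ^ N) * (y j / d) + \<Lambda> * h * ?\<rho> * (y j / d))) \<le> y (Suc j)"
        unfolding N_def .
    qed
    finally show ?case unfolding v_def a_def .
  qed
  let ?V = "\<lambda>x. ennreal ((max (w x - (k + h)) 0)\<^sup>2) * indicator (ball x\<^sub>1 (\<rho>/2)) x"
  have "(\<integral>\<^sup>+x. ?V x \<partial>lborel) \<le> ennreal (y j)" for j
  proof (rule order_trans[OF _ main], rule nn_integral_mono)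
    fix x
    have "l j \<le> k + h" unfolding l_def using h by (simp add: algebra_simps)
    then have "(max (w x - (k + h)) 0)\<^sup>2 \<le> (?v j x)\<^sup>2" by (intro power_mono) auto
    moreover have "\<rho>/2 \<le> R j" unfolding R_def using \<rho> by (simp add: algebra_simps)
    ultimately show "?V x \<le> ennreal ((?v j x)\<^sup>2) * indicator (ball x\<^sub>1 (R j)) x"
      by (auto split: split_indicator intro: ennreal_leI)
  qed
  moreover have "(\<lambda>j. ennreal (y j)) \<longlonglongrightarrow> ennreal 0"
  proof (rule tendsto_ennrealI)
    have "\<theta> ^ N \<le> 1" using \<theta> by (simp add: power_le_one)
    then have "\<bar>q\<bar> < 1" using q unfolding q_def by simp
    then have "(\<lambda>j. q ^ j) \<longlonglongrightarrow> 0" by (rule LIMSEQ_abs_realpow_zero2)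
    from tendsto_mult[OF tendsto_const this] show "y \<longlonglongrightarrow> 0" unfolding y_def by simp
  qed
  ultimately have "(\<integral>\<^sup>+x. ?V x \<partial>lborel) \<le> ennreal 0" by (intro LIMSEQ_le_const) auto
  then have "AE x in lborel. ?V x = 0"
    by (subst nn_integral_0_iff_AE[symmetric]) auto
  then show ?thesis
  proof (rule AE_mp, intro AE_I2 impI)
    fix x assume "?V x = 0" "x \<in> ball x\<^sub>1 (\<rho>/2)"
    then have "(max (w x - (k + h)) 0)\<^sup>2 \<le> 0" by (simp add: ennreal_eq_0_iff)
    then show "w x \<le> k + h" by (auto simp: max_def split: if_splits)
  qed
qed

end

section \<open>De Giorgi's lemma with uniform constants, and transformations of solutions\<close>

definition de_giorgi_bound ::
  "('a::euclidean_space \<times> 'a) measure \<Rightarrow> 'a set \<Rightarrow> real \<Rightarrow> real \<Rightarrow> real \<Rightarrow> bool" where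
  "de_giorgi_bound J E \<alpha> \<Lambda> \<nu> \<longleftrightarrow> (\<forall>w x\<^sub>1 \<rho> k h.
     weak_sol J E w \<longrightarrow> 0 < \<rho> \<longrightarrow> ball x\<^sub>1 (3/2 * \<rho>) \<subseteq> E \<longrightarrow> 0 < h \<longrightarrow>
     (\<integral>\<^sup>+x\<in>ball x\<^sub>1 \<rho>. ennreal ((max (w x - k) 0)\<^sup>2) \<partial>lborel) \<le> ennreal (\<nu> * h\<^sup>2 * \<rho> ^ DIM('a)) \<longrightarrow>
     (\<integral>\<^sup>+x\<in>ball x\<^sub>1 (3/2 * \<rho>). ennreal (max (w x - k) 0) \<partial>lborel) \<le> ennreal (\<Lambda> * h * \<rho> ^ DIM('a)) \<longrightarrow>
     tail_le J (\<lambda>x. max (w x - k) 0) (ball x\<^sub>1 \<rho>) (- ball x\<^sub>1 (3/2 * \<rho>)) (\<Lambda> * h * \<rho> powr (-\<alpha>)) \<longrightarrow>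
     (AE x in lborel. x \<in> ball x\<^sub>1 (\<rho>/2) \<longrightarrow> w x \<le> k + h))"

text \<open>Order of choice: \<open>\<theta>\<close> from the dimension and \<alpha>, then
  \<open>\<kappa>\<close> from \<open>\<theta>\<close> and \<open>Q\<close>, then
  \<open>\<nu>\<close> from \<open>\<kappa>\<close>. None of them depends on \<open>J\<close> or
  \<open>E\<close>; this is why the conclusion is packaged as a predicate in which both are still
  free.\<close>

lemma de_giorgi:
  fixes \<alpha> C \<Lambda> :: real
  assumes \<alpha>: "0 < \<alpha>" "\<alpha> < 2" and C: "1 \<le> C" and \<Lambda>: "0 \<le> \<Lambda>"
  obtains \<nu> where "0 < \<nu>"
    and "\<forall>(J :: ('a::euclidean_space \<times> 'a) measure) E. jump_form J \<alpha> C E \<longrightarrow> de_giorgi_bound J E \<alpha> \<Lambda> \<nu>"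
proof -
  let ?N = "DIM('a)"
  define Q where "Q = 64 * decay_const \<alpha> C + 4 * \<Lambda> * (C * 8 ^ (?N + 2) + 1)"
  have dc: "0 < decay_const \<alpha> C" using \<alpha> C by (rule decay_const_pos)
  have Q: "0 < Q" unfolding Q_def using dc \<Lambda> C by (simp add: add_pos_nonneg)
  define \<theta> where "\<theta> = 2 powr (- (real ?N + 3) / \<alpha>)"
  have \<theta>: "0 < \<theta>" "\<theta> \<le> 1" "2 ^ (?N + 3) * \<theta> powr \<alpha> \<le> 1"
  proof -
    show "0 < \<theta>" unfolding \<theta>_def by simp
    have "- (real ?N + 3) / \<alpha> \<le> 0" using \<alpha> by (simp add: divide_le_0_iff)
    then have "2 powr (- (real ?N + 3) / \<alpha>) \<le> 2 powr 0" by (intro powr_mono) auto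
    then show "\<theta> \<le> 1" unfolding \<theta>_def by simp
    have "\<theta> powr \<alpha> = 2 powr (- (real ?N + 3))" unfolding \<theta>_def powr_powr using \<alpha> by simp
    also have "\<dots> = 1 / 2 powr (real (?N + 3))" by (simp only: powr_minus_divide of_nat_add of_nat_numeral)
    also have "2 powr (real (?N + 3)) = (2::real) ^ (?N + 3)" by (rule powr_realpow) simp
    finally show "2 ^ (?N + 3) * \<theta> powr \<alpha> \<le> 1" by simp
  qed
  define q where "q = \<theta> ^ ?N / 4"
  have q: "0 < q" unfolding q_def using \<theta> by simp
  \<comment> \<open>Solves \<open>8 * C * \<kappa> powr \<alpha> * Q = q\<close>, capped at
    \<open>1/4\<close> so that the Faber-Krahn radii do not exceed \<open>\<rho> / 4\<close> and
    their balls fit into the ball of radius \<open>3/2 * \<rho>\<close>.\<close>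
  define \<kappa> where "\<kappa> = min (1/4) ((q / (8 * C * Q)) powr (1/\<alpha>))"
  have b: "0 < q / (8 * C * Q)" using q C Q by simp
  have \<kappa>: "0 < \<kappa>" "\<kappa> \<le> 1/4" "8 * C * \<kappa> powr \<alpha> * Q \<le> q"
  proof -
    show "0 < \<kappa>" unfolding \<kappa>_def using q C Q by simp
    show "\<kappa> \<le> 1/4" unfolding \<kappa>_def by simp
    have "\<kappa> powr \<alpha> \<le> ((q / (8 * C * Q)) powr (1/\<alpha>)) powr \<alpha>"
      using \<open>0 < \<kappa>\<close> \<alpha> unfolding \<kappa>_def by (intro powr_mono2) auto
    also have "\<dots> = q / (8 * C * Q)"
    proof -
      have "1 / \<alpha> * \<alpha> = 1" using \<alpha> by simp
      then show ?thesis using powr_one[OF less_imp_le[OF b]] by (simp only: powr_powr)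
    qed
    finally show "8 * C * \<kappa> powr \<alpha> * Q \<le> q" using C Q by (simp add: field_simps)
  qed
  show thesis
  proof (rule that)
    show "0 < unit_ball_vol ?N * \<kappa> ^ ?N / 8" using \<kappa> by simp
  qed (unfold de_giorgi_bound_def, intro allI impI, rule jump_form.de_giorgi_iteration[OF _ \<theta> \<kappa>(1,2) \<kappa>(3)[unfolded q_def Q_def] \<Lambda>])
qed

text \<open>\<open>F\<close> need not vanish at 0, which matters for the truncated logarithm and for
  adding constants: \<open>E\<close> is bounded, hence constants are square integrable over the sets
  \<open>D\<close>.\<close>

lemma loc_space_Lipschitz:
  assumes J: "jump_form J \<alpha> C E" and w: "loc_space J E w" and F: "\<And>s t. \<bar>F s - F t\<bar> \<le> L * \<bar>s - t\<bar>"
  shows "loc_space J E (\<lambda>x. F (w x))"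
proof -
  interpret jump_form J \<alpha> C E by (rule J)
  have Lpos: "0 \<le> L" using order_trans[OF abs_ge_zero F[of 0 1]] by simp
  have [measurable]: "w \<in> borel_measurable borel" using w by (simp add: loc_space_def)
  have [measurable]: "F \<in> borel_measurable borel" by (rule Lipschitz_borel[OF F])
  show ?thesis unfolding loc_space_def
  proof (intro conjI allI impI)
    fix D :: "'a set" assume D: "open D \<and> closure D \<subseteq> E"
    then have [measurable]: "D \<in> sets borel" by simp
    have w2: "(\<integral>\<^sup>+x\<in>D. ennreal ((w x)\<^sup>2) \<partial>lborel) < \<infinity>" and wf: "form_on J D w < \<infinity>"
      using w D unfolding loc_space_def by auto
    have "bounded D" using bounded_subset[OF bounded_E] D closure_subset by blast
    then have Dfin: "emeasure lborel D < \<infinity>" using emeasure_bounded_finite by simp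
    have "(\<integral>\<^sup>+x\<in>D. ennreal ((F (w x))\<^sup>2) \<partial>lborel) \<le> (\<integral>\<^sup>+x. ennreal (2 * (F 0)\<^sup>2) * indicator D x + ennreal (2 * L\<^sup>2) * (ennreal ((w x)\<^sup>2) * indicator D x) \<partial>lborel)"
    proof (rule nn_integral_mono)
      fix x
      have "(F (w x))\<^sup>2 \<le> 2 * (F 0)\<^sup>2 + 2 * L\<^sup>2 * (w x)\<^sup>2" by (rule Lipschitz_power2_le[OF F])
      then have "ennreal ((F (w x))\<^sup>2) \<le> ennreal (2 * (F 0)\<^sup>2 + 2 * L\<^sup>2 * (w x)\<^sup>2)" by (rule ennreal_leI)
      also have "\<dots> = ennreal (2 * (F 0)\<^sup>2) + ennreal (2 * L\<^sup>2) * ennreal ((w x)\<^sup>2)"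
        by (simp add: ennreal_plus ennreal_mult[symmetric])
      finally show "ennreal ((F (w x))\<^sup>2) * indicator D x \<le> ennreal (2 * (F 0)\<^sup>2) * indicator D x + ennreal (2 * L\<^sup>2) * (ennreal ((w x)\<^sup>2) * indicator D x)"
        by (auto split: split_indicator)
    qed
    also have "\<dots> = ennreal (2 * (F 0)\<^sup>2) * emeasure lborel D + ennreal (2 * L\<^sup>2) * (\<integral>\<^sup>+x\<in>D. ennreal ((w x)\<^sup>2) \<partial>lborel)"
      by (simp add: nn_integral_add nn_integral_cmult nn_integral_cmult_indicator)
    also have "\<dots> < \<infinity>" using w2 Dfin by (simp add: ennreal_mult_less_top)
    finally show "(\<integral>\<^sup>+x\<in>D. ennreal ((F (w x))\<^sup>2) \<partial>lborel) < \<infinity>" .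
    have "form_on J D (\<lambda>x. F (w x)) \<le> (\<integral>\<^sup>+p. ennreal (L\<^sup>2) * (ennreal ((w (fst p) - w (snd p))\<^sup>2) * indicator (D \<times> D) p) \<partial>J)"
      unfolding form_on_def
    proof (rule nn_integral_mono)
      fix p :: "'a \<times> 'a"
      have "\<bar>F (w (fst p)) - F (w (snd p))\<bar>\<^sup>2 \<le> (L * \<bar>w (fst p) - w (snd p)\<bar>)\<^sup>2" by (intro power_mono F) simp
      then have "(F (w (fst p)) - F (w (snd p)))\<^sup>2 \<le> L\<^sup>2 * (w (fst p) - w (snd p))\<^sup>2" by (simp add: power_mult_distrib)
      then have "ennreal ((F (w (fst p)) - F (w (snd p)))\<^sup>2) \<le> ennreal (L\<^sup>2) * ennreal ((w (fst p) - w (snd p))\<^sup>2)"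
        by (simp add: ennreal_mult[symmetric] ennreal_leI)
      then show "ennreal ((F (w (fst p)) - F (w (snd p)))\<^sup>2) * indicator (D \<times> D) p \<le> ennreal (L\<^sup>2) * (ennreal ((w (fst p) - w (snd p))\<^sup>2) * indicator (D \<times> D) p)"
        by (auto split: split_indicator)
    qed
    also have "\<dots> = ennreal (L\<^sup>2) * form_on J D w" unfolding form_on_def by (rule nn_integral_cmult) measurable
    also have "\<dots> < \<infinity>" using wf by (simp add: ennreal_mult_less_top)
    finally show "form_on J D (\<lambda>x. F (w x)) < \<infinity>" .
  qed simp
qed

text \<open>De Giorgi's lemma bounds from above; applied to the negative of a solution it yields the
  lower bounds of \<open>expansion_of_positivity\<close>.\<close>

lemma weak_sol_uminus:
  assumes J: "jump_form J \<alpha> C E" and w: "weak_sol J E w"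
  shows "weak_sol J E (\<lambda>x. - w x)"
  unfolding weak_sol_def
proof (intro conjI ballI impI)
  show "loc_space J E (\<lambda>x. - w x)"
    by (rule loc_space_Lipschitz[OF J, where F = uminus and L = 1]) (use w in \<open>auto simp: weak_sol_def\<close>)
  show "\<forall>x R. 0 < R \<and> ball x R \<subseteq> E \<longrightarrow> (\<exists>T. tail_le J (\<lambda>y. \<bar>- w y\<bar>) (ball x (7/8 * R)) (- ball x R) T)"
    using w unfolding weak_sol_def by simp
  fix \<phi> assume \<phi>: "\<phi> \<in> borel_measurable borel" and
    "(\<forall>x. 0 \<le> \<phi> x) \<and> (\<integral>\<^sup>+x. ennreal ((\<phi> x)\<^sup>2) \<partial>lborel) < \<infinity> \<and> form_on J UNIV \<phi> < \<infinity> \<and> closure {x. \<phi> x \<noteq> 0} \<subseteq> E \<and>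
      integrable J (\<lambda>p. (- w (fst p) - - w (snd p)) * (\<phi> (fst p) - \<phi> (snd p)))"
  then have a: "(\<forall>x. 0 \<le> \<phi> x) \<and> (\<integral>\<^sup>+x. ennreal ((\<phi> x)\<^sup>2) \<partial>lborel) < \<infinity> \<and> form_on J UNIV \<phi> < \<infinity> \<and> closure {x. \<phi> x \<noteq> 0} \<subseteq> E"
    and i: "integrable J (\<lambda>p. (- w (fst p) - - w (snd p)) * (\<phi> (fst p) - \<phi> (snd p)))" by auto
  have eq: "(- w (fst p) - - w (snd p)) * (\<phi> (fst p) - \<phi> (snd p)) = - ((w (fst p) - w (snd p)) * (\<phi> (fst p) - \<phi> (snd p)))" for p
    by (simp add: algebra_simps)
  have "integrable J (\<lambda>p. (w (fst p) - w (snd p)) * (\<phi> (fst p) - \<phi> (snd p)))"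
    using i unfolding eq by simp
  then have "(LINT p|J. (w (fst p) - w (snd p)) * (\<phi> (fst p) - \<phi> (snd p))) = 0"
    using w a \<phi> unfolding weak_sol_def by blast
  then show "(LINT p|J. (- w (fst p) - - w (snd p)) * (\<phi> (fst p) - \<phi> (snd p))) = 0"
    unfolding eq by simp
qed

section \<open>The logarithmic estimate\<close>

text \<open>With \<open>q = sqrt (b/a)\<close> the left-hand side equals \<open>(s - t)\<^sup>2 - (s * q - t / q)\<^sup>2\<close>.\<close>

lemma log_pointwise_ordered:
  fixes a b s t :: real
  assumes ab: "0 < a" "a \<le> b" and s: "0 \<le> s" and t: "0 \<le> t"
  shows "(a - b) * (s\<^sup>2 / a - t\<^sup>2 / b) \<le> 2 * (s - t)\<^sup>2 - 1/8 * (min s t)\<^sup>2 * (ln a - ln b)\<^sup>2"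
proof -
  define q where "q = sqrt (b / a)"
  have q1: "1 \<le> q" unfolding q_def using ab by simp
  have q2: "q\<^sup>2 = b / a" unfolding q_def using ab by simp
  have lnq: "ln q = (ln b - ln a) / 2"
    unfolding q_def using ab by (simp add: ln_sqrt ln_div)
  \<comment> \<open>\<open>A\<close> is the value of \<open>s * q - t / q\<close> when both cutoff
    values equal their minimum \<open>m\<close>; the actual values lower it by at most
    \<open>d\<close>. The logarithm enters through ln q <= q - 1/q.\<close>
  define m A d where "m = min s t" and "A = m * (q - 1/q)" and "d = \<bar>s - t\<bar>"
  have m: "0 \<le> m" unfolding m_def using s t by simp
  have iq: "1/q \<le> 1" "0 < 1/q" using q1 by auto
  have "ln q \<le> q - 1" using q1 by (intro ln_le_minus_one) auto
  also have "\<dots> \<le> q - 1/q" using iq by simp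
  finally have lnA: "m * ln q \<le> A" unfolding A_def using m by (rule mult_left_mono)
  have lnq0: "0 \<le> ln q" using q1 by simp
  have A0: "0 \<le> A" using lnA m lnq0 by (meson mult_nonneg_nonneg order_trans)
  have "A - d \<le> s * q - t / q"
  proof (cases "s \<le> t")
    case True
    then have e: "s * q - t / q = A - d * (1/q)" unfolding A_def m_def d_def by (simp add: algebra_simps diff_divide_distrib)
    have "d * (1/q) \<le> d * 1" by (intro mult_left_mono iq) (simp add: d_def)
    then show ?thesis using e by simp
  next
    case False
    then have e: "s * q - t / q = A + d * q" unfolding A_def m_def d_def by (simp add: algebra_simps)
    have "0 \<le> d * q" using q1 by (simp add: d_def)
    moreover have "0 \<le> d" by (simp add: d_def)
    ultimately show ?thesis using e by linarith
  qed
  moreover have "1/2 * A\<^sup>2 - d\<^sup>2 \<le> (A - d)\<^sup>2"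
    using zero_le_power2[of "A - 2 * d"] unfolding power2_diff by (simp add: power_mult_distrib)
  moreover have "1/2 * A\<^sup>2 - d\<^sup>2 \<le> 0" if "A < d"
  proof -
    have "A\<^sup>2 \<le> d\<^sup>2" using that A0 by (intro power_mono) auto
    then show ?thesis using zero_le_power2[of d] by linarith
  qed
  ultimately have "1/2 * A\<^sup>2 - d\<^sup>2 \<le> (s * q - t / q)\<^sup>2"
    by (smt (verit) power_mono zero_le_power2)
  moreover have "(m * ln q)\<^sup>2 \<le> A\<^sup>2" using lnA m lnq0 by (intro power_mono) auto
  moreover have "(m * ln q)\<^sup>2 = 1/4 * m\<^sup>2 * (ln a - ln b)\<^sup>2"
    unfolding lnq by (simp add: power_mult_distrib power_divide power2_commute)
  ultimately have "1/8 * m\<^sup>2 * (ln a - ln b)\<^sup>2 - (s - t)\<^sup>2 \<le> (s * q - t / q)\<^sup>2"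
    unfolding d_def by simp
  moreover have "(a - b) * (s\<^sup>2 / a - t\<^sup>2 / b) = (s - t)\<^sup>2 - (s * q - t / q)\<^sup>2"
  proof -
    have "(s * q - t / q)\<^sup>2 = s\<^sup>2 * q\<^sup>2 - 2 * s * t + t\<^sup>2 / q\<^sup>2"
      using q1 by (simp add: power2_diff power_mult_distrib power_divide)
    then show ?thesis unfolding q2 using ab by (simp add: power2_diff field_simps)
  qed
  ultimately show ?thesis unfolding m_def by linarith
qed

text \<open>With \<open>a\<close>, \<open>b\<close> values of the solution and \<open>s\<close>,
  \<open>t\<close> values of the cutoff, the left-hand side is the energy integrand for the test
  function \<eta>^2/u. Exchanging the two points changes nothing, so the ordered case
  suffices.\<close>

lemma log_pointwise:
  fixes a b s t :: real
  assumes "0 < a" "0 < b" "0 \<le> s" "0 \<le> t"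
  shows "(a - b) * (s\<^sup>2 / a - t\<^sup>2 / b) \<le> 2 * (s - t)\<^sup>2 - 1/8 * (min s t)\<^sup>2 * (ln a - ln b)\<^sup>2"
proof (cases "a \<le> b")
  case False
  have "(a - b) * (s\<^sup>2 / a - t\<^sup>2 / b) = (b - a) * (t\<^sup>2 / b - s\<^sup>2 / a)"
    using minus_mult_minus[of "b - a" "t\<^sup>2 / b - s\<^sup>2 / a"] by simp
  also have "\<dots> \<le> 2 * (t - s)\<^sup>2 - 1/8 * (min t s)\<^sup>2 * (ln b - ln a)\<^sup>2"
    using False assms by (intro log_pointwise_ordered) auto
  finally show ?thesis by (simp add: power2_commute min.commute)
qed (use assms log_pointwise_ordered in auto)

text \<open>The summands come from the energy of the cutoff, from twice the far-jump term and from
  twice the tail constant 9; the last two factors are the volume of a ball of radius 6.\<close>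

definition log_const :: "real \<Rightarrow> real \<Rightarrow> nat \<Rightarrow> real" where
  "log_const \<alpha> C n = (2 * decay_const \<alpha> C + 2 * C + 18) * unit_ball_vol n * 6 ^ n"

context jump_form
begin

text \<open>A single inequality between the integrals of \<open>?Q\<close> and \<open>?U\<close>
  gives both bounds. Besides the squared increments of the logarithm it retains the jumps from the
  ball of radius \<open>4 * \<rho>\<close> to the outside of the one of radius
  \<open>6 * \<rho>\<close>. Their contribution has a good sign and would often be discarded; here
  it carries the ratio \<open>u\<^sub>+(y) / u(x)\<close> that makes UJS effective.\<close>

lemma log_estimate:
  assumes w: "weak_sol J E w" and \<rho>: "0 < \<rho>" and E: "ball x\<^sub>1 (7 * \<rho>) \<subseteq> E" and \<tau>: "0 < \<tau>"
    and pos: "\<And>x. x \<in> ball x\<^sub>1 (6 * \<rho>) \<Longrightarrow> \<tau> \<le> w x"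
    and tail: "tail_le J (\<lambda>y. max (- w y) 0) (ball x\<^sub>1 (5 * \<rho>)) UNIV (9 * \<tau> * \<rho> powr (-\<alpha>))"
  shows "(\<integral>\<^sup>+p. ennreal ((ln (w (fst p)) - ln (w (snd p)))\<^sup>2) * indicator (ball x\<^sub>1 (4 * \<rho>) \<times> ball x\<^sub>1 (4 * \<rho>)) p \<partial>J)
      \<le> ennreal (8 * (log_const \<alpha> C DIM('a) * \<rho> powr (-\<alpha>) * \<rho> ^ DIM('a)))"
    and "(\<integral>\<^sup>+p. ennreal (max (w (snd p)) 0 / w (fst p)) * indicator (ball x\<^sub>1 (4 * \<rho>) \<times> - ball x\<^sub>1 (6 * \<rho>)) p \<partial>J)
      \<le> ennreal (log_const \<alpha> C DIM('a) * \<rho> powr (-\<alpha>) * \<rho> ^ DIM('a))"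
proof -
  let ?c = "cutoff x\<^sub>1 (4 * \<rho>) (5 * \<rho>)"
  let ?B4 = "ball x\<^sub>1 (4 * \<rho>)" and ?B5 = "ball x\<^sub>1 (5 * \<rho>)" and ?D = "ball x\<^sub>1 (6 * \<rho>)"
  have sub: "?B4 \<subseteq> ?B5" "?B5 \<subseteq> ?D" using \<rho> by auto
  have [measurable]: "w \<in> borel_measurable borel" using w by (simp add: loc_space_def weak_sol_def)
  have F: "\<bar>1 / max s \<tau> - 1 / max t \<tau>\<bar> \<le> 1 / \<tau>\<^sup>2 * \<bar>s - t\<bar>" for s t
  proof -
    have "1 / max s \<tau> - 1 / max t \<tau> = (max t \<tau> - max s \<tau>) / (max s \<tau> * max t \<tau>)"
      using \<tau> by (simp add: field_simps)
    then have "\<bar>1 / max s \<tau> - 1 / max t \<tau>\<bar> = \<bar>max t \<tau> - max s \<tau>\<bar> / (max s \<tau> * max t \<tau>)"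
      using \<tau> by (simp add: abs_mult)
    also have "\<dots> \<le> \<bar>s - t\<bar> / (\<tau> * \<tau>)"
      using \<tau> by (intro frac_le mult_mono) auto
    finally show ?thesis by (simp add: power2_eq_square)
  qed
  define \<phi> where "\<phi> = (\<lambda>x. (?c x)\<^sup>2 * (1 / max (w x) \<tau>))"
  let ?P = "\<lambda>p. (w (fst p) - w (snd p)) * (\<phi> (fst p) - \<phi> (snd p))"
  have ab: "0 < 4 * \<rho>" "4 * \<rho> < 5 * \<rho>" using \<rho> by auto
  have E5: "ball x\<^sub>1 (5/4 * (5 * \<rho>)) \<subseteq> E" by (rule subset_trans[OF subset_ball E]) (use \<rho> in auto)
  have P: "integrable J ?P" "(LINT p|J. ?P p) = 0"
    using weak_sol_test[OF w F _ ab E5] \<tau> unfolding \<phi>_def by auto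
  have \<phi>out: "\<phi> x = 0" if "x \<notin> ?B5" for x
    unfolding \<phi>_def using that \<rho> by (simp add: cutoff_eq_0)
  have \<phi>in: "\<phi> x = (?c x)\<^sup>2 / w x" if "x \<in> ?D" for x
    unfolding \<phi>_def using pos[OF that] by (simp add: max_absorb1)
  have c1: "?c x = 1" if "x \<in> ?B4" for x using that \<rho> by (intro cutoff_eq_1) auto
  \<comment> \<open>\<open>?U1\<close> is the energy of the cutoff. For a pair with one point in
    \<open>?B5\<close> and the other outside \<open>?D\<close>, \<open>?U2\<close> and
    \<open>?U3\<close> account for w(x) \<phi>(x) <= 1, and \<open>?U4\<close>, \<open>?U5\<close>
    for the negative part at the outer point, where 1/w is at most \<open>1/\<tau>\<close>.\<close>
  let ?U1 = "\<lambda>p. 2 * (indicat_real ?D (fst p) * (?c (fst p) - ?c (snd p))\<^sup>2)"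
  let ?U2 = "\<lambda>p. indicat_real ?B5 (fst p) * indicat_real (far \<rho>) p"
  let ?U3 = "\<lambda>p. indicat_real ?B5 (snd p) * indicat_real (far \<rho>) p"
  let ?U4 = "\<lambda>p. indicat_real ?B5 (fst p) * max (- w (snd p)) 0 * indicat_real (?B5 \<times> UNIV) p * (1/\<tau>)"
  let ?U5 = "\<lambda>p. indicat_real ?B5 (snd p) * max (- w (fst p)) 0 * indicat_real (UNIV \<times> ?B5) p * (1/\<tau>)"
  let ?U = "\<lambda>p. ?U1 p + ?U2 p + ?U3 p + ?U4 p + ?U5 p"
  let ?Q1 = "\<lambda>p. 1/8 * (ln (w (fst p)) - ln (w (snd p)))\<^sup>2 * indicat_real (?B4 \<times> ?B4) p"
  let ?Q2 = "\<lambda>p. max (w (snd p)) 0 / max (w (fst p)) \<tau> * indicat_real (?B4 \<times> - ?D) p"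
  let ?Q = "\<lambda>p. ?Q1 p + ?Q2 p"
  have U0: "0 \<le> ?U1 p" "0 \<le> ?U2 p" "0 \<le> ?U3 p" "0 \<le> ?U4 p" "0 \<le> ?U5 p" for p using \<tau> by auto
  have Q0: "0 \<le> ?Q1 p" "0 \<le> ?Q2 p" for p using \<tau> by auto
  \<comment> \<open>The term with \<open>max (w y) 0\<close> enters with a minus sign. It is kept
    only where the cutoff equals 1, and becomes \<open>?Q2\<close>.\<close>
  have cross: "(w x - w y) * \<phi> x \<le> 1 + max (- w y) 0 / \<tau> - max (w y) 0 / w x * indicat_real ?B4 x"
    if x: "x \<in> ?B5" for x y
  proof -
    have wx: "\<tau> \<le> w x" "0 < w x" using pos[of x] x sub \<tau> by auto
    have cc: "(?c x)\<^sup>2 \<le> 1" "0 \<le> (?c x)\<^sup>2" using cutoff_range[of x\<^sub>1 "4 * \<rho>" "5 * \<rho>" x] by (auto simp: power_le_one)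
    have "w y = max (w y) 0 - max (- w y) 0" by auto
    then have "(w x - w y) * \<phi> x = (w x - max (w y) 0 + max (- w y) 0) * ((?c x)\<^sup>2 / w x)"
      using \<phi>in[of x] x sub by auto
    also have "\<dots> = (?c x)\<^sup>2 - (?c x)\<^sup>2 * (max (w y) 0 / w x) + (?c x)\<^sup>2 * (max (- w y) 0 / w x)"
      using wx by (simp add: field_simps)
    also have "\<dots> \<le> 1 - indicat_real ?B4 x * (max (w y) 0 / w x) + 1 * (max (- w y) 0 / \<tau>)"
    proof (intro add_mono diff_mono mult_mono cc)
      show "indicat_real ?B4 x \<le> (?c x)\<^sup>2" using c1[of x] by (auto split: split_indicator)
      show "max (- w y) 0 / w x \<le> max (- w y) 0 / \<tau>" using wx \<tau> by (intro divide_left_mono) auto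
    qed (use wx in auto)
    finally show ?thesis by (simp add: mult.commute)
  qed
  have farp: "\<rho> \<le> dist x y" if "x \<in> ?B5" "y \<notin> ?D" for x y
    using that dist_triangle[of x\<^sub>1 y x] by auto
  have pw: "?P p \<le> ?U p - ?Q p" for p
  proof -
    obtain x y where p: "p = (x, y)" by fastforce
    consider "x \<in> ?D" "y \<in> ?D" | "x \<in> ?B5" "y \<notin> ?D" | "x \<notin> ?D" "y \<in> ?B5" | "x \<notin> ?B5" "y \<notin> ?B5"
      using sub by blast
    then show ?thesis
    proof cases
      case 1
      have wp: "0 < w x" "0 < w y" using pos 1 \<tau> by (meson less_le_trans)+
      have "?P p = (w x - w y) * ((?c x)\<^sup>2 / w x - (?c y)\<^sup>2 / w y)" using 1 p by (simp add: \<phi>in)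
      also have "\<dots> \<le> 2 * (?c x - ?c y)\<^sup>2 - 1/8 * (min (?c x) (?c y))\<^sup>2 * (ln (w x) - ln (w y))\<^sup>2"
        by (intro log_pointwise wp cutoff_range)
      also have "\<dots> \<le> ?U1 p - ?Q1 p"
      proof -
        have "1/8 * (indicat_real (?B4 \<times> ?B4) p * (ln (w x) - ln (w y))\<^sup>2) \<le> 1/8 * ((min (?c x) (?c y))\<^sup>2 * (ln (w x) - ln (w y))\<^sup>2)"
          using c1[of x] c1[of y] p by (intro mult_left_mono mult_right_mono) (auto split: split_indicator)
        then show ?thesis using 1 p by (simp add: mult_ac)
      qed
      also have "?Q1 p = ?Q p" using 1 p by simp
      finally show ?thesis using U0[of p] by linarith
    next
      case 2
      then have "y \<notin> ?B5" "y \<notin> ?B4" "x \<in> ?D" using sub by blast+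
      then have "\<phi> y = 0" by (intro \<phi>out)
      then have "?P p \<le> 1 + max (- w y) 0 / \<tau> - max (w y) 0 / w x * indicat_real ?B4 x"
        using cross[OF 2(1), of y] p by simp
      also have "\<dots> = ?U2 p + ?U4 p - ?Q p"
        using 2 p farp[OF 2] \<open>y \<notin> ?B4\<close> pos[OF \<open>x \<in> ?D\<close>] by (simp add: max_absorb1 indicator_times)
      finally show ?thesis using U0[of p] by linarith
    next
      case 3
      then have "x \<notin> ?B5" "x \<notin> ?B4" using sub by blast+
      then have "\<phi> x = 0" by (intro \<phi>out)
      then have "?P p = (w y - w x) * \<phi> y" using p by (simp add: algebra_simps)
      also have "\<dots> \<le> 1 + max (- w x) 0 / \<tau> - max (w x) 0 / w y * indicat_real ?B4 y" by (rule cross[OF 3(2)])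
      also have "\<dots> \<le> 1 + max (- w x) 0 / \<tau>"
        using pos[of y] 3 sub \<tau> by (auto split: split_indicator intro!: divide_nonneg_nonneg)
      also have "\<dots> = ?U3 p + ?U5 p - ?Q p"
        using 3 p farp[OF 3(2,1)] \<open>x \<notin> ?B4\<close> by (simp add: indicator_times dist_commute)
      finally show ?thesis using U0[of p] by linarith
    next
      case 4
      then have "x \<notin> ?B4" using sub by blast
      then have "?P p = 0" "?Q p = 0" using 4 p \<phi>out by (simp_all add: indicator_times)
      then show ?thesis using U0[of p] by linarith
    qed
  qed
  define V where "V = unit_ball_vol DIM('a) * 6 ^ DIM('a) * \<rho> ^ DIM('a)"
  have V0: "0 \<le> V" unfolding V_def using \<rho> by simp
  have eD: "emeasure lborel ?D = ennreal V" unfolding V_def using \<rho>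
    by (simp add: emeasure_ball_eq power_mult_distrib mult.assoc)
  have e5: "emeasure lborel ?B5 \<le> ennreal V"
    unfolding eD[symmetric] by (intro emeasure_mono sub) simp
  have i5: "(\<integral>\<^sup>+x. ennreal (indicat_real ?B5 x) \<partial>lborel) \<le> ennreal V"
    using e5 by (simp add: ennreal_indicator)
  have "(\<integral>\<^sup>+p. ennreal (?Q p) \<partial>J) \<le> (\<integral>\<^sup>+p. ennreal (?U p) \<partial>J)"
  proof (rule nn_integral_le_of_integral_zero[OF P])
    show "0 \<le> ?U p" for p using U0[of p] by linarith
    show "0 \<le> ?Q p" for p using Q0[of p] by linarith
  qed (use pw in auto)
  also have "\<dots> = (\<integral>\<^sup>+p. ennreal (?U1 p) + ennreal (?U2 p) + ennreal (?U3 p) + ennreal (?U4 p) + ennreal (?U5 p) \<partial>J)"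
    using U0 by (simp only: ennreal_plus add_nonneg_nonneg)
  also have "\<dots> = (\<integral>\<^sup>+p. ennreal (?U1 p) \<partial>J) + (\<integral>\<^sup>+p. ennreal (?U2 p) \<partial>J) + (\<integral>\<^sup>+p. ennreal (?U3 p) \<partial>J) + (\<integral>\<^sup>+p. ennreal (?U4 p) \<partial>J) + (\<integral>\<^sup>+p. ennreal (?U5 p) \<partial>J)"
    by (simp add: nn_integral_add)
  also have "(\<integral>\<^sup>+p. ennreal (?U3 p) \<partial>J) = (\<integral>\<^sup>+p. ennreal (?U2 p) \<partial>J)"
    by (rule nn_integral_swap) (auto intro!: arg_cong[where f = ennreal] split: split_indicator simp: dist_commute)
  also have "(\<integral>\<^sup>+p. ennreal (?U5 p) \<partial>J) = (\<integral>\<^sup>+p. ennreal (?U4 p) \<partial>J)"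
    by (rule nn_integral_swap) (auto intro!: arg_cong[where f = ennreal] split: split_indicator)
  also have "(\<integral>\<^sup>+p. ennreal (?U1 p) \<partial>J) \<le> ennreal (2 * (Cq * \<rho> powr (-\<alpha>) * V))"
  proof -
    have "(\<integral>\<^sup>+p. ennreal (?U1 p) \<partial>J) = 2 * (\<integral>\<^sup>+p. ennreal (indicat_real ?D (fst p) * (?c (fst p) - ?c (snd p))\<^sup>2) \<partial>J)"
      by (subst nn_integral_cmult[symmetric]) (measurable, auto simp: ennreal_mult intro!: nn_integral_cong)
    also have "\<dots> \<le> 2 * (ennreal (Cq * (5 * \<rho> - 4 * \<rho>) powr (-\<alpha>)) * (\<integral>\<^sup>+x. ennreal (indicat_real ?D x) \<partial>lborel))"
      by (intro mult_left_mono decay_cutoff_real[where f = "indicat_real ?D"] ab) simp_all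
    also have "\<dots> = 2 * (ennreal (Cq * \<rho> powr (-\<alpha>)) * ennreal V)"
      by (simp add: ennreal_indicator eD)
    also have "\<dots> = ennreal (2 * (Cq * \<rho> powr (-\<alpha>) * V))"
      using Cq_pos V0 by (simp add: ennreal_mult)
    finally show ?thesis .
  qed
  also have "(\<integral>\<^sup>+p. ennreal (?U2 p) \<partial>J) \<le> ennreal (C * \<rho> powr (-\<alpha>) * V)"
  proof -
    have "(\<integral>\<^sup>+p. ennreal (?U2 p) \<partial>J) \<le> ennreal (C * \<rho> powr (-\<alpha>)) * (\<integral>\<^sup>+x. ennreal (indicat_real ?B5 x) \<partial>lborel)"
      by (rule decay_fst) (use \<rho> in auto)
    also have "\<dots> \<le> ennreal (C * \<rho> powr (-\<alpha>)) * ennreal V" by (intro mult_left_mono i5) simp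
    also have "\<dots> = ennreal (C * \<rho> powr (-\<alpha>) * V)" using C V0 by (simp add: ennreal_mult)
    finally show ?thesis .
  qed
  also have "(\<integral>\<^sup>+p. ennreal (?U4 p) \<partial>J) \<le> ennreal (9 * \<rho> powr (-\<alpha>) * V)"
  proof -
    have "(\<integral>\<^sup>+p. ennreal (?U4 p) \<partial>J) = (\<integral>\<^sup>+p. ennreal (indicat_real ?B5 (fst p) * max (- w (snd p)) 0 * indicat_real (?B5 \<times> UNIV) p) * ennreal (1/\<tau>) \<partial>J)"
      by (intro nn_integral_cong ennreal_mult'') (use \<tau> in simp)
    also have "\<dots> = (\<integral>\<^sup>+p. ennreal (indicat_real ?B5 (fst p) * max (- w (snd p)) 0 * indicat_real (?B5 \<times> UNIV) p) \<partial>J) * ennreal (1/\<tau>)"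
      by (rule nn_integral_multc) measurable
    also have "\<dots> \<le> (ennreal (9 * \<tau> * \<rho> powr (-\<alpha>)) * (\<integral>\<^sup>+x. ennreal (indicat_real ?B5 x) \<partial>lborel)) * ennreal (1/\<tau>)"
      by (intro mult_right_mono tail_leD[OF tail, where f = "indicat_real ?B5"]) simp_all
    also have "\<dots> \<le> (ennreal (9 * \<tau> * \<rho> powr (-\<alpha>)) * ennreal V) * ennreal (1/\<tau>)"
      by (intro mult_right_mono mult_left_mono i5) simp_all
    also have "\<dots> = ennreal (9 * \<rho> powr (-\<alpha>) * V)"
      using \<tau> V0 by (simp add: ennreal_mult[symmetric])
    finally show ?thesis .
  qed
  finally have "(\<integral>\<^sup>+p. ennreal (?Q p) \<partial>J) \<le> ennreal (2 * (Cq * \<rho> powr (-\<alpha>) * V)) + ennreal (C * \<rho> powr (-\<alpha>) * V)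
     + ennreal (C * \<rho> powr (-\<alpha>) * V) + ennreal (9 * \<rho> powr (-\<alpha>) * V) + ennreal (9 * \<rho> powr (-\<alpha>) * V)"
    by (simp add: add_mono)
  also have "\<dots> = ennreal (2 * (Cq * \<rho> powr (-\<alpha>) * V) + C * \<rho> powr (-\<alpha>) * V + C * \<rho> powr (-\<alpha>) * V + 9 * \<rho> powr (-\<alpha>) * V + 9 * \<rho> powr (-\<alpha>) * V)"
    using Cq_pos C V0 by (simp only: ennreal_plus add_nonneg_nonneg mult_nonneg_nonneg powr_ge_zero less_imp_le zero_le_numeral order_trans[OF zero_le_one])
  also have "2 * (Cq * \<rho> powr (-\<alpha>) * V) + C * \<rho> powr (-\<alpha>) * V + C * \<rho> powr (-\<alpha>) * V + 9 * \<rho> powr (-\<alpha>) * V + 9 * \<rho> powr (-\<alpha>) * V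
     = log_const \<alpha> C DIM('a) * \<rho> powr (-\<alpha>) * \<rho> ^ DIM('a)"
    unfolding log_const_def V_def by (simp add: algebra_simps)
  finally have main: "(\<integral>\<^sup>+p. ennreal (?Q p) \<partial>J) \<le> ennreal (log_const \<alpha> C DIM('a) * \<rho> powr (-\<alpha>) * \<rho> ^ DIM('a))" (is "_ \<le> ennreal ?K") .
  have K0: "0 \<le> ?K" using Cq_pos C \<rho> by (simp add: log_const_def)
  have "(\<integral>\<^sup>+p. ennreal ((ln (w (fst p)) - ln (w (snd p)))\<^sup>2) * indicator (?B4 \<times> ?B4) p \<partial>J)
     \<le> (\<integral>\<^sup>+p. ennreal 8 * ennreal (?Q p) \<partial>J)"
  proof (rule nn_integral_mono)
    fix p
    have "(ln (w (fst p)) - ln (w (snd p)))\<^sup>2 * indicat_real (?B4 \<times> ?B4) p \<le> 8 * ?Q p" using Q0(2)[of p] by simp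
    then show "ennreal ((ln (w (fst p)) - ln (w (snd p)))\<^sup>2) * indicator (?B4 \<times> ?B4) p \<le> ennreal 8 * ennreal (?Q p)"
      by (simp only: ennreal_mult_indicat_real[symmetric] ennreal_mult'[symmetric] zero_le_numeral) (rule ennreal_leI)
  qed
  also have "\<dots> = ennreal 8 * (\<integral>\<^sup>+p. ennreal (?Q p) \<partial>J)" by (rule nn_integral_cmult) measurable
  also have "\<dots> \<le> ennreal 8 * ennreal ?K" by (intro mult_left_mono main) simp
  also have "\<dots> = ennreal (8 * ?K)" by (rule ennreal_mult[symmetric]) (use K0 in auto)
  finally show "(\<integral>\<^sup>+p. ennreal ((ln (w (fst p)) - ln (w (snd p)))\<^sup>2) * indicator (?B4 \<times> ?B4) p \<partial>J) \<le> ennreal (8 * ?K)" .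
  have "(\<integral>\<^sup>+p. ennreal (max (w (snd p)) 0 / w (fst p)) * indicator (?B4 \<times> - ?D) p \<partial>J) \<le> (\<integral>\<^sup>+p. ennreal (?Q p) \<partial>J)"
  proof (rule nn_integral_mono)
    fix p
    have "max (w (snd p)) 0 / w (fst p) * indicat_real (?B4 \<times> - ?D) p \<le> ?Q p"
    proof (cases "p \<in> ?B4 \<times> - ?D")
      case True
      then have "fst p \<in> ?D" using sub by auto
      then have "max (w (fst p)) \<tau> = w (fst p)" using pos by (simp add: max_absorb1)
      then show ?thesis using Q0(1)[of p] by simp
    qed (use Q0[of p] in simp)
    then show "ennreal (max (w (snd p)) 0 / w (fst p)) * indicator (?B4 \<times> - ?D) p \<le> ennreal (?Q p)"
      unfolding ennreal_mult_indicat_real[symmetric] by (rule ennreal_leI)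
  qed
  then show "(\<integral>\<^sup>+p. ennreal (max (w (snd p)) 0 / w (fst p)) * indicator (?B4 \<times> - ?D) p \<partial>J) \<le> ennreal ?K"
    using main by (rule order_trans)
qed

end

section \<open>Expansion of positivity\<close>

lemma tail_leI_add:
  assumes g: "\<And>y. y \<in> B \<Longrightarrow> g y \<le> g1 y + g2 y" and nn: "\<And>y. 0 \<le> g1 y" "\<And>y. 0 \<le> g2 y"
    and sets: "sets J = sets (borel \<Otimes>\<^sub>M borel)" and AB: "A \<in> sets borel" "B \<in> sets borel"
    and meas: "g1 \<in> borel_measurable borel" "g2 \<in> borel_measurable borel"
    and t: "tail_le J g1 A B T1" "tail_le J g2 A B T2" and T: "0 \<le> T1" "0 \<le> T2"
  shows "tail_le J g A B (T1 + T2)"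
  unfolding tail_le_def
proof (intro allI impI)
  fix f :: "'a \<Rightarrow> ennreal" assume f[measurable]: "f \<in> borel_measurable borel"
  note [measurable_cong] = sets
  note [measurable] = AB meas
  have "(\<integral>\<^sup>+p. f (fst p) * ennreal (g (snd p)) * indicator (A \<times> B) p \<partial>J)
      \<le> (\<integral>\<^sup>+p. f (fst p) * ennreal (g1 (snd p)) * indicator (A \<times> B) p + f (fst p) * ennreal (g2 (snd p)) * indicator (A \<times> B) p \<partial>J)"
  proof (rule nn_integral_mono)
    fix p :: "'a \<times> 'a"
    show "f (fst p) * ennreal (g (snd p)) * indicator (A \<times> B) p
      \<le> f (fst p) * ennreal (g1 (snd p)) * indicator (A \<times> B) p + f (fst p) * ennreal (g2 (snd p)) * indicator (A \<times> B) p"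
    proof (cases "p \<in> A \<times> B")
      case True
      then have "ennreal (g (snd p)) \<le> ennreal (g1 (snd p)) + ennreal (g2 (snd p))"
        using g[of "snd p"] nn by (auto simp: ennreal_plus[symmetric] simp del: ennreal_plus intro!: ennreal_leI)
      then have "f (fst p) * ennreal (g (snd p)) \<le> f (fst p) * (ennreal (g1 (snd p)) + ennreal (g2 (snd p)))"
        by (rule mult_left_mono) simp
      then show ?thesis using True by (simp add: distrib_left)
    qed simp
  qed
  also have "\<dots> = (\<integral>\<^sup>+p. f (fst p) * ennreal (g1 (snd p)) * indicator (A \<times> B) p \<partial>J) + (\<integral>\<^sup>+p. f (fst p) * ennreal (g2 (snd p)) * indicator (A \<times> B) p \<partial>J)"
    by (rule nn_integral_add) measurable
  also have "\<dots> \<le> ennreal T1 * (\<integral>\<^sup>+x. f x \<partial>lborel) + ennreal T2 * (\<integral>\<^sup>+x. f x \<partial>lborel)"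
    using t f unfolding tail_le_def by (intro add_mono) auto
  also have "\<dots> = ennreal (T1 + T2) * (\<integral>\<^sup>+x. f x \<partial>lborel)"
    using T by (simp add: distrib_right)
  finally show "(\<integral>\<^sup>+p. f (fst p) * ennreal (g (snd p)) * indicator (A \<times> B) p \<partial>J) \<le> ennreal (T1 + T2) * (\<integral>\<^sup>+x. f x \<partial>lborel)" .
qed

lemma (in jump_form) tail_le_const:
  assumes a: "0 \<le> a" and s: "0 < s" and far: "\<And>x y. x \<in> A \<Longrightarrow> y \<in> B \<Longrightarrow> s \<le> dist x y"
  shows "tail_le J (\<lambda>_. a) A B (a * C * s powr (-\<alpha>))"
  unfolding tail_le_def
proof (intro allI impI)
  fix f :: "'a \<Rightarrow> ennreal" assume f[measurable]: "f \<in> borel_measurable borel"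
  have "(\<integral>\<^sup>+p. f (fst p) * ennreal a * indicator (A \<times> B) p \<partial>J)
     \<le> (\<integral>\<^sup>+p. ennreal a * (f (fst p) * indicator {p. s \<le> dist (fst p) (snd p)} p) \<partial>J)"
    using far by (intro nn_integral_mono) (auto split: split_indicator simp: mult.commute)
  also have "\<dots> = ennreal a * (\<integral>\<^sup>+p. f (fst p) * indicator {p. s \<le> dist (fst p) (snd p)} p \<partial>J)"
    by (rule nn_integral_cmult) measurable
  also have "\<dots> \<le> ennreal a * (ennreal (C * s powr (-\<alpha>)) * (\<integral>\<^sup>+x. f x \<partial>lborel))"
    by (intro mult_left_mono decay f s) simp
  also have "\<dots> = ennreal (a * C * s powr (-\<alpha>)) * (\<integral>\<^sup>+x. f x \<partial>lborel)"
    using a C by (simp add: mult.assoc[symmetric] ennreal_mult[symmetric])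
  finally show "(\<integral>\<^sup>+p. f (fst p) * ennreal a * indicator (A \<times> B) p \<partial>J) \<le> ennreal (a * C * s powr (-\<alpha>)) * (\<integral>\<^sup>+x. f x \<partial>lborel)" .
qed

text \<open>Changing the scale by a factor c >= 1 costs c^\<alpha>, which is replaced by c^2; the
  numerical constants below are then free of \<alpha>.\<close>

lemma powr_scale_le:
  fixes \<rho> \<alpha> :: real
  assumes "0 < \<rho>" "0 < \<alpha>" "\<alpha> < 2" "1 \<le> c"
  shows "\<rho> powr (-\<alpha>) \<le> c\<^sup>2 * (c * \<rho>) powr (-\<alpha>)"
proof -
  have "\<rho> powr (-\<alpha>) = c powr \<alpha> * (c * \<rho>) powr (-\<alpha>)"
    using assms by (simp add: powr_mult powr_minus)
  also have "c powr \<alpha> \<le> c powr 2" using assms by (intro powr_mono) auto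
  also have "c powr 2 = c\<^sup>2" using assms by simp
  finally show ?thesis using assms by (simp add: mult_right_mono)
qed

lemma ln_max_Lipschitz:
  fixes s t \<tau> :: real
  assumes \<tau>: "0 < \<tau>"
  shows "\<bar>ln (max s \<tau>) - ln (max t \<tau>)\<bar> \<le> 1/\<tau> * \<bar>s - t\<bar>"
proof -
  have *: "\<bar>ln a - ln b\<bar> \<le> 1/\<tau> * (b - a)" if "\<tau> \<le> a" "a \<le> b" for a b
  proof -
    have "\<bar>ln a - ln b\<bar> = ln b - ln a" using that \<tau> by simp
    also have "\<dots> = ln (b / a)" using that \<tau> by (simp add: ln_div)
    also have "\<dots> \<le> b / a - 1" using that \<tau> by (intro ln_le_minus_one) auto
    also have "\<dots> = (b - a) / a" using that \<tau> by (simp add: diff_divide_distrib)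
    also have "\<dots> \<le> (b - a) / \<tau>" using that \<tau> by (intro divide_left_mono) auto
    finally show ?thesis by simp
  qed
  have **: "1/\<tau> * (max b \<tau> - max a \<tau>) \<le> 1/\<tau> * \<bar>a - b\<bar>" for a b
    using \<tau> by (intro mult_left_mono) auto
  show ?thesis
  proof (cases "max s \<tau> \<le> max t \<tau>")
    case True
    show ?thesis by (rule order_trans[OF * **]) (use True in auto)
  next
    case False
    have "\<bar>ln (max t \<tau>) - ln (max s \<tau>)\<bar> \<le> 1/\<tau> * \<bar>t - s\<bar>"
      by (rule order_trans[OF * **]) (use False in auto)
    then show ?thesis by (simp only: abs_minus_commute)
  qed
qed

text \<open>The factor 9 is 3^2: in the application the tail is controlled at scale r, while
  \<open>\<rho>\<close> may be as large as 3 r.\<close>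

definition expansion_bound ::
  "('a::euclidean_space \<times> 'a) measure \<Rightarrow> 'a set \<Rightarrow> real \<Rightarrow> real \<Rightarrow> real \<Rightarrow> bool" where
  "expansion_bound J E \<alpha> \<mu> c \<longleftrightarrow> (\<forall>w x\<^sub>1 \<rho> \<tau> k.
     weak_sol J E w \<longrightarrow> 0 < \<rho> \<longrightarrow> ball x\<^sub>1 (7 * \<rho>) \<subseteq> E \<longrightarrow> 0 < \<tau> \<longrightarrow>
     (\<forall>x\<in>ball x\<^sub>1 (6 * \<rho>). \<tau> \<le> w x) \<longrightarrow>
     tail_le J (\<lambda>y. max (- w y) 0) (ball x\<^sub>1 (5 * \<rho>)) UNIV (9 * \<tau> * \<rho> powr (-\<alpha>)) \<longrightarrow> 0 < k \<longrightarrow>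
     ennreal (\<mu> * unit_ball_vol DIM('a) * \<rho> ^ DIM('a)) \<le> emeasure lborel {x\<in>ball x\<^sub>1 \<rho>. k \<le> w x} \<longrightarrow>
     (AE x in lborel. x \<in> ball x\<^sub>1 (2 * \<rho>) \<longrightarrow> c * k \<le> w x))"

text \<open>The positive part of ln k - ln w vanishes on the set where \<open>w\<close> is large, so
  Poincare and the logarithmic estimate bound its square integral. By Chebyshev, \<open>w\<close>
  lies below \<open>k * exp (- t)\<close> only on a small portion once \<open>t\<close> is large,
  and De Giorgi's lemma for \<open>- w\<close> turns this into a pointwise bound.\<close>

lemma expansion_of_positivity:
  fixes \<alpha> C \<mu> :: real
  assumes \<alpha>: "0 < \<alpha>" "\<alpha> < 2" and C: "1 \<le> C" and \<mu>: "0 < \<mu>" "\<mu> \<le> 1"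
  obtains c where "0 < c" "c \<le> 1"
    and "\<forall>(J :: ('a::euclidean_space \<times> 'a) measure) E. jump_form J \<alpha> C E \<longrightarrow> expansion_bound J E \<alpha> \<mu> c"
proof -
  let ?N = "DIM('a)"
  let ?\<omega> = "unit_ball_vol (real ?N)"
  have \<omega>: "0 < ?\<omega>" by simp
  have dc: "0 < decay_const \<alpha> C" using \<alpha> C by (rule decay_const_pos)
  \<comment> \<open>First summand: the mean of a function bounded by \<open>k'\<close> over the ball
    of radius \<open>6 * \<rho>\<close>, relative to height \<open>k' / 2\<close> and radius
    \<open>4 * \<rho>\<close>. Second: the tail, where 32 is 2 times the scale factor 4^2, the 2
    again coming from \<open>k' / 2\<close>.\<close>
  define \<Lambda> where "\<Lambda> = 2 * ?\<omega> * (3/2) ^ ?N + 32 * (C + 9)"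
  have \<Lambda>: "0 \<le> \<Lambda>" unfolding \<Lambda>_def using C \<omega> by simp
  obtain \<nu> where \<nu>: "0 < \<nu>" and DG: "\<forall>(J :: ('a \<times> 'a) measure) E. jump_form J \<alpha> C E \<longrightarrow> de_giorgi_bound J E \<alpha> \<Lambda> \<nu>"
    by (rule de_giorgi[where 'a = 'a, OF \<alpha> C \<Lambda>]) (rule that)
  define L where "L = log_const \<alpha> C ?N"
  have L: "0 < L" unfolding L_def log_const_def using dc C \<omega> by (simp add: add_pos_pos)
  define m where "m = \<mu> / 4 ^ ?N"
  have m: "0 < m" "m \<le> 1"
  proof -
    show "0 < m" unfolding m_def using \<mu> by simp
    have "(1::real) \<le> 4 ^ ?N" by simp
    then have "\<mu> \<le> 4 ^ ?N" using \<mu>(2) by linarith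
    then show "m \<le> 1" unfolding m_def by simp
  qed
  \<comment> \<open>Product of the constant \<open>4 / m * C\<close> of
    \<open>poincare_vanishing\<close>, the bound 16 for 4^\<alpha> and the constant
    \<open>8 * L\<close> of the logarithmic estimate. \<open>m\<close> is the density \<mu> seen
    from the ball of radius \<open>4 * \<rho>\<close>.\<close>
  define K where "K = 4 / m * C * 16 * (8 * L)"
  have K: "0 < K" unfolding K_def using m C L by simp
  \<comment> \<open>Chosen so that the Chebyshev bound \<open>K / t\<^sup>2\<close> meets the
    smallness requirement of De Giorgi's lemma at radius \<open>4 * \<rho>\<close> with
    \<open>h = k' / 2\<close>; the latter explains the division by 4.\<close>
  define t where "t = sqrt (4 * K / (\<nu> * 4 ^ ?N))"
  have t: "0 < t" "K / t\<^sup>2 = \<nu> * 4 ^ ?N / 4"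
  proof -
    show "0 < t" unfolding t_def using K \<nu> by simp
    show "K / t\<^sup>2 = \<nu> * 4 ^ ?N / 4" unfolding t_def using K \<nu> by simp
  qed
  \<comment> \<open>\<open>exp (- t)\<close> is lost in passing to the level \<open>k'\<close>, and
    one half in De Giorgi's lemma between \<open>k'\<close> and \<open>k' / 2\<close>.\<close>
  define c where "c = exp (- t) / 2"
  have e1: "exp (-t) \<le> 1" using t by simp
  have c: "0 < c" unfolding c_def by simp
  have c1: "c \<le> 1" unfolding c_def using e1 by linarith
  show thesis
  proof (rule that[OF c c1], unfold expansion_bound_def, intro allI impI)
    fix J :: "('a \<times> 'a) measure" and E w x\<^sub>1 and \<rho> \<tau> k :: real
    assume J: "jump_form J \<alpha> C E" and w: "weak_sol J E w" and \<rho>: "0 < \<rho>" and E: "ball x\<^sub>1 (7 * \<rho>) \<subseteq> E"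
      and \<tau>: "0 < \<tau>" and pos': "\<forall>x\<in>ball x\<^sub>1 (6 * \<rho>). \<tau> \<le> w x"
      and tail: "tail_le J (\<lambda>y. max (- w y) 0) (ball x\<^sub>1 (5 * \<rho>)) UNIV (9 * \<tau> * \<rho> powr (-\<alpha>))" and k: "0 < k"
      and Z: "ennreal (\<mu> * ?\<omega> * \<rho> ^ ?N) \<le> emeasure lborel {x\<in>ball x\<^sub>1 \<rho>. k \<le> w x}"
    interpret jump_form J \<alpha> C E by (rule J)
    have pos: "\<tau> \<le> w x" if "x \<in> ball x\<^sub>1 (6 * \<rho>)" for x using pos' that by blast
    have wl: "loc_space J E w" using w by (simp add: weak_sol_def)
    have [measurable]: "w \<in> borel_measurable borel" using wl by (simp add: loc_space_def)
    let ?B4 = "ball x\<^sub>1 (4 * \<rho>)" and ?B6 = "ball x\<^sub>1 (6 * \<rho>)"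
    have B46: "?B4 \<subseteq> ?B6" using \<rho> by auto
    define k' where "k' = k * exp (- t)"
    have k': "0 < k'" "c * k = k' / 2" unfolding k'_def c_def using k by auto
    show "AE x in lborel. x \<in> ball x\<^sub>1 (2 * \<rho>) \<longrightarrow> c * k \<le> w x"
    \<comment> \<open>If \<open>k' \<le> \<tau>\<close> the pointwise bound by \<open>\<tau>\<close>
      is already enough; otherwise \<open>\<tau> < k'\<close> allows the tail of the negative part,
      of size \<open>9 * \<tau>\<close>, to be absorbed into a multiple of
      \<open>k'\<close>.\<close>
    proof (cases "k' \<le> \<tau>")
      case True
      show ?thesis
      proof (intro AE_I2 impI)
        fix x assume "x \<in> ball x\<^sub>1 (2 * \<rho>)"
        then have "\<tau> \<le> w x" using \<rho> by (intro pos) auto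
        then show "c * k \<le> w x" using True k' by linarith
      qed
    next
      case False
      define G where "G = (\<lambda>s. max 0 (ln k - ln (max s \<tau>)))"
      define v where "v = (\<lambda>x. G (w x))"
      have GL: "\<bar>G s - G s'\<bar> \<le> 1/\<tau> * \<bar>s - s'\<bar>" for s s'
      proof -
        have "\<bar>G s - G s'\<bar> \<le> \<bar>ln (max s \<tau>) - ln (max s' \<tau>)\<bar>" unfolding G_def by linarith
        then show ?thesis using ln_max_Lipschitz[OF \<tau>, of s s'] by linarith
      qed
      have v: "loc_space J E v" unfolding v_def by (rule loc_space_Lipschitz[OF J wl GL])
      have [measurable]: "v \<in> borel_measurable borel" using v by (simp add: loc_space_def)
      have B4E: "?B4 \<subseteq> E" by (rule subset_trans[OF subset_ball E]) (use \<rho> in auto)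
      have Zsub: "{x\<in>ball x\<^sub>1 \<rho>. k \<le> w x} \<subseteq> ?B4" using \<rho> by auto
      have "(\<integral>\<^sup>+x\<in>?B4. ennreal ((v x)\<^sup>2) \<partial>lborel) \<le> ennreal (4 / m * C * (4 * \<rho>) powr \<alpha>) * form_on J ?B4 v"
      proof (rule poincare_vanishing[OF v _ B4E _ Zsub _ m])
        show "v x = 0" if "x \<in> {x\<in>ball x\<^sub>1 \<rho>. k \<le> w x}" for x
        proof -
          have "ln k \<le> ln (max (w x) \<tau>)" using that k by auto
          then show ?thesis unfolding v_def G_def by simp
        qed
        have "ennreal m * emeasure lborel ?B4 = ennreal (\<mu> * ?\<omega> * \<rho> ^ ?N)"
          unfolding m_def using \<rho> \<mu> by (simp add: emeasure_ball_eq ennreal_mult[symmetric] power_mult_distrib)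
        then show "ennreal m * emeasure lborel ?B4 \<le> emeasure lborel {x\<in>ball x\<^sub>1 \<rho>. k \<le> w x}" using Z by simp
      qed (use \<rho> in auto)
      also have "form_on J ?B4 v \<le> ennreal (8 * (L * \<rho> powr (-\<alpha>) * \<rho> ^ ?N))"
      proof (rule order_trans[OF _ log_estimate(1)[OF w \<rho> E \<tau> pos tail, folded L_def]], unfold form_on_def, rule nn_integral_mono)
        fix p :: "'a \<times> 'a"
        show "ennreal ((v (fst p) - v (snd p))\<^sup>2) * indicator (?B4 \<times> ?B4) p \<le> ennreal ((ln (w (fst p)) - ln (w (snd p)))\<^sup>2) * indicator (?B4 \<times> ?B4) p"
        proof (cases "p \<in> ?B4 \<times> ?B4")
          case True
          then have "fst p \<in> ?B6" "snd p \<in> ?B6" using B46 by auto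
          then have "max (w (fst p)) \<tau> = w (fst p)" "max (w (snd p)) \<tau> = w (snd p)" using pos by (auto simp: max_absorb1)
          then have "\<bar>v (fst p) - v (snd p)\<bar> \<le> \<bar>ln (w (fst p)) - ln (w (snd p))\<bar>" unfolding v_def G_def by auto
          then have "(v (fst p) - v (snd p))\<^sup>2 \<le> (ln (w (fst p)) - ln (w (snd p)))\<^sup>2" by (simp add: abs_le_square_iff)
          then show ?thesis by (intro mult_right_mono ennreal_leI) auto
        qed simp
      qed simp
      also have "ennreal (4 / m * C * (4 * \<rho>) powr \<alpha>) * ennreal (8 * (L * \<rho> powr (-\<alpha>) * \<rho> ^ ?N)) \<le> ennreal (K * \<rho> ^ ?N)"
      proof -
        have "(4 * \<rho>) powr \<alpha> * \<rho> powr (-\<alpha>) = 4 powr \<alpha>" using \<rho> by (simp add: powr_mult powr_minus)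
        also have "4 powr \<alpha> \<le> 4 powr (2::real)" using \<alpha> by (intro powr_mono) auto
        finally have *: "(4 * \<rho>) powr \<alpha> * \<rho> powr (-\<alpha>) \<le> 16" by simp
        have "4 / m * C * (4 * \<rho>) powr \<alpha> * (8 * (L * \<rho> powr (-\<alpha>) * \<rho> ^ ?N)) = (4 / m * C * (8 * L) * \<rho> ^ ?N) * ((4 * \<rho>) powr \<alpha> * \<rho> powr (-\<alpha>))" by simp
        also have "\<dots> \<le> (4 / m * C * (8 * L) * \<rho> ^ ?N) * 16" by (rule mult_left_mono[OF *]) (use m C L \<rho> in simp)
        also have "\<dots> = K * \<rho> ^ ?N" unfolding K_def by simp
        finally show ?thesis using m C L \<rho> by (subst ennreal_mult[symmetric]) (auto intro: ennreal_leI)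
      qed
      finally have v2: "(\<integral>\<^sup>+x\<in>?B4. ennreal ((v x)\<^sup>2) \<partial>lborel) \<le> ennreal (K * \<rho> ^ ?N)"
        by (simp add: mult_left_mono)
      let ?A = "{x\<in>?B4. w x < k'}"
      have A: "emeasure lborel ?A \<le> ennreal (\<nu> * 4 ^ ?N / 4 * \<rho> ^ ?N)"
      proof -
        have "emeasure lborel ?A = (\<integral>\<^sup>+x. indicator ?A x \<partial>lborel)" by (rule nn_integral_indicator[symmetric]) measurable
        also have "\<dots> \<le> (\<integral>\<^sup>+x. ennreal (1/t\<^sup>2) * (ennreal ((v x)\<^sup>2) * indicator ?B4 x) \<partial>lborel)"
        proof (rule nn_integral_mono)
          fix x
          show "indicator ?A x \<le> ennreal (1/t\<^sup>2) * (ennreal ((v x)\<^sup>2) * indicator ?B4 x)"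
          proof (cases "x \<in> ?A")
            case True
            then have "x \<in> ?B6" using B46 by auto
            then have wx: "\<tau> \<le> w x" "max (w x) \<tau> = w x" using pos by (auto simp: max_absorb1)
            have "ln (w x) < ln k'" using True wx \<tau> by simp
            also have "ln k' = ln k - t" unfolding k'_def using k by (simp add: ln_mult)
            finally have "t \<le> v x" unfolding v_def G_def wx(2) by simp
            then have "t\<^sup>2 \<le> (v x)\<^sup>2" using t by (intro power_mono) auto
            then have "1 \<le> 1/t\<^sup>2 * (v x)\<^sup>2" using t by (simp add: field_simps)
            then have "ennreal 1 \<le> ennreal (1/t\<^sup>2) * ennreal ((v x)\<^sup>2)"
              by (subst ennreal_mult[symmetric]) (auto intro: ennreal_leI)
            then show ?thesis using True by simp
          qed simp
        qed
        also have "\<dots> = ennreal (1/t\<^sup>2) * (\<integral>\<^sup>+x\<in>?B4. ennreal ((v x)\<^sup>2) \<partial>lborel)" by (rule nn_integral_cmult) measurable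
        also have "\<dots> \<le> ennreal (1/t\<^sup>2) * ennreal (K * \<rho> ^ ?N)" by (intro mult_left_mono v2) simp
        also have "\<dots> = ennreal (K / t\<^sup>2 * \<rho> ^ ?N)" using K \<rho> by (simp add: ennreal_mult[symmetric])
        finally show ?thesis unfolding t(2) .
      qed
      have lev: "max (- w x - - k') 0 \<le> k' * indicator {..<k'} (w x)" if "x \<in> ?B6" for x
        using pos[OF that] \<tau> by (auto split: split_indicator)
      have "AE x in lborel. x \<in> ball x\<^sub>1 ((4 * \<rho>) / 2) \<longrightarrow> - w x \<le> - k' + k' / 2"
      proof (rule DG[rule_format, OF J, unfolded de_giorgi_bound_def, rule_format, OF weak_sol_uminus[OF J w]])
        show "ball x\<^sub>1 (3/2 * (4 * \<rho>)) \<subseteq> E" by (rule subset_trans[OF subset_ball E]) (use \<rho> in auto)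
        show "(\<integral>\<^sup>+x\<in>?B4. ennreal ((max (- w x - - k') 0)\<^sup>2) \<partial>lborel) \<le> ennreal (\<nu> * (k' / 2)\<^sup>2 * (4 * \<rho>) ^ ?N)"
        proof -
          have "(\<integral>\<^sup>+x\<in>?B4. ennreal ((max (- w x - - k') 0)\<^sup>2) \<partial>lborel) \<le> (\<integral>\<^sup>+x. ennreal (k'\<^sup>2) * indicator ?A x \<partial>lborel)"
          proof (rule nn_integral_mono)
            fix x
            show "ennreal ((max (- w x - - k') 0)\<^sup>2) * indicator ?B4 x \<le> ennreal (k'\<^sup>2) * indicator ?A x"
            proof (cases "x \<in> ?B4")
              case True
              then have "max (- w x - - k') 0 \<le> k' * indicator {..<k'} (w x)" using lev B46 by blast
              then have "(max (- w x - - k') 0)\<^sup>2 \<le> (k' * indicator {..<k'} (w x))\<^sup>2" by (intro power_mono) auto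
              then have "(max (- w x - - k') 0)\<^sup>2 \<le> k'\<^sup>2 * indicator {..<k'} (w x)"
                by (auto split: split_indicator_asm)
              then show ?thesis using True by (auto split: split_indicator_asm split_indicator intro: ennreal_leI)
            qed simp
          qed
          also have "\<dots> = ennreal (k'\<^sup>2) * emeasure lborel ?A" by (rule nn_integral_cmult_indicator) measurable
          also have "\<dots> \<le> ennreal (k'\<^sup>2) * ennreal (\<nu> * 4 ^ ?N / 4 * \<rho> ^ ?N)" by (intro mult_left_mono A) simp
          also have "\<dots> = ennreal (\<nu> * (k' / 2)\<^sup>2 * (4 * \<rho>) ^ ?N)"
            by (subst ennreal_mult'[symmetric]) (auto simp: power_divide power_mult_distrib mult_ac)
          finally show ?thesis .
        qed
        show "(\<integral>\<^sup>+x\<in>ball x\<^sub>1 (3/2 * (4 * \<rho>)). ennreal (max (- w x - - k') 0) \<partial>lborel) \<le> ennreal (\<Lambda> * (k' / 2) * (4 * \<rho>) ^ ?N)"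
        proof -
          have 6: "3/2 * (4 * \<rho>) = 6 * \<rho>" by simp
          have "(\<integral>\<^sup>+x\<in>?B6. ennreal (max (- w x - - k') 0) \<partial>lborel) \<le> (\<integral>\<^sup>+x. ennreal k' * indicator ?B6 x \<partial>lborel)"
          proof (rule nn_integral_mono)
            fix x
            show "ennreal (max (- w x - - k') 0) * indicator ?B6 x \<le> ennreal k' * indicator ?B6 x"
            proof (cases "x \<in> ?B6")
              case True
              have "max (- w x - - k') 0 \<le> k'" using pos[OF True] \<tau> k' by auto
              then show ?thesis by (intro mult_right_mono ennreal_leI) auto
            qed simp
          qed
          also have "\<dots> = ennreal k' * emeasure lborel ?B6" by (rule nn_integral_cmult_indicator) measurable
          also have "\<dots> = ennreal (k' * (?\<omega> * (6 * \<rho>) ^ ?N))"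
            using \<rho> k' by (simp add: emeasure_ball_eq ennreal_mult)
          also have "\<dots> \<le> ennreal (\<Lambda> * (k' / 2) * (4 * \<rho>) ^ ?N)"
          proof (rule ennreal_leI)
            have "(6 * \<rho>) ^ ?N = (3/2 * (4 * \<rho>)) ^ ?N" by simp
            then have "(6 * \<rho>) ^ ?N = (3/2) ^ ?N * (4 * \<rho>) ^ ?N" by (simp only: power_mult_distrib[of "3/2"])
            moreover have "k' * (?\<omega> * (X * Y)) = (2 * ?\<omega> * X) * (k' / 2 * Y)" for X Y by simp
            ultimately have "k' * (?\<omega> * (6 * \<rho>) ^ ?N) = (2 * ?\<omega> * (3/2) ^ ?N) * (k' / 2 * (4 * \<rho>) ^ ?N)" by metis
            also have "\<dots> \<le> \<Lambda> * (k' / 2 * (4 * \<rho>) ^ ?N)"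
              unfolding \<Lambda>_def using k' \<rho> C by (intro mult_right_mono) auto
            finally show "k' * (?\<omega> * (6 * \<rho>) ^ ?N) \<le> \<Lambda> * (k' / 2) * (4 * \<rho>) ^ ?N" by (simp add: mult.assoc)
          qed
          finally show ?thesis unfolding 6 .
        qed
        show "tail_le J (\<lambda>x. max (- w x - - k') 0) ?B4 (- ball x\<^sub>1 (3/2 * (4 * \<rho>))) (\<Lambda> * (k' / 2) * (4 * \<rho>) powr (-\<alpha>))"
        proof -
          have far: "\<rho> \<le> dist x y" if "x \<in> ?B4" "y \<in> - ?B6" for x y
            using that \<rho> dist_triangle[of x\<^sub>1 y x] by auto
          have t1: "tail_le J (\<lambda>x. max (- w x - - k') 0) ?B4 (- ?B6) (k' * C * \<rho> powr (-\<alpha>) + 9 * \<tau> * \<rho> powr (-\<alpha>))"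
          proof (rule tail_leI_add[where ?g1.0 = "\<lambda>_. k'" and ?g2.0 = "\<lambda>y. max (- w y) 0"])
            show "tail_le J (\<lambda>_. k') ?B4 (- ?B6) (k' * C * \<rho> powr (-\<alpha>))"
              by (rule tail_le_const) (use k' \<rho> far in auto)
            show "tail_le J (\<lambda>y. max (- w y) 0) ?B4 (- ?B6) (9 * \<tau> * \<rho> powr (-\<alpha>))"
              by (rule tail_le_subset[OF tail]) (use \<rho> in auto)
          qed (use k' \<tau> C sets_J in auto)
          have t2: "k' * C * \<rho> powr (-\<alpha>) + 9 * \<tau> * \<rho> powr (-\<alpha>) \<le> \<Lambda> * (k' / 2) * (4 * \<rho>) powr (-\<alpha>)"
          proof -
            have "k' * C * \<rho> powr (-\<alpha>) + 9 * \<tau> * \<rho> powr (-\<alpha>) \<le> k' * C * \<rho> powr (-\<alpha>) + 9 * k' * \<rho> powr (-\<alpha>)"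
              using False by (intro add_left_mono mult_right_mono) auto
            also have "\<dots> = (k' * (C + 9)) * \<rho> powr (-\<alpha>)" by (simp add: algebra_simps)
            also have "\<dots> \<le> (k' * (C + 9)) * (4\<^sup>2 * (4 * \<rho>) powr (-\<alpha>))"
              by (intro mult_left_mono powr_scale_le \<rho> \<alpha>) (use k' C in auto)
            also have "\<dots> = (32 * (C + 9)) * (k' / 2 * (4 * \<rho>) powr (-\<alpha>))" by simp
            also have "\<dots> \<le> \<Lambda> * (k' / 2 * (4 * \<rho>) powr (-\<alpha>))"
              unfolding \<Lambda>_def using k' \<omega> by (intro mult_right_mono) auto
            finally show ?thesis by (simp add: mult.assoc)
          qed
          have "3/2 * (4 * \<rho>) = 6 * \<rho>" by simp
          then show ?thesis
            using tail_le_subset[OF t1 order_refl order_refl t2] by (simp only: order_refl)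
        qed
      qed (use \<rho> k' in auto)
      then show ?thesis by (rule AE_mp, intro AE_I2 impI) (use k' in auto)
    qed
  qed
qed

section \<open>Harnack's inequality for jump forms\<close>

text \<open>Purely qualitative: \<open>h\<close> depends on \<open>w\<close>. It is used only to
  make the weighted supremum in \<open>harnack_abstract\<close> finite.\<close>

lemma locally_bounded_above:
  fixes x\<^sub>0 :: "'a::euclidean_space"
  assumes J: "jump_form J \<alpha> C E" and w: "weak_sol J E w" and \<rho>: "0 < \<rho>" and E: "cball x\<^sub>0 (3/2 * \<rho>) \<subseteq> E"
  shows "\<exists>h>0. AE x in lborel. x \<in> ball x\<^sub>0 (\<rho>/2) \<longrightarrow> w x \<le> h"
proof -
  interpret jump_form J \<alpha> C E by (rule J)
  let ?N = "DIM('a)"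
  let ?D = "ball x\<^sub>0 (3/2 * \<rho>)"
  obtain \<nu> where \<nu>: "0 < \<nu>" and DG: "\<forall>(J :: ('a \<times> 'a) measure) E. jump_form J \<alpha> C E \<longrightarrow> de_giorgi_bound J E \<alpha> 1 \<nu>"
    by (rule de_giorgi[where 'a = 'a, OF \<alpha> C zero_le_one]) (rule that)
  have wl: "loc_space J E w" using w by (simp add: weak_sol_def)
  have [measurable]: "w \<in> borel_measurable borel" using wl by (simp add: loc_space_def)
  have DE: "?D \<subseteq> E" using E ball_subset_cball by blast
  have "closure ?D \<subseteq> cball x\<^sub>0 (3/2 * \<rho>)" by (rule closure_minimal) auto
  then have "closure ?D \<subseteq> E" using E by blast
  then have fin: "(\<integral>\<^sup>+x\<in>?D. ennreal ((w x)\<^sup>2) \<partial>lborel) < \<infinity>"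
    using wl unfolding loc_space_def by auto
  then obtain a where a: "(\<integral>\<^sup>+x\<in>?D. ennreal ((w x)\<^sup>2) \<partial>lborel) = ennreal a" "0 \<le> a"
    by (cases "\<integral>\<^sup>+x\<in>?D. ennreal ((w x)\<^sup>2) \<partial>lborel" rule: ennreal_cases) auto
  define b where "b = unit_ball_vol ?N * (3/2 * \<rho>) ^ ?N + a"
  have b: "0 \<le> b" unfolding b_def using a \<rho> by simp
  have m: "(\<integral>\<^sup>+x\<in>?D. ennreal (max (w x - 0) 0) \<partial>lborel) \<le> ennreal b"
  proof -
    have "(\<integral>\<^sup>+x\<in>?D. ennreal (max (w x - 0) 0) \<partial>lborel) \<le> (\<integral>\<^sup>+x. indicator ?D x + ennreal ((w x)\<^sup>2) * indicator ?D x \<partial>lborel)"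
    proof (rule nn_integral_mono)
      fix x
      have "2 * w x \<le> 1 + (w x)\<^sup>2" using zero_le_power2[of "w x - 1"] unfolding power2_diff by simp
      then have "max (w x - 0) 0 \<le> 1 + (w x)\<^sup>2" using zero_le_power2[of "w x"] by linarith
      then have "ennreal (max (w x - 0) 0) \<le> ennreal (1 + (w x)\<^sup>2)" by (rule ennreal_leI)
      then show "ennreal (max (w x - 0) 0) * indicator ?D x \<le> indicator ?D x + ennreal ((w x)\<^sup>2) * indicator ?D x"
        by (auto split: split_indicator simp: ennreal_plus)
    qed
    also have "\<dots> = emeasure lborel ?D + ennreal a" using a by (simp add: nn_integral_add)
    also have "\<dots> = ennreal b" unfolding b_def using \<rho> a by (simp add: emeasure_ball_eq)
    finally show ?thesis .
  qed
  have s: "(\<integral>\<^sup>+x\<in>ball x\<^sub>0 \<rho>. ennreal ((max (w x - 0) 0)\<^sup>2) \<partial>lborel) \<le> ennreal a"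
    unfolding a(1)[symmetric]
  proof (rule nn_integral_mono)
    fix x
    have "(max (w x - 0) 0)\<^sup>2 \<le> (w x)\<^sup>2" by (auto simp: max_def)
    then show "ennreal ((max (w x - 0) 0)\<^sup>2) * indicator (ball x\<^sub>0 \<rho>) x \<le> ennreal ((w x)\<^sup>2) * indicator ?D x"
      using \<rho> by (auto split: split_indicator intro: ennreal_leI)
  qed
  have "0 < 3/2 * \<rho>" using \<rho> by simp
  then obtain T where T: "tail_le J (\<lambda>y. \<bar>w y\<bar>) (ball x\<^sub>0 (7/8 * (3/2 * \<rho>))) (- ?D) T"
    using w DE unfolding weak_sol_def by blast
  \<comment> \<open>Each summand secures one hypothesis of De Giorgi's lemma at level 0; the leading
    1 ensures \<open>h \<le> h\<^sup>2\<close>, as the smallness condition is quadratic in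
    \<open>h\<close>.\<close>
  define h where "h = 1 + a / (\<nu> * \<rho> ^ ?N) + b / \<rho> ^ ?N + \<bar>T\<bar> * \<rho> powr \<alpha>"
  have h1: "1 \<le> h" "a / (\<nu> * \<rho> ^ ?N) \<le> h" "b / \<rho> ^ ?N \<le> h" "\<bar>T\<bar> * \<rho> powr \<alpha> \<le> h"
    unfolding h_def using a b \<nu> \<rho> by (simp_all add: add_nonneg_nonneg)
  have "AE x in lborel. x \<in> ball x\<^sub>0 (\<rho>/2) \<longrightarrow> w x \<le> 0 + h"
  proof (rule DG[rule_format, OF J, unfolded de_giorgi_bound_def, rule_format, OF w \<rho> DE])
    show "0 < h" using h1 by simp
    have "a \<le> h * (\<nu> * \<rho> ^ ?N)" using h1(2) \<nu> \<rho> by (simp add: divide_le_eq)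
    also have "\<dots> \<le> h\<^sup>2 * (\<nu> * \<rho> ^ ?N)" using h1(1) \<nu> \<rho> by (intro mult_right_mono) (auto simp: power2_eq_square)
    finally have "a \<le> \<nu> * h\<^sup>2 * \<rho> ^ ?N" by (simp add: mult_ac)
    then show "(\<integral>\<^sup>+x\<in>ball x\<^sub>0 \<rho>. ennreal ((max (w x - 0) 0)\<^sup>2) \<partial>lborel) \<le> ennreal (\<nu> * h\<^sup>2 * \<rho> ^ ?N)"
      using order_trans[OF s ennreal_leI] by blast
    have "b \<le> 1 * h * \<rho> ^ ?N" using h1(3) \<rho> by (simp add: divide_le_eq)
    then show "(\<integral>\<^sup>+x\<in>?D. ennreal (max (w x - 0) 0) \<partial>lborel) \<le> ennreal (1 * h * \<rho> ^ ?N)"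
      using order_trans[OF m ennreal_leI] by blast
    have e: "\<rho> powr \<alpha> * \<rho> powr (-\<alpha>) = 1" using \<rho> by (simp add: powr_minus)
    have "T \<le> \<bar>T\<bar> * (\<rho> powr \<alpha> * \<rho> powr (-\<alpha>))" unfolding e mult_1_right by (rule abs_ge_self)
    also have "\<dots> = (\<bar>T\<bar> * \<rho> powr \<alpha>) * \<rho> powr (-\<alpha>)" by (rule mult.assoc[symmetric])
    also have "\<dots> \<le> h * \<rho> powr (-\<alpha>)" by (rule mult_right_mono[OF h1(4)]) simp
    also have "\<dots> = 1 * h * \<rho> powr (-\<alpha>)" by (simp only: mult_1_left)
    finally have T': "T \<le> 1 * h * \<rho> powr (-\<alpha>)" .
    have sub: "ball x\<^sub>0 \<rho> \<subseteq> ball x\<^sub>0 (7/8 * (3/2 * \<rho>))" using \<rho> by (intro subset_ball) simp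
    show "tail_le J (\<lambda>x. max (w x - 0) 0) (ball x\<^sub>0 \<rho>) (- ?D) (1 * h * \<rho> powr (-\<alpha>))"
      by (rule tail_le_subset[OF T sub order_refl T']) simp
  qed
  then show ?thesis using h1 by (intro exI[of _ h]) auto
qed

text \<open>Otherwise countably many balls would cover \<open>W\<close> by null pieces. It replaces
  attainment of a supremum, since \<open>w\<close> is not known to be continuous: near the chosen
  point, values from \<open>W\<close> occur with positive measure.\<close>

lemma non_null_point:
  fixes W :: "'a::euclidean_space set"
  assumes W: "W \<in> sets lborel" "emeasure lborel W \<noteq> 0"
  shows "\<exists>x\<in>W. \<forall>\<epsilon>>0. emeasure lborel (W \<inter> ball x \<epsilon>) \<noteq> 0"
proof (rule ccontr)
  assume "\<not> ?thesis"
  then obtain e where e: "\<And>x. x \<in> W \<Longrightarrow> 0 < e x \<and> emeasure lborel (W \<inter> ball x (e x)) = 0" by metis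
  obtain F where F: "F \<subseteq> (\<lambda>x. ball x (e x)) ` W" "countable F" "\<Union>F = \<Union>((\<lambda>x. ball x (e x)) ` W)"
    using Lindelof[of "(\<lambda>x. ball x (e x)) ` W"] by blast
  have "W = (\<Union>B\<in>F. W \<inter> B)" using F(3) e by fastforce
  moreover have "(\<Union>B\<in>F. W \<inter> B) \<in> null_sets lborel"
    using F(1,2) e W(1) by (intro null_sets_UN') (auto simp: null_sets_def)
  ultimately show False using W(2) by auto
qed

text \<open>The number \<open>M\<close> separates the essential supremum from \<gamma> times the
  essential infimum. The radius \<open>28 * r\<close> fits the application: it is below 7/8 of R
  because R > 32 r, hence the tail is controlled on that ball.\<close>

lemma harnack_abstract:
  fixes \<alpha> C :: real
  assumes \<alpha>: "0 < \<alpha>" "\<alpha> < 2" and C: "1 \<le> C"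
  obtains \<gamma> where "1 < \<gamma>"
    and "\<forall>(J :: ('a::euclidean_space \<times> 'a) measure) E w x\<^sub>0 r \<tau>.
      jump_form J \<alpha> C E \<longrightarrow> weak_sol J E w \<longrightarrow> 0 < r \<longrightarrow> ball x\<^sub>0 (28 * r) \<subseteq> E \<longrightarrow> 0 < \<tau> \<longrightarrow>
      (\<forall>x\<in>ball x\<^sub>0 (28 * r). \<tau> \<le> w x) \<longrightarrow>
      tail_le J (\<lambda>y. max (- w y) 0) (ball x\<^sub>0 (28 * r)) UNIV (\<tau> * r powr (-\<alpha>)) \<longrightarrow>
      (\<exists>M. (AE x in lborel. x \<in> ball x\<^sub>0 r \<longrightarrow> w x \<le> M) \<and> (AE x in lborel. x \<in> ball x\<^sub>0 r \<longrightarrow> M \<le> \<gamma> * w x))"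
proof -
  let ?N = "DIM('a)"
  let ?\<omega> = "unit_ball_vol (real ?N)"
  have \<omega>: "0 < ?\<omega>" by simp
  have dc: "0 < decay_const \<alpha> C" using \<alpha> C by (rule decay_const_pos)
  define L where "L = log_const \<alpha> C ?N"
  have L: "0 < L" unfolding L_def log_const_def using dc C \<omega> by (simp add: add_pos_pos)
  obtain c1 where c1: "0 < c1" "c1 \<le> 1" and EP1: "\<forall>(J :: ('a::euclidean_space \<times> 'a) measure) E. jump_form J \<alpha> C E \<longrightarrow> expansion_bound J E \<alpha> 1 c1"
    by (rule expansion_of_positivity[where 'a = 'a, OF \<alpha> C zero_less_one order_refl]) (rule that)
  \<comment> \<open>\<open>c1\<close> is the loss of one doubling when positivity is known on the
    whole ball. Replacing it by a power of 1/2 makes the accumulated loss a power of the ratio of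
    radii.\<close>
  obtain D where D: "(1/2) ^ D < c1" using real_arch_pow_inv[of c1 "1/2"] c1 by auto
  \<comment> \<open>Bound for \<open>w / M\<close> on \<open>ball x\<^sub>1 (6 * \<rho>)\<close>:
    the base of the weight is at least \<open>8 * \<rho>\<close> there and at most
    \<open>24 * \<rho>\<close> where \<open>M\<close> is compared with \<open>w\<close>; the factor
    2 comes from the near-maximum.\<close>
  define \<Gamma> where "\<Gamma> = 2 * (3::real) ^ D"
  have \<Gamma>: "0 < \<Gamma>" unfolding \<Gamma>_def by simp
  \<comment> \<open>The first summand serves the mean over the ball of radius
    \<open>3/2 * \<rho>\<close>; the bracket collects the tail of the positive part, split at radius
    \<open>6 * \<rho>\<close>. The factors 2 occur because the step height is
    \<open>M / 2\<close>.\<close>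
  define \<Lambda> where "\<Lambda> = 2 * \<Gamma> * ?\<omega> * (3/2) ^ ?N + 2 * (4 * C * \<Gamma> * ?\<omega> * 12 ^ ?N + C * \<Gamma> * L)"
  have \<Lambda>: "0 \<le> \<Lambda>" unfolding \<Lambda>_def using C \<omega> L \<Gamma> by simp
  obtain \<nu> where \<nu>: "0 < \<nu>" and DG: "\<forall>(J :: ('a \<times> 'a) measure) E. jump_form J \<alpha> C E \<longrightarrow> de_giorgi_bound J E \<alpha> \<Lambda> \<nu>"
    by (rule de_giorgi[where 'a = 'a, OF \<alpha> C \<Lambda>]) (rule that)
  \<comment> \<open>If \<open>w \<ge> M / 2\<close> held only on a fraction \<open>\<mu>\<close> of
    the ball, the truncation at \<open>M / 2\<close>, bounded by \<open>\<Gamma> * M\<close>, would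
    satisfy the smallness condition of De Giorgi's lemma, which \<open>big\<close> excludes.\<close>
  define \<mu> where "\<mu> = min 1 (\<nu> / (4 * \<Gamma>\<^sup>2 * ?\<omega>))"
  have \<mu>: "0 < \<mu>" "\<mu> \<le> 1" unfolding \<mu>_def using \<nu> \<Gamma> \<omega> by auto
  have \<mu>\<nu>: "\<Gamma>\<^sup>2 * (\<mu> * ?\<omega>) \<le> \<nu> / 4"
  proof -
    have "\<mu> \<le> \<nu> / (4 * \<Gamma>\<^sup>2 * ?\<omega>)" unfolding \<mu>_def by simp
    then have "\<mu> * (4 * \<Gamma>\<^sup>2 * ?\<omega>) \<le> \<nu>" using \<Gamma> \<omega> by (simp add: le_divide_eq)
    then show ?thesis by (simp add: mult_ac)
  qed
  obtain c2 where c2: "0 < c2" "c2 \<le> 1" and EP2: "\<forall>(J :: ('a::euclidean_space \<times> 'a) measure) E. jump_form J \<alpha> C E \<longrightarrow> expansion_bound J E \<alpha> \<mu> c2"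
    by (rule expansion_of_positivity[where 'a = 'a, OF \<alpha> C \<mu>]) (rule that)
  \<comment> \<open>72 is 3 * 24: the expansion stops at a radius of at most \<open>3 * r\<close>,
    and \<open>M\<close> is defined with the weight \<open>(24 * \<rho>) ^ D\<close>. The 4 stems
    from \<open>S / 2\<close> and \<open>M / 2\<close>.\<close>
  define \<gamma> where "\<gamma> = 4 * 72 ^ D / c2"
  have \<gamma>: "1 < \<gamma>"
  proof -
    have "(1::real) \<le> 72 ^ D" by simp
    then have "c2 < 4 * 72 ^ D" using c2(2) by linarith
    then show ?thesis unfolding \<gamma>_def using c2(1) by simp
  qed
  show thesis
  proof (rule that[OF \<gamma>], intro allI impI)
    fix J :: "('a \<times> 'a) measure" and E w x\<^sub>0 and r \<tau> :: real
    assume J: "jump_form J \<alpha> C E" and w: "weak_sol J E w" and r: "0 < r" and E: "ball x\<^sub>0 (28 * r) \<subseteq> E"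
      and \<tau>: "0 < \<tau>" and pos: "\<forall>x\<in>ball x\<^sub>0 (28 * r). \<tau> \<le> w x"
      and tail: "tail_le J (\<lambda>y. max (- w y) 0) (ball x\<^sub>0 (28 * r)) UNIV (\<tau> * r powr (-\<alpha>))"
    interpret jump_form J \<alpha> C E by (rule J)
    have [measurable]: "w \<in> borel_measurable borel" using w by (simp add: loc_space_def weak_sol_def)
    let ?B = "ball x\<^sub>0 (2 * r)"
    have "\<exists>h>0. AE x in lborel. x \<in> ball x\<^sub>0 ((4 * r) / 2) \<longrightarrow> w x \<le> h"
    proof (rule locally_bounded_above[OF J w])
      show "cball x\<^sub>0 (3/2 * (4 * r)) \<subseteq> E" using E r by (auto simp: subset_iff)
    qed (use r in simp)
    then obtain h where h: "0 < h" "AE x in lborel. x \<in> ?B \<longrightarrow> w x \<le> h" by auto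
    \<comment> \<open>The weight of exponent \<open>D\<close> is matched to the loss \<open>2\<^sup>-\<^sup>D\<close> per doubling in \<open>iter\<close> below.\<close>
    define g where "g = (\<lambda>x. (2 * r - dist x\<^sub>0 x) ^ D * w x)"
    have [measurable]: "g \<in> borel_measurable borel" unfolding g_def by measurable
    \<comment> \<open>The essential supremum of \<open>g\<close> as a real number. The set of bounds
      is nonempty by the local boundedness just obtained, and \<open>gS\<close> shows that its
      infimum is itself a bound.\<close>
    define S where "S = Inf {s. AE x in lborel. x \<in> ?B \<longrightarrow> g x \<le> s}" (is "_ = Inf ?T")
    have wpos: "0 < w x" if "x \<in> ?B" for x
    proof -
      have "x \<in> ball x\<^sub>0 (28 * r)" using that r by auto
      then show ?thesis using pos \<tau> by force
    qed
    have gpos: "0 < g x" if "x \<in> ?B" for x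
      unfolding g_def using that wpos[OF that] by simp
    have Bnn: "\<not> (AE x in lborel. x \<notin> ?B)"
    proof
      assume "AE x in lborel. x \<notin> ?B"
      then have "emeasure lborel ?B = 0" by (subst (asm) AE_iff_measurable[where N = ?B]) auto
      moreover have "0 < ?\<omega> * (2 * r) ^ ?N" using r \<omega> by (intro mult_pos_pos zero_less_power) auto
      ultimately show False using r by (simp add: emeasure_ball_eq)
    qed
    have Tpos: "0 < s" if "s \<in> ?T" for s
    proof (rule ccontr)
      assume "\<not> 0 < s"
      have "AE x in lborel. x \<in> ?B \<longrightarrow> g x \<le> s" using that by simp
      then have "AE x in lborel. x \<notin> ?B"
      proof (rule AE_mp, intro AE_I2 impI notI)
        fix x assume "x \<in> ?B \<longrightarrow> g x \<le> s" "x \<in> ?B"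
        then show False using gpos[of x] \<open>\<not> 0 < s\<close> by linarith
      qed
      then show False using Bnn by blast
    qed
    have "(2 * r) ^ D * h \<in> ?T"
    proof -
      have "AE x in lborel. x \<in> ?B \<longrightarrow> g x \<le> (2 * r) ^ D * h"
        using h(2)
      proof (rule AE_mp, intro AE_I2 impI)
        fix x assume x: "x \<in> ?B \<longrightarrow> w x \<le> h" "x \<in> ?B"
        then show "g x \<le> (2 * r) ^ D * h" unfolding g_def using wpos[of x] r
          by (intro mult_mono power_mono) auto
      qed
      then show ?thesis by simp
    qed
    then have Tne: "?T \<noteq> {}" by blast
    have Tbd: "bdd_below ?T" by (rule bdd_belowI[of _ 0]) (use Tpos in force)
    have gS: "AE x in lborel. x \<in> ?B \<longrightarrow> g x \<le> S"
    proof -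
      have "AE x in lborel. x \<in> ?B \<longrightarrow> g x \<le> S + 1 / Suc n" for n
      proof -
        have "Inf ?T < S + 1 / Suc n" unfolding S_def by simp
        then obtain s where "s \<in> ?T" "s < S + 1 / Suc n" using cInf_lessD[OF Tne] by blast
        then have "AE x in lborel. x \<in> ?B \<longrightarrow> g x \<le> s" by simp
        then show ?thesis
        proof (rule AE_mp, intro AE_I2 impI)
          fix x assume "x \<in> ?B \<longrightarrow> g x \<le> s" "x \<in> ?B"
          then show "g x \<le> S + 1 / Suc n" using \<open>s < S + 1 / Suc n\<close> by linarith
        qed
      qed
      then have "AE x in lborel. \<forall>n. x \<in> ?B \<longrightarrow> g x \<le> S + 1 / Suc n" by (subst AE_all_countable) blast
      then show ?thesis
      proof (rule AE_mp, intro AE_I2 impI)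
        fix x assume a: "\<forall>n. x \<in> ?B \<longrightarrow> g x \<le> S + 1 / Suc n" "x \<in> ?B"
        have "(\<lambda>n. S + 1 / Suc n) \<longlonglongrightarrow> S + 0" by (intro tendsto_add tendsto_const LIMSEQ_Suc[OF lim_1_over_n])
        then show "g x \<le> S" using a by (intro LIMSEQ_le_const[of _ S]) auto
      qed
    qed
    then have S0: "0 < S" using Tpos by simp
    define W where "W = {x\<in>?B. S / 2 < g x}"
    have [measurable]: "W \<in> sets borel" unfolding W_def by measurable
    have Wnn: "emeasure lborel W \<noteq> 0"
    proof
      assume "emeasure lborel W = 0"
      then have "AE x in lborel. x \<notin> W" by (intro AE_not_in) (auto simp: null_sets_def)
      then have "AE x in lborel. x \<in> ?B \<longrightarrow> g x \<le> S / 2"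
      proof (rule AE_mp, intro AE_I2 impI)
        fix x assume "x \<notin> W" "x \<in> ?B"
        then show "g x \<le> S / 2" unfolding W_def by auto
      qed
      then have "S / 2 \<in> ?T" by simp
      then have "S \<le> S / 2" unfolding S_def using cInf_lower[OF _ Tbd] by blast
      then show False using S0 by simp
    qed
    then obtain x\<^sub>1 where x1: "x\<^sub>1 \<in> W" "\<And>\<epsilon>. 0 < \<epsilon> \<Longrightarrow> emeasure lborel (W \<inter> ball x\<^sub>1 \<epsilon>) \<noteq> 0"
      using non_null_point[of W] by auto
    \<comment> \<open>The distance from \<open>x\<^sub>1\<close> to the boundary of
      \<open>?B\<close> is \<open>16 * \<rho>\<close>, so on
      \<open>ball x\<^sub>1 (6 * \<rho>)\<close> the base of the weight stays between
      \<open>8 * \<rho>\<close> and \<open>24 * \<rho>\<close>.\<close>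
    define \<rho> where "\<rho> = (2 * r - dist x\<^sub>0 x\<^sub>1) / 16"
    have \<rho>: "0 < \<rho>" "\<rho> \<le> r / 8" "2 * r - dist x\<^sub>0 x\<^sub>1 = 16 * \<rho>" using x1(1) unfolding W_def \<rho>_def by auto
    have x10: "dist x\<^sub>0 x\<^sub>1 < 2 * r" using x1(1) unfolding W_def by auto
    define M where "M = S / 2 / (24 * \<rho>) ^ D"
    have M: "0 < M" unfolding M_def using S0 \<rho> by simp
    have ub: "AE x in lborel. x \<in> ball x\<^sub>1 (6 * \<rho>) \<longrightarrow> w x \<le> \<Gamma> * M"
      using gS
    proof (rule AE_mp, intro AE_I2 impI)
      fix x assume a: "x \<in> ?B \<longrightarrow> g x \<le> S" "x \<in> ball x\<^sub>1 (6 * \<rho>)"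
      have d: "8 * \<rho> \<le> 2 * r - dist x\<^sub>0 x" using a(2) \<rho> dist_triangle[of x\<^sub>0 x x\<^sub>1] by auto
      then have xB: "x \<in> ?B" using \<rho> by auto
      have "(8 * \<rho>) ^ D * w x \<le> (2 * r - dist x\<^sub>0 x) ^ D * w x"
        using d \<rho> wpos[OF xB] by (intro mult_right_mono power_mono) auto
      also have "\<dots> \<le> S" using a(1) xB unfolding g_def by blast
      finally have "w x \<le> S / (8 * \<rho>) ^ D" using \<rho> by (simp add: field_simps)
      also have "\<dots> = \<Gamma> * M"
      proof -
        have "(24 * \<rho>) ^ D = (3 * (8 * \<rho>)) ^ D" by simp
        then have "(24 * \<rho>) ^ D = 3 ^ D * (8 * \<rho>) ^ D" by (simp only: power_mult_distrib[of 3])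
        then show ?thesis unfolding \<Gamma>_def M_def using \<rho> by simp
      qed
      finally show "w x \<le> \<Gamma> * M" .
    qed
    have lb: "M < w x" if "x \<in> W \<inter> ball x\<^sub>1 (\<rho> / 2)" for x
    proof -
      have xB: "x \<in> ?B" "S / 2 < g x" using that unfolding W_def by auto
      have "2 * r - dist x\<^sub>0 x \<le> 24 * \<rho>" using that \<rho> dist_triangle[of x\<^sub>0 x\<^sub>1 x] by (auto simp: dist_commute)
      then have "g x \<le> (24 * \<rho>) ^ D * w x" unfolding g_def
        using xB(1) wpos[OF xB(1)] by (intro mult_right_mono power_mono) auto
      then have "S / 2 < (24 * \<rho>) ^ D * w x" using xB(2) by linarith
      then show ?thesis unfolding M_def using \<rho> by (simp add: field_simps)
    qed
    \<comment> \<open>\<open>x\<^sub>1\<close> is within \<open>2 * r\<close> of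
      \<open>x\<^sub>0\<close>, and \<open>7 * (3 * r)\<close> more stays within
      \<open>28 * r\<close>; this leaves room for every radius up to \<open>3 * r\<close> used in
      the expansion.\<close>
    have loc: "ball x\<^sub>1 (7 * \<rho>') \<subseteq> E" "\<forall>x\<in>ball x\<^sub>1 (6 * \<rho>'). \<tau> \<le> w x"
        "tail_le J (\<lambda>y. max (- w y) 0) (ball x\<^sub>1 (5 * \<rho>')) UNIV (9 * \<tau> * \<rho>' powr (-\<alpha>))"
      if \<rho>': "0 < \<rho>'" "\<rho>' \<le> 3 * r" for \<rho>'
    proof -
      have sub: "ball x\<^sub>1 (7 * \<rho>') \<subseteq> ball x\<^sub>0 (28 * r)"
      proof
        fix x assume "x \<in> ball x\<^sub>1 (7 * \<rho>')"
        then show "x \<in> ball x\<^sub>0 (28 * r)" using \<rho>' x10 r dist_triangle[of x\<^sub>0 x x\<^sub>1] by auto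
      qed
      then show "ball x\<^sub>1 (7 * \<rho>') \<subseteq> E" using E by blast
      have "ball x\<^sub>1 (6 * \<rho>') \<subseteq> ball x\<^sub>1 (7 * \<rho>')" using \<rho>' by auto
      then show "\<forall>x\<in>ball x\<^sub>1 (6 * \<rho>'). \<tau> \<le> w x" using sub pos by blast
      have "r powr (-\<alpha>) \<le> (\<rho>' / 3) powr (-\<alpha>)" using \<rho>' \<alpha> r by (intro powr_mono2') auto
      also have "\<dots> \<le> 3\<^sup>2 * (3 * (\<rho>' / 3)) powr (-\<alpha>)" by (rule powr_scale_le) (use \<rho>' \<alpha> in auto)
      finally have "\<tau> * r powr (-\<alpha>) \<le> 9 * \<tau> * \<rho>' powr (-\<alpha>)" using \<tau> by (simp add: mult.left_commute)
      moreover have "ball x\<^sub>1 (5 * \<rho>') \<subseteq> ball x\<^sub>0 (28 * r)" using subset_trans[OF subset_ball sub] \<rho>' by auto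
      ultimately show "tail_le J (\<lambda>y. max (- w y) 0) (ball x\<^sub>1 (5 * \<rho>')) UNIV (9 * \<tau> * \<rho>' powr (-\<alpha>))"
        by (intro tail_le_subset[OF tail]) auto
    qed
    have \<rho>3: "\<rho> \<le> 3 * r" using \<rho> r by simp
    note loc1 = loc[OF \<rho>(1) \<rho>3]
    let ?P = "\<lambda>r. ball x\<^sub>1 r"
    have E32: "?P (3/2 * \<rho>) \<subseteq> E" by (rule subset_trans[OF subset_ball loc1(1)]) (use \<rho> in auto)
    \<comment> \<open>Were it small, De Giorgi's lemma with level and height both
      \<open>M / 2\<close> would give \<open>w \<le> M\<close> almost everywhere near
      \<open>x\<^sub>1\<close>, although \<open>w > M\<close> on the part of \<open>W\<close> there,
      which has positive measure.\<close>
    have big: "\<not> (\<integral>\<^sup>+x\<in>?P \<rho>. ennreal ((max (w x - M / 2) 0)\<^sup>2) \<partial>lborel) \<le> ennreal (\<nu> * (M / 2)\<^sup>2 * \<rho> ^ ?N)"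
    proof
      assume small: "(\<integral>\<^sup>+x\<in>?P \<rho>. ennreal ((max (w x - M / 2) 0)\<^sup>2) \<partial>lborel) \<le> ennreal (\<nu> * (M / 2)\<^sup>2 * \<rho> ^ ?N)"
      have "AE x in lborel. x \<in> ?P (\<rho> / 2) \<longrightarrow> w x \<le> M / 2 + M / 2"
      proof (rule DG[rule_format, OF J, unfolded de_giorgi_bound_def, rule_format, OF w \<rho>(1) E32 _ small])
        show "(\<integral>\<^sup>+x\<in>?P (3/2 * \<rho>). ennreal (max (w x - M / 2) 0) \<partial>lborel) \<le> ennreal (\<Lambda> * (M / 2) * \<rho> ^ ?N)"
        proof -
          have "(\<integral>\<^sup>+x\<in>?P (3/2 * \<rho>). ennreal (max (w x - M / 2) 0) \<partial>lborel) \<le> (\<integral>\<^sup>+x. ennreal (\<Gamma> * M) * indicator (?P (3/2 * \<rho>)) x \<partial>lborel)"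
          proof (rule nn_integral_mono_AE, use ub in \<open>rule AE_mp\<close>, intro AE_I2 impI)
            fix x assume a: "x \<in> ?P (6 * \<rho>) \<longrightarrow> w x \<le> \<Gamma> * M"
            show "ennreal (max (w x - M / 2) 0) * indicator (?P (3/2 * \<rho>)) x \<le> ennreal (\<Gamma> * M) * indicator (?P (3/2 * \<rho>)) x"
            proof (cases "x \<in> ?P (3/2 * \<rho>)")
              case True
              then have "w x \<le> \<Gamma> * M" using a \<rho> by auto
              then have "max (w x - M / 2) 0 \<le> \<Gamma> * M" using M \<Gamma> by auto
              then show ?thesis by (intro mult_right_mono ennreal_leI) auto
            qed simp
          qed
          also have "\<dots> = ennreal (\<Gamma> * M) * emeasure lborel (?P (3/2 * \<rho>))" by (rule nn_integral_cmult_indicator) measurable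
          also have "\<dots> = ennreal (\<Gamma> * M * (?\<omega> * (3/2 * \<rho>) ^ ?N))"
            using \<rho> M \<Gamma> by (simp add: emeasure_ball_eq ennreal_mult)
          also have "\<dots> \<le> ennreal (\<Lambda> * (M / 2) * \<rho> ^ ?N)"
          proof (rule ennreal_leI)
            have "\<Gamma> * M * (?\<omega> * (3/2 * \<rho>) ^ ?N) = (2 * \<Gamma> * ?\<omega> * (3/2) ^ ?N) * (M / 2 * \<rho> ^ ?N)"
              unfolding power_mult_distrib by simp
            also have "\<dots> \<le> \<Lambda> * (M / 2 * \<rho> ^ ?N)"
              unfolding \<Lambda>_def using M \<rho> C \<Gamma> \<omega> L by (intro mult_right_mono) auto
            finally show "\<Gamma> * M * (?\<omega> * (3/2 * \<rho>) ^ ?N) \<le> \<Lambda> * (M / 2) * \<rho> ^ ?N" by (simp add: mult.assoc)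
          qed
          finally show ?thesis .
        qed
        show "tail_le J (\<lambda>x. max (w x - M / 2) 0) (?P \<rho>) (- ?P (3/2 * \<rho>)) (\<Lambda> * (M / 2) * \<rho> powr (-\<alpha>))"
        proof -
          \<comment> \<open>The tail is split at radius \<open>6 * \<rho>\<close>. Up to it,
            \<open>w \<le> \<Gamma> * M\<close> and the kernel bound \<open>upper\<close> suffice;
            beyond it nothing is known about the size of \<open>w\<close>, and UJS has to be
            used.\<close>
          let ?wp = "\<lambda>x. max (w x) 0"
          let ?near = "\<lambda>x. ?wp x * indicat_real (?P (6 * \<rho>)) x"
          let ?far = "\<lambda>x. ?wp x * indicat_real (- ?P (6 * \<rho>)) x"
          define T1 where "T1 = 4 * C * \<Gamma> * ?\<omega> * 12 ^ ?N * M * \<rho> powr (-\<alpha>)"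
          define T2 where "T2 = C * \<Gamma> * L * M * \<rho> powr (-\<alpha>)"
          have "tail_le J ?near (?P \<rho>) (- ?P (3/2 * \<rho>)) T1"
            unfolding tail_le_def
          proof (intro allI impI)
            fix f :: "'a \<Rightarrow> ennreal" assume f[measurable]: "f \<in> borel_measurable borel"
            have "(\<integral>\<^sup>+p. f (fst p) * ennreal (?near (snd p)) * indicator (?P \<rho> \<times> - ?P (3/2 * \<rho>)) p \<partial>J)
               \<le> (\<integral>\<^sup>+p. f (fst p) * ennreal (?near (snd p)) * indicator {p. \<rho>/2 \<le> dist (fst p) (snd p)} p \<partial>J)"
            proof (rule nn_integral_mono, rule mult_left_mono)
              fix p :: "'a \<times> 'a"
              show "indicator (?P \<rho> \<times> - ?P (3/2 * \<rho>)) p \<le> (indicator {p. \<rho>/2 \<le> dist (fst p) (snd p)} p :: ennreal)"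
              proof (cases "p \<in> ?P \<rho> \<times> - ?P (3/2 * \<rho>)")
                case True
                then have "\<rho>/2 \<le> dist (fst p) (snd p)" using dist_triangle[of x\<^sub>1 "snd p" "fst p"] by auto
                then show ?thesis by (auto split: split_indicator)
              qed simp
            qed simp
            also have "\<dots> \<le> ennreal (C * (\<rho>/2) powr (-\<alpha>) / (\<rho>/2) ^ ?N) * ((\<integral>\<^sup>+x. f x \<partial>lborel) * (\<integral>\<^sup>+x. ennreal (?near x) \<partial>lborel))"
              by (rule upper[where g = "\<lambda>x. ennreal (?near x)"]) (use \<rho> in auto)
            also have "(\<integral>\<^sup>+x. ennreal (?near x) \<partial>lborel) \<le> ennreal (\<Gamma> * M * (?\<omega> * (6 * \<rho>) ^ ?N))"
            proof -
              have "(\<integral>\<^sup>+x. ennreal (?near x) \<partial>lborel) \<le> (\<integral>\<^sup>+x. ennreal (\<Gamma> * M) * indicator (?P (6 * \<rho>)) x \<partial>lborel)"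
              proof (rule nn_integral_mono_AE, use ub in \<open>rule AE_mp\<close>, intro AE_I2 impI)
                fix x assume "x \<in> ?P (6 * \<rho>) \<longrightarrow> w x \<le> \<Gamma> * M"
                then show "ennreal (?near x) \<le> ennreal (\<Gamma> * M) * indicator (?P (6 * \<rho>)) x"
                  using M \<Gamma> by (auto split: split_indicator intro!: ennreal_leI)
              qed
              also have "\<dots> = ennreal (\<Gamma> * M) * emeasure lborel (?P (6 * \<rho>))" by (rule nn_integral_cmult_indicator) measurable
              also have "\<dots> = ennreal (\<Gamma> * M * (?\<omega> * (6 * \<rho>) ^ ?N))"
                using \<rho> M \<Gamma> by (simp add: emeasure_ball_eq ennreal_mult)
              finally show ?thesis .
            qed
            also have "ennreal (C * (\<rho>/2) powr (-\<alpha>) / (\<rho>/2) ^ ?N) * ((\<integral>\<^sup>+x. f x \<partial>lborel) * ennreal (\<Gamma> * M * (?\<omega> * (6 * \<rho>) ^ ?N)))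
               = ennreal (C * (\<rho>/2) powr (-\<alpha>) / (\<rho>/2) ^ ?N * (\<Gamma> * M * (?\<omega> * (6 * \<rho>) ^ ?N))) * (\<integral>\<^sup>+x. f x \<partial>lborel)"
              using C \<rho> M \<Gamma> by (subst ennreal_mult) (auto simp: mult_ac)
            also have "\<dots> \<le> ennreal T1 * (\<integral>\<^sup>+x. f x \<partial>lborel)"
            proof (intro mult_right_mono ennreal_leI)
              have "(6 * \<rho>) ^ ?N = (12 * (\<rho>/2)) ^ ?N" by simp
              then have "(6 * \<rho>) ^ ?N = 12 ^ ?N * (\<rho>/2) ^ ?N" by (simp only: power_mult_distrib[of 12])
              then have "C * (\<rho>/2) powr (-\<alpha>) / (\<rho>/2) ^ ?N * (\<Gamma> * M * (?\<omega> * (6 * \<rho>) ^ ?N)) = (C * \<Gamma> * M * ?\<omega> * 12 ^ ?N) * (\<rho>/2) powr (-\<alpha>)"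
                using \<rho> by simp
              also have "\<dots> \<le> (C * \<Gamma> * M * ?\<omega> * 12 ^ ?N) * (2\<^sup>2 * (2 * (\<rho>/2)) powr (-\<alpha>))"
                by (rule mult_left_mono[OF powr_scale_le]) (use \<rho> \<alpha> C \<Gamma> M in auto)
              also have "\<dots> = T1" unfolding T1_def by simp
              finally show "C * (\<rho>/2) powr (-\<alpha>) / (\<rho>/2) ^ ?N * (\<Gamma> * M * (?\<omega> * (6 * \<rho>) ^ ?N)) \<le> T1" .
            qed simp
            finally show "(\<integral>\<^sup>+p. f (fst p) * ennreal (?near (snd p)) * indicator (?P \<rho> \<times> - ?P (3/2 * \<rho>)) p \<partial>J) \<le> ennreal T1 * (\<integral>\<^sup>+x. f x \<partial>lborel)"
              by (simp add: mult_left_mono)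
          qed
          moreover have "tail_le J ?far (?P \<rho>) (- ?P (3/2 * \<rho>)) T2"
            unfolding tail_le_def
          proof (intro allI impI)
            fix f :: "'a \<Rightarrow> ennreal" assume f[measurable]: "f \<in> borel_measurable borel"
            have "(\<integral>\<^sup>+p. f (fst p) * ennreal (?far (snd p)) * indicator (?P \<rho> \<times> - ?P (3/2 * \<rho>)) p \<partial>J)
               \<le> (\<integral>\<^sup>+p. f (fst p) * ennreal (?wp (snd p)) * indicator (?P \<rho> \<times> - ?P (6 * \<rho>)) p \<partial>J)"
              by (intro nn_integral_mono) (auto split: split_indicator)
            also have "\<dots> \<le> ennreal (C / \<rho> ^ ?N) * ((\<integral>\<^sup>+x. f x \<partial>lborel) *
                 (\<integral>\<^sup>+p. ennreal (?wp (snd p)) * indicator (?P (2 * \<rho>) \<times> - ?P (6 * \<rho>)) p \<partial>J))"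
              by (rule ujs[where g = "\<lambda>x. ennreal (?wp x)"]) (use \<rho> in auto)
            \<comment> \<open>After UJS the inner point ranges over a ball where
              \<open>w \<le> \<Gamma> * M\<close>, so the integrand may be multiplied by \<Gamma> M
              / w >= 1 at that point. This produces the quantity bounded by the second logarithmic
              estimate.\<close>
            also have "(\<integral>\<^sup>+p. ennreal (?wp (snd p)) * indicator (?P (2 * \<rho>) \<times> - ?P (6 * \<rho>)) p \<partial>J)
                \<le> (\<integral>\<^sup>+p. ennreal (\<Gamma> * M) * (ennreal (?wp (snd p) / w (fst p)) * indicator (?P (4 * \<rho>) \<times> - ?P (6 * \<rho>)) p) \<partial>J)"
            proof (rule nn_integral_mono_AE, use AE_fst[OF ub] in \<open>rule AE_mp\<close>, intro AE_I2 impI)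
              fix p :: "'a \<times> 'a" assume a: "fst p \<in> ?P (6 * \<rho>) \<longrightarrow> w (fst p) \<le> \<Gamma> * M"
              show "ennreal (?wp (snd p)) * indicator (?P (2 * \<rho>) \<times> - ?P (6 * \<rho>)) p
                 \<le> ennreal (\<Gamma> * M) * (ennreal (?wp (snd p) / w (fst p)) * indicator (?P (4 * \<rho>) \<times> - ?P (6 * \<rho>)) p)"
              proof (cases "p \<in> ?P (2 * \<rho>) \<times> - ?P (6 * \<rho>)")
                case True
                then have p: "fst p \<in> ?P (6 * \<rho>)" "p \<in> ?P (4 * \<rho>) \<times> - ?P (6 * \<rho>)" using \<rho> by auto
                have wp: "0 < w (fst p)" using loc1(2) p(1) \<tau> by force
                have zz: "z \<le> \<Gamma> * M * (z / w (fst p))" if "0 \<le> z" for z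
                  using mult_right_mono[of "w (fst p)" "\<Gamma> * M" z] a p(1) wp that
                  by (simp add: pos_le_divide_eq mult.commute)
                have "?wp (snd p) \<le> \<Gamma> * M * (?wp (snd p) / w (fst p))" by (rule zz) simp
                then have "ennreal (?wp (snd p)) \<le> ennreal (\<Gamma> * M * (?wp (snd p) / w (fst p)))" by (rule ennreal_leI)
                also have "\<dots> = ennreal (\<Gamma> * M) * ennreal (?wp (snd p) / w (fst p))"
                  using M \<Gamma> wp by (intro ennreal_mult) auto
                finally show ?thesis using True p by simp
              qed simp
            qed
            also have "\<dots> = ennreal (\<Gamma> * M) * (\<integral>\<^sup>+p. ennreal (?wp (snd p) / w (fst p)) * indicator (?P (4 * \<rho>) \<times> - ?P (6 * \<rho>)) p \<partial>J)"
              by (rule nn_integral_cmult) measurable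
            also have "\<dots> \<le> ennreal (\<Gamma> * M) * ennreal (L * \<rho> powr (-\<alpha>) * \<rho> ^ ?N)"
              unfolding L_def
              by (intro mult_left_mono log_estimate(2)[OF w \<rho>(1) loc1(1) \<tau> _ loc1(3)] loc1(2)[rule_format]) auto
            also have "\<dots> = ennreal (\<Gamma> * M * (L * \<rho> powr (-\<alpha>) * \<rho> ^ ?N))"
              using M \<Gamma> L \<rho> by (intro ennreal_mult[symmetric]) auto
            also have "ennreal (C / \<rho> ^ ?N) * ((\<integral>\<^sup>+x. f x \<partial>lborel) * ennreal (\<Gamma> * M * (L * \<rho> powr (-\<alpha>) * \<rho> ^ ?N)))
               = ennreal (C / \<rho> ^ ?N * (\<Gamma> * M * (L * \<rho> powr (-\<alpha>) * \<rho> ^ ?N))) * (\<integral>\<^sup>+x. f x \<partial>lborel)"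
              using C \<rho> M \<Gamma> L by (subst ennreal_mult) (auto simp: mult_ac)
            also have "C / \<rho> ^ ?N * (\<Gamma> * M * (L * \<rho> powr (-\<alpha>) * \<rho> ^ ?N)) = T2"
              unfolding T2_def using \<rho> by simp
            finally show "(\<integral>\<^sup>+p. f (fst p) * ennreal (?far (snd p)) * indicator (?P \<rho> \<times> - ?P (3/2 * \<rho>)) p \<partial>J) \<le> ennreal T2 * (\<integral>\<^sup>+x. f x \<partial>lborel)"
              by (simp add: mult_left_mono)
          qed
          ultimately have t1: "tail_le J (\<lambda>x. max (w x - M / 2) 0) (?P \<rho>) (- ?P (3/2 * \<rho>)) (T1 + T2)"
          proof (rule tail_leI_add[rotated -4])
            show "max (w y - M / 2) 0 \<le> ?near y + ?far y" for y
              using M by (auto split: split_indicator)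
            show "0 \<le> T1" "0 \<le> T2" unfolding T1_def T2_def using C \<Gamma> \<omega> M L by auto
          qed (use sets_J in auto)
          have t2: "T1 + T2 \<le> \<Lambda> * (M / 2) * \<rho> powr (-\<alpha>)"
          proof -
            have "T1 + T2 = (2 * (4 * C * \<Gamma> * ?\<omega> * 12 ^ ?N + C * \<Gamma> * L)) * (M / 2 * \<rho> powr (-\<alpha>))"
              unfolding T1_def T2_def by (simp add: algebra_simps)
            also have "\<dots> \<le> \<Lambda> * (M / 2 * \<rho> powr (-\<alpha>))"
              unfolding \<Lambda>_def using M \<Gamma> \<omega> by (intro mult_right_mono) auto
            finally show ?thesis by (simp add: mult.assoc)
          qed
          show ?thesis by (rule tail_le_subset[OF t1 order_refl order_refl t2]) simp
        qed
      qed (use M in auto)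
      then have "AE x in lborel. x \<notin> W \<inter> ?P (\<rho> / 2)"
        by (rule AE_mp, intro AE_I2 impI) (use lb in force)
      then have "emeasure lborel (W \<inter> ?P (\<rho> / 2)) = 0"
        by (subst (asm) AE_iff_measurable[where N = "W \<inter> ?P (\<rho> / 2)"]) auto
      then show False using x1(2)[of "\<rho> / 2"] \<rho> by simp
    qed
    have meas: "ennreal (\<mu> * ?\<omega> * \<rho> ^ ?N) \<le> emeasure lborel {x\<in>?P \<rho>. M / 2 \<le> w x}" (is "_ \<le> emeasure lborel ?A")
    proof (rule ccontr)
      assume "\<not> ?thesis"
      then have A: "emeasure lborel ?A \<le> ennreal (\<mu> * ?\<omega> * \<rho> ^ ?N)" by simp
      have "(\<integral>\<^sup>+x\<in>?P \<rho>. ennreal ((max (w x - M / 2) 0)\<^sup>2) \<partial>lborel) \<le> (\<integral>\<^sup>+x. ennreal ((\<Gamma> * M)\<^sup>2) * indicator ?A x \<partial>lborel)"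
      proof (rule nn_integral_mono_AE, use ub in \<open>rule AE_mp\<close>, intro AE_I2 impI)
        fix x assume a: "x \<in> ?P (6 * \<rho>) \<longrightarrow> w x \<le> \<Gamma> * M"
        show "ennreal ((max (w x - M / 2) 0)\<^sup>2) * indicator (?P \<rho>) x \<le> ennreal ((\<Gamma> * M)\<^sup>2) * indicator ?A x"
        proof (cases "x \<in> ?A")
          case True
          then have "w x \<le> \<Gamma> * M" using a \<rho> by auto
          then have "(max (w x - M / 2) 0)\<^sup>2 \<le> (\<Gamma> * M)\<^sup>2" using M \<Gamma> by (intro power_mono) auto
          then show ?thesis using True by (auto intro: ennreal_leI)
        next
          case False
          then show ?thesis by (cases "x \<in> ?P \<rho>") auto
        qed
      qed
      also have "\<dots> = ennreal ((\<Gamma> * M)\<^sup>2) * emeasure lborel ?A" by (rule nn_integral_cmult_indicator) measurable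
      also have "\<dots> \<le> ennreal ((\<Gamma> * M)\<^sup>2) * ennreal (\<mu> * ?\<omega> * \<rho> ^ ?N)" by (intro mult_left_mono A) simp
      also have "\<dots> = ennreal ((\<Gamma> * M)\<^sup>2 * (\<mu> * ?\<omega> * \<rho> ^ ?N))" using \<mu> \<rho> by (intro ennreal_mult[symmetric]) auto
      also have "\<dots> \<le> ennreal (\<nu> * (M / 2)\<^sup>2 * \<rho> ^ ?N)"
      proof (rule ennreal_leI)
        have "(\<Gamma> * M)\<^sup>2 * (\<mu> * ?\<omega> * \<rho> ^ ?N) = (\<Gamma>\<^sup>2 * (\<mu> * ?\<omega>)) * (M\<^sup>2 * \<rho> ^ ?N)" by (simp add: power_mult_distrib)
        also have "\<dots> \<le> \<nu> / 4 * (M\<^sup>2 * \<rho> ^ ?N)" by (rule mult_right_mono[OF \<mu>\<nu>]) (use \<rho> in auto)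
        also have "\<dots> = \<nu> * (M / 2)\<^sup>2 * \<rho> ^ ?N" by (simp add: power_divide)
        finally show "(\<Gamma> * M)\<^sup>2 * (\<mu> * ?\<omega> * \<rho> ^ ?N) \<le> \<nu> * (M / 2)\<^sup>2 * \<rho> ^ ?N" .
      qed
      finally show False using big by blast
    qed
    \<comment> \<open>Only the first expansion starts from a fraction \<open>\<mu>\<close> and costs
      \<open>c2\<close>. Afterwards positivity holds almost everywhere on the starting ball, so the
      fraction is 1 and each doubling costs at most \<open>(1/2) ^ D\<close>.\<close>
    have iter: "AE x in lborel. x \<in> ?P (2 ^ Suc j * \<rho>) \<longrightarrow> ((1/2) ^ D) ^ j * (c2 * (M / 2)) \<le> w x"
      if "2 ^ j * \<rho> \<le> 3 * r" for j
      using that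
    proof (induction j)
      case 0
      have "AE x in lborel. x \<in> ?P (2 * \<rho>) \<longrightarrow> c2 * (M / 2) \<le> w x"
        by (rule EP2[rule_format, OF J, unfolded expansion_bound_def, rule_format, OF w \<rho>(1) loc1(1) \<tau> _ loc1(3) _ meas]) (use loc1(2) M in auto)
      then show ?case by simp
    next
      case (Suc j)
      let ?\<rho> = "2 ^ Suc j * \<rho>" and ?k = "((1/2) ^ D) ^ j * (c2 * (M / 2))"
      have \<rho>': "0 < ?\<rho>" using \<rho> by simp
      note loc2 = loc[OF \<rho>' Suc.prems]
      have k: "0 < ?k" using c2 M by simp
      have "2 ^ Suc j * \<rho> = 2 * (2 ^ j * \<rho>)" "0 \<le> 2 ^ j * \<rho>" using \<rho> by auto
      then have "2 ^ j * \<rho> \<le> 3 * r" using Suc.prems by linarith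
      then have IH: "AE x in lborel. x \<in> ?P ?\<rho> \<longrightarrow> ?k \<le> w x" by (rule Suc.IH)
      have "emeasure lborel {x\<in>?P ?\<rho>. ?k \<le> w x} = emeasure lborel (?P ?\<rho>)"
        by (rule emeasure_eq_AE) (use IH in auto)
      then have m: "ennreal (1 * ?\<omega> * ?\<rho> ^ ?N) \<le> emeasure lborel {x\<in>?P ?\<rho>. ?k \<le> w x}"
        using \<rho>' by (simp add: emeasure_ball_eq)
      have "AE x in lborel. x \<in> ?P (2 * ?\<rho>) \<longrightarrow> c1 * ?k \<le> w x"
        by (rule EP1[rule_format, OF J, unfolded expansion_bound_def, rule_format, OF w \<rho>' loc2(1) \<tau> _ loc2(3) k m]) (use loc2(2) in auto)
      then show ?case
      proof (rule AE_mp, intro AE_I2 impI)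
        fix x assume a: "x \<in> ?P (2 * ?\<rho>) \<longrightarrow> c1 * ?k \<le> w x" "x \<in> ?P (2 ^ Suc (Suc j) * \<rho>)"
        have "((1/2) ^ D) ^ Suc j * (c2 * (M / 2)) = (1/2) ^ D * ?k" by simp
        also have "\<dots> \<le> c1 * ?k" by (rule mult_right_mono) (use D k in auto)
        also have "\<dots> \<le> w x" using a by (simp add: mult.assoc)
        finally show "((1/2) ^ D) ^ Suc j * (c2 * (M / 2)) \<le> w x" .
      qed
    qed
    \<comment> \<open>The last admissible doubling. Its target radius exceeds \<open>3 * r\<close>,
      hence that ball contains \<open>ball x\<^sub>0 r\<close>, since \<open>x\<^sub>1\<close> is
      within \<open>2 * r\<close> of \<open>x\<^sub>0\<close>.\<close>
    obtain i where i: "2 ^ i * \<rho> \<le> 3 * r" "3 * r < 2 ^ Suc i * \<rho>"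
    proof -
      obtain n where "3 * r / \<rho> < 2 ^ n" using real_arch_pow[of 2 "3 * r / \<rho>"] by auto
      then have ex: "\<exists>n. 3 * r < 2 ^ n * \<rho>" using \<rho> by (auto simp: divide_less_eq)
      define n' where "n' = (LEAST n. 3 * r < 2 ^ n * \<rho>)"
      have n1: "3 * r < 2 ^ n' * \<rho>" unfolding n'_def by (rule LeastI_ex[OF ex])
      have "n' \<noteq> 0" using n1 \<rho>3 by (cases n') auto
      then obtain i where i: "n' = Suc i" using not0_implies_Suc by blast
      have "\<not> 3 * r < 2 ^ i * \<rho>" using not_less_Least[of i "\<lambda>n. 3 * r < 2 ^ n * \<rho>"] i unfolding n'_def by simp
      then show thesis using that[of i] n1 i by simp
    qed
    \<comment> \<open>The loss of \<open>i\<close> doublings combines with the weight hidden in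
      \<open>M\<close> to a power of \<open>2 ^ i * \<rho>\<close>, which is at most
      \<open>3 * r\<close>: the dependence on \<open>\<rho>\<close> disappears.\<close>
    have fin: "S / r ^ D \<le> \<gamma> * (((1/2) ^ D) ^ i * (c2 * (M / 2)))"
    proof -
      have "(2 ^ i * \<rho>) ^ D \<le> (3 * r) ^ D" using i(1) \<rho> by (intro power_mono) auto
      then have "1 / (3 * r) ^ D \<le> 1 / (2 ^ i * \<rho>) ^ D" using \<rho> r by (intro divide_left_mono) auto
      then have "S / r ^ D \<le> S * 3 ^ D / (2 ^ i * \<rho>) ^ D"
        using S0 mult_left_mono[of "1 / (3 * r) ^ D" "1 / (2 ^ i * \<rho>) ^ D" "S * 3 ^ D"] by (simp add: power_mult_distrib)
      also have "\<dots> = \<gamma> * (((1/2) ^ D) ^ i * (c2 * (M / 2)))"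
      proof -
        have a: "((1/2::real) ^ D) ^ i = 1 / (2 ^ i) ^ D"
          by (metis mult.commute power_mult power_one_over)
        have b: "(72::real) ^ D = 3 ^ D * 24 ^ D" by (simp flip: power_mult_distrib)
        show ?thesis unfolding a \<gamma>_def M_def b power_mult_distrib using c2 \<rho> by simp
      qed
      finally show ?thesis .
    qed
    show "\<exists>M. (AE x in lborel. x \<in> ball x\<^sub>0 r \<longrightarrow> w x \<le> M) \<and> (AE x in lborel. x \<in> ball x\<^sub>0 r \<longrightarrow> M \<le> \<gamma> * w x)"
    proof (intro exI conjI)
      show "AE x in lborel. x \<in> ball x\<^sub>0 r \<longrightarrow> w x \<le> S / r ^ D"
        using gS
      proof (rule AE_mp, intro AE_I2 impI)
        fix x assume a: "x \<in> ?B \<longrightarrow> g x \<le> S" "x \<in> ball x\<^sub>0 r"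
        have xB: "x \<in> ?B" using a(2) r by auto
        have "r ^ D * w x \<le> (2 * r - dist x\<^sub>0 x) ^ D * w x"
          using a(2) r wpos[OF xB] by (intro mult_right_mono power_mono) auto
        also have "\<dots> \<le> S" using a(1) xB unfolding g_def by blast
        finally show "w x \<le> S / r ^ D" using r by (simp add: field_simps)
      qed
      show "AE x in lborel. x \<in> ball x\<^sub>0 r \<longrightarrow> S / r ^ D \<le> \<gamma> * w x"
        using iter[OF i(1)]
      proof (rule AE_mp, intro AE_I2 impI)
        fix x assume a: "x \<in> ?P (2 ^ Suc i * \<rho>) \<longrightarrow> ((1/2) ^ D) ^ i * (c2 * (M / 2)) \<le> w x" "x \<in> ball x\<^sub>0 r"
        have "x \<in> ?P (2 ^ Suc i * \<rho>)"
          using a(2) x10 i(2) dist_triangle[of x\<^sub>1 x x\<^sub>0] by (auto simp: dist_commute)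
        then have "\<gamma> * (((1/2) ^ D) ^ i * (c2 * (M / 2))) \<le> \<gamma> * w x"
          using a(1) \<gamma> by (intro mult_left_mono) auto
        then show "S / r ^ D \<le> \<gamma> * w x" using fin by linarith
      qed
    qed
  qed
qed

section \<open>Measures given by a kernel\<close>

text \<open>Increments ignore constants; only the tail condition needs an argument, and there the
  gap of \<open>R / 8\<close> between the two balls makes the decay estimate applicable.\<close>

lemma weak_sol_add_const:
  assumes J: "jump_form J \<alpha> C E" and w: "weak_sol J E w" and \<tau>: "0 \<le> \<tau>"
  shows "weak_sol J E (\<lambda>x. w x + \<tau>)"
  unfolding weak_sol_def
proof (intro conjI ballI allI impI)
  interpret jump_form J \<alpha> C E by (rule J)
  have wl: "loc_space J E w" using w by (simp add: weak_sol_def)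
  have [measurable]: "w \<in> borel_measurable borel" using wl by (simp add: loc_space_def)
  show "loc_space J E (\<lambda>x. w x + \<tau>)"
    by (rule loc_space_Lipschitz[OF J wl, where F = "\<lambda>s. s + \<tau>" and L = 1]) simp
  show "\<exists>T. tail_le J (\<lambda>y. \<bar>w y + \<tau>\<bar>) (ball x (7/8 * R)) (- ball x R) T"
    if R: "0 < R \<and> ball x R \<subseteq> E" for x R
  proof -
    obtain T where T: "tail_le J (\<lambda>y. \<bar>w y\<bar>) (ball x (7/8 * R)) (- ball x R) T"
      using w R unfolding weak_sol_def by blast
    have far: "R / 8 \<le> dist y z" if "y \<in> ball x (7/8 * R)" "z \<in> - ball x R" for y z
      using that dist_triangle[of x z y] by auto
    have "tail_le J (\<lambda>_. \<tau>) (ball x (7/8 * R)) (- ball x R) (\<tau> * C * (R / 8) powr (-\<alpha>))"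
      by (rule tail_le_const[OF \<tau> _ far]) (use R in auto)
    moreover have "tail_le J (\<lambda>y. \<bar>w y\<bar>) (ball x (7/8 * R)) (- ball x R) \<bar>T\<bar>"
      by (rule tail_le_subset[OF T]) auto
    ultimately have "tail_le J (\<lambda>y. \<bar>w y + \<tau>\<bar>) (ball x (7/8 * R)) (- ball x R) (\<bar>T\<bar> + \<tau> * C * (R / 8) powr (-\<alpha>))"
      using \<tau> C by (intro tail_leI_add[where ?g1.0 = "\<lambda>y. \<bar>w y\<bar>" and ?g2.0 = "\<lambda>_. \<tau>"] sets_J) auto
    then show ?thesis ..
  qed
  fix \<phi> assume "\<phi> \<in> borel_measurable borel" and
    "(\<forall>x. 0 \<le> \<phi> x) \<and> (\<integral>\<^sup>+x. ennreal ((\<phi> x)\<^sup>2) \<partial>lborel) < \<infinity> \<and> form_on J UNIV \<phi> < \<infinity> \<and> closure {x. \<phi> x \<noteq> 0} \<subseteq> E \<and>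
      integrable J (\<lambda>p. (w (fst p) + \<tau> - (w (snd p) + \<tau>)) * (\<phi> (fst p) - \<phi> (snd p)))"
  moreover have "w (fst p) + \<tau> - (w (snd p) + \<tau>) = w (fst p) - w (snd p)" for p by simp
  ultimately show "(LINT p|J. (w (fst p) + \<tau> - (w (snd p) + \<tau>)) * (\<phi> (fst p) - \<phi> (snd p))) = 0"
    using w unfolding weak_sol_def by simp
qed

text \<open>The summands dominate, in this order, the constants for Poincare, decay, the pointwise
  bound of \<open>K_upper\<close> and UJS, so that one constant serves the whole locale
  \<open>jump_form\<close>.\<close>

definition jump_const :: "nat \<Rightarrow> real \<Rightarrow> real \<Rightarrow> real \<Rightarrow> real" where
  "jump_const n C\<^sub>1 C\<^sub>2 c = C\<^sub>1 + C\<^sub>2 + c * C\<^sub>2 * 4 * 2 ^ n / unit_ball_vol n + c / unit_ball_vol n"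

locale symmetric_jump_kernel =
  fixes K :: "'a::euclidean_space \<Rightarrow> 'a \<Rightarrow> real" and \<alpha> C\<^sub>1 C\<^sub>2 c C :: real and E :: "'a set"
  assumes K_nonneg: "\<And>x y. 0 \<le> K x y"
    and K_joint: "(\<lambda>(x, y). K x y) \<in> borel_measurable lebesgue"
    and K_section: "\<And>x. K x \<in> borel_measurable lebesgue"
    and K_sym: "\<And>x y. K x y = K y x"
    and PI: "poincare_inequality (kernel_of K) \<alpha> E C\<^sub>1"
    and DE: "decay_estimate (kernel_of K) \<alpha> C\<^sub>2"
    and UJS: "UJS K c"
    and \<alpha>: "0 < \<alpha>" "\<alpha> < 2" and C1: "1 \<le> C\<^sub>1" and C2: "1 \<le> C\<^sub>2" and c: "0 < c"
    and bounded_E: "bounded E" and C_eq: "C = jump_const DIM('a) C\<^sub>1 C\<^sub>2 c"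
begin

text \<open>\<open>K\<close> is only Lebesgue measurable on the product, so Tonelli's theorem is applied to a Borel
  version \<open>KB\<close>; the hypotheses that hold for every \<open>x\<close> are transferred for almost every \<open>x\<close>.\<close>

definition KB :: "'a \<times> 'a \<Rightarrow> real" where
  "KB = (SOME k. k \<in> borel_measurable borel \<and> (\<forall>p. 0 \<le> k p) \<and> (AE p in lborel. K (fst p) (snd p) = k p))"

lemma KB: "KB \<in> borel_measurable borel" "0 \<le> KB p" "AE p in lborel. K (fst p) (snd p) = KB p"
proof -
  obtain k where k: "k \<in> borel_measurable lborel" "AE p in lborel. (case p of (x, y) \<Rightarrow> K x y) = k p"
    using completion_ex_borel_measurable_real[OF K_joint] by blast
  have "(\<lambda>p. max 0 (k p)) \<in> borel_measurable borel" using k(1) by simp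
  moreover have "AE p in lborel. K (fst p) (snd p) = max 0 (k p)"
    using k(2)
  proof (rule AE_mp, intro AE_I2 impI)
    fix p assume "(case p of (x, y) \<Rightarrow> K x y) = k p"
    then have "K (fst p) (snd p) = k p" by (simp add: case_prod_beta)
    then show "K (fst p) (snd p) = max 0 (k p)" using K_nonneg[of "fst p" "snd p"] by simp
  qed
  ultimately have "\<exists>k. k \<in> borel_measurable borel \<and> (\<forall>p. 0 \<le> k p) \<and> (AE p in lborel. K (fst p) (snd p) = k p)"
    by (intro exI[of _ "\<lambda>p. max 0 (k p)"]) simp
  from someI_ex[OF this, folded KB_def]
  show "KB \<in> borel_measurable borel" "0 \<le> KB p" "AE p in lborel. K (fst p) (snd p) = KB p" by blast+
qed

lemma KB_measurable [measurable]: "KB \<in> borel_measurable (borel \<Otimes>\<^sub>M borel)"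
  using KB(1) by (simp add: borel_prod)

lemma AE_KB_pair: "AE p in lborel \<Otimes>\<^sub>M lborel. K (fst p) (snd p) = KB p"
  using KB(3) unfolding lborel_prod[symmetric] .

lemma AE_KB: "AE x in lborel. AE y in lborel. K x y = KB (x, y)"
  using lborel_pair.AE_pair[OF AE_KB_pair] by simp

text \<open>\<open>KB\<close> is an arbitrary Borel version and need not be symmetric. The symmetry
  of \<open>K\<close> is passed on to it here, almost everywhere, by swapping the product
  measure.\<close>

lemma AE_KB_swap: "AE x in lborel. AE y in lborel. K x y = KB (y, x)"
proof -
  have "AE p in distr (lborel \<Otimes>\<^sub>M lborel) (lborel \<Otimes>\<^sub>M lborel) (\<lambda>(x, y). (y, x)). K (fst p) (snd p) = KB p"
    using AE_KB_pair unfolding lborel_pair.distr_pair_swap[symmetric] .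
  then have "AE p in lborel \<Otimes>\<^sub>M lborel. K (snd p) (fst p) = KB (snd p, fst p)"
    by (drule_tac AE_distrD[rotated]) (auto simp: case_prod_beta measurable_pair_swap')
  then have "AE x in lborel. AE y in lborel. K y x = KB (y, x)"
    using lborel_pair.AE_pair[of "\<lambda>p. K (snd p) (fst p) = KB (snd p, fst p)"] by simp
  then show ?thesis by (simp add: K_sym)
qed

section \<open>The jump measure of a kernel and its two disintegrations\<close>

definition J :: "('a \<times> 'a) measure" where
  "J = density (lborel \<Otimes>\<^sub>M lborel) (\<lambda>p. ennreal (KB p))"

lemma sets_J [measurable_cong]: "sets J = sets (borel \<Otimes>\<^sub>M borel)"
  unfolding J_def by (simp cong: sets_pair_measure_cong)

lemma nn_integral_kernel:
  assumes [measurable]: "g \<in> borel_measurable lebesgue"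
  shows "(\<integral>\<^sup>+y. g y \<partial>kernel_of K x) = (\<integral>\<^sup>+y. ennreal (K x y) * g y \<partial>lborel)"
proof -
  note [measurable] = K_section[of x]
  have "(\<integral>\<^sup>+y. g y \<partial>kernel_of K x) = (\<integral>\<^sup>+y. ennreal (K x y) * g y \<partial>lebesgue)"
    unfolding kernel_of_def by (rule nn_integral_density) measurable
  then show ?thesis by (simp add: nn_integral_completion)
qed

text \<open>\<open>F\<close> is Borel on the product, whereas \<open>G\<close> may be built from the
  original function, which is only Lebesgue measurable: agreement for almost every x and then almost
  every y suffices, because the measures \<mu>(x,dy) have densities.\<close>

lemma nn_integral_J:
  assumes [measurable]: "F \<in> borel_measurable (borel \<Otimes>\<^sub>M borel)"
    and G: "\<And>x. G x \<in> borel_measurable lebesgue" and GF: "AE x in lborel. AE y in lborel. G x y = F (x, y)"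
  shows "(\<integral>\<^sup>+p. F p \<partial>J) = (\<integral>\<^sup>+x. (\<integral>\<^sup>+y. G x y \<partial>kernel_of K x) \<partial>lborel)"
proof -
  have "(\<integral>\<^sup>+p. F p \<partial>J) = (\<integral>\<^sup>+p. ennreal (KB p) * F p \<partial>(lborel \<Otimes>\<^sub>M lborel))"
    unfolding J_def by (rule nn_integral_density) measurable
  also have "\<dots> = (\<integral>\<^sup>+x. \<integral>\<^sup>+y. ennreal (KB (x, y)) * F (x, y) \<partial>lborel \<partial>lborel)"
    by (rule lborel.nn_integral_fst[symmetric]) measurable
  also have "\<dots> = (\<integral>\<^sup>+x. (\<integral>\<^sup>+y. G x y \<partial>kernel_of K x) \<partial>lborel)"
  proof (rule nn_integral_cong_AE, use AE_KB GF in eventually_elim)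
    case (elim x)
    have "(\<integral>\<^sup>+y. G x y \<partial>kernel_of K x) = (\<integral>\<^sup>+y. ennreal (K x y) * G x y \<partial>lborel)"
      by (rule nn_integral_kernel[OF G])
    also have "\<dots> = (\<integral>\<^sup>+y. ennreal (KB (x, y)) * F (x, y) \<partial>lborel)"
      by (rule nn_integral_cong_AE) (use elim in eventually_elim, simp)
    finally show ?case ..
  qed
  finally show ?thesis .
qed

lemma nn_integral_J_borel:
  assumes [measurable]: "F \<in> borel_measurable (borel \<Otimes>\<^sub>M borel)"
  shows "(\<integral>\<^sup>+p. F p \<partial>J) = (\<integral>\<^sup>+x. (\<integral>\<^sup>+y. F (x, y) \<partial>kernel_of K x) \<partial>lborel)"
  by (rule nn_integral_J) (auto intro!: measurable_completion)

text \<open>Here the second variable is the base point of the kernel, thanks to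
  \<open>AE_KB_swap\<close>. Together with \<open>nn_integral_J_borel\<close> this gives the
  invariance of \<open>J\<close> under exchange of variables.\<close>

lemma nn_integral_J_snd:
  assumes [measurable]: "F \<in> borel_measurable (borel \<Otimes>\<^sub>M borel)"
  shows "(\<integral>\<^sup>+p. F p \<partial>J) = (\<integral>\<^sup>+y. (\<integral>\<^sup>+x. F (x, y) \<partial>kernel_of K y) \<partial>lborel)"
proof -
  have "(\<integral>\<^sup>+p. F p \<partial>J) = (\<integral>\<^sup>+p. ennreal (KB p) * F p \<partial>(lborel \<Otimes>\<^sub>M lborel))"
    unfolding J_def by (rule nn_integral_density) measurable
  also have "\<dots> = (\<integral>\<^sup>+y. \<integral>\<^sup>+x. ennreal (KB (x, y)) * F (x, y) \<partial>lborel \<partial>lborel)"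
    by (rule lborel_pair.nn_integral_snd[symmetric]) measurable
  also have "\<dots> = (\<integral>\<^sup>+y. (\<integral>\<^sup>+x. F (x, y) \<partial>kernel_of K y) \<partial>lborel)"
  proof (rule nn_integral_cong_AE, use AE_KB_swap in eventually_elim)
    case (elim y)
    have "(\<integral>\<^sup>+x. F (x, y) \<partial>kernel_of K y) = (\<integral>\<^sup>+x. ennreal (K y x) * F (x, y) \<partial>lborel)"
      by (rule nn_integral_kernel) (auto intro!: measurable_completion)
    also have "\<dots> = (\<integral>\<^sup>+x. ennreal (KB (x, y)) * F (x, y) \<partial>lborel)"
      by (rule nn_integral_cong_AE) (use elim in eventually_elim, simp)
    finally show ?case ..
  qed
  finally show ?thesis .
qed

text \<open>Passing to a Borel representative does not affect the energy, since both the outer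
  measure and \<mu>(x,dy) ignore Lebesgue null sets.\<close>

lemma energy_eq_form_on:
  assumes u: "u \<in> borel_measurable lebesgue" and [measurable]: "v \<in> borel_measurable borel"
    and uv: "AE x in lborel. u x = v x" and D[measurable]: "D \<in> sets borel"
  shows "energy D (kernel_of K) u = form_on J D v"
proof -
  let ?G = "\<lambda>x y. ennreal ((u y - u x) * (u y - u x)) * indicator D y * indicator D x"
  have G: "?G x \<in> borel_measurable lebesgue" for x
  proof -
    note [measurable] = u
    have [measurable]: "D \<in> sets lebesgue" using D by simp
    show ?thesis by measurable
  qed
  have "form_on J D v = (\<integral>\<^sup>+x. (\<integral>\<^sup>+y. ?G x y \<partial>kernel_of K x) \<partial>lborel)"
    unfolding form_on_def
  proof (rule nn_integral_J)
    show "AE x in lborel. AE y in lborel. ?G x y = ennreal ((v (fst (x, y)) - v (snd (x, y)))\<^sup>2) * indicator (D \<times> D) (x, y)"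
      using uv
    proof eventually_elim
      case (elim x)
      show ?case using uv
      proof eventually_elim
        case (elim y)
        then show ?case using \<open>u x = v x\<close> by (simp add: indicator_times power2_eq_square algebra_simps)
      qed
    qed
  qed (use G in measurable)
  also have "\<dots> = (\<integral>\<^sup>+x. (\<integral>\<^sup>+y. ennreal ((u y - u x) * (u y - u x)) * indicator D y \<partial>kernel_of K x) * indicator D x \<partial>lborel)"
    by (intro nn_integral_cong) (auto split: split_indicator)
  also have "\<dots> = energy D (kernel_of K) u"
    unfolding energy_def by (simp add: nn_integral_completion)
  finally show ?thesis ..
qed

section \<open>Consequences of the decay estimate and of UJS\<close>

lemma decay_le:
  assumes "0 < r"
  shows "emeasure (kernel_of K x) (- ball x r) \<le> ennreal (C\<^sub>2 * r powr (-\<alpha>))"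
  using DE assms unfolding decay_estimate_def by blast

text \<open>Symmetry turns the average of K(z,y) over z into that of K(y,z), that is, into \<mu>(y,
  ball x r) divided by the volume, to which the decay estimate at y can be applied.\<close>

lemma K_average:
  assumes "0 < r" "2 * r \<le> dist x y"
  shows "ennreal (K x y) \<le> ennreal (c / (unit_ball_vol DIM('a) * r ^ DIM('a))) * (\<integral>\<^sup>+z\<in>ball x r. ennreal (K y z) \<partial>lborel)"
proof -
  let ?V = "unit_ball_vol DIM('a) * r ^ DIM('a)"
  have V: "0 < ?V" using assms by simp
  have "ennreal (K x y) \<le> ennreal c * ((\<integral>\<^sup>+z\<in>ball x r. ennreal (K z y) \<partial>lebesgue) / emeasure lebesgue (ball x r))"
    using UJS assms unfolding UJS_def dist_norm by auto
  also have "(\<integral>\<^sup>+z\<in>ball x r. ennreal (K z y) \<partial>lebesgue) = (\<integral>\<^sup>+z\<in>ball x r. ennreal (K y z) \<partial>lborel)"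
    unfolding nn_integral_completion by (subst K_sym) simp
  also have "emeasure lebesgue (ball x r) = ennreal ?V"
    using assms by (simp add: emeasure_ball_eq)
  also have "ennreal c * (I / ennreal ?V) = ennreal (c / ?V) * I" for I
  proof -
    have "ennreal (c / ?V) = ennreal c * ennreal (inverse ?V)"
      unfolding divide_inverse
      by (rule ennreal_mult[OF less_imp_le[OF c] less_imp_le[OF positive_imp_inverse_positive[OF V]]])
    then show ?thesis unfolding divide_ennreal_def inverse_ennreal[OF V] by (simp only: mult_ac)
  qed
  finally show ?thesis .
qed

text \<open>\<open>ball x (r/2)\<close> lies outside \<open>ball y (r/2)\<close>, so decay at y
  bounds its \<mu>(y,dz) measure, and UJS converts this into a pointwise bound.\<close>

lemma K_upper:
  assumes r: "0 < r" "r \<le> dist x y"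
  shows "K x y \<le> c * C\<^sub>2 * 4 * 2 ^ DIM('a) / unit_ball_vol DIM('a) * r powr (-\<alpha>) / r ^ DIM('a)"
proof -
  let ?\<omega> = "unit_ball_vol (real DIM('a))"
  have \<omega>: "0 < ?\<omega>" by simp
  have sub: "ball x (r/2) \<subseteq> - ball y (r/2)"
  proof
    fix z assume "z \<in> ball x (r/2)"
    then show "z \<in> - ball y (r/2)" using r dist_triangle[of x y z] by (auto simp: dist_commute)
  qed
  have "(\<integral>\<^sup>+z\<in>ball x (r/2). ennreal (K y z) \<partial>lborel) = (\<integral>\<^sup>+z. indicator (ball x (r/2)) z \<partial>kernel_of K y)"
    by (subst nn_integral_kernel) (auto intro!: measurable_completion)
  also have "\<dots> \<le> (\<integral>\<^sup>+z. indicator (- ball y (r/2)) z \<partial>kernel_of K y)"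
    using sub by (intro nn_integral_mono) (auto split: split_indicator)
  also have "\<dots> = emeasure (kernel_of K y) (- ball y (r/2))"
    by (rule nn_integral_indicator) (simp add: kernel_of_def)
  also have "\<dots> \<le> ennreal (C\<^sub>2 * (r/2) powr (-\<alpha>))" using r by (intro decay_le) simp
  also have "\<dots> \<le> ennreal (C\<^sub>2 * (4 * r powr (-\<alpha>)))"
  proof (intro ennreal_leI mult_left_mono)
    have "(r/2) powr (-\<alpha>) \<le> 2\<^sup>2 * (2 * (r/2)) powr (-\<alpha>)" by (rule powr_scale_le) (use r \<alpha> in auto)
    then show "(r/2) powr (-\<alpha>) \<le> 4 * r powr (-\<alpha>)" by simp
  qed (use C2 in simp)
  finally have I: "(\<integral>\<^sup>+z\<in>ball x (r/2). ennreal (K y z) \<partial>lborel) \<le> ennreal (C\<^sub>2 * (4 * r powr (-\<alpha>)))" .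
  have "ennreal (K x y) \<le> ennreal (c / (?\<omega> * (r/2) ^ DIM('a))) * (\<integral>\<^sup>+z\<in>ball x (r/2). ennreal (K y z) \<partial>lborel)"
    by (rule K_average) (use r in auto)
  also have "\<dots> \<le> ennreal (c / (?\<omega> * (r/2) ^ DIM('a))) * ennreal (C\<^sub>2 * (4 * r powr (-\<alpha>)))"
    by (intro mult_left_mono I) simp
  also have "\<dots> = ennreal (c / (?\<omega> * (r/2) ^ DIM('a)) * (C\<^sub>2 * (4 * r powr (-\<alpha>))))"
    by (rule ennreal_mult[symmetric]) (use c C2 \<omega> r in auto)
  also have "c / (?\<omega> * (r/2) ^ DIM('a)) * (C\<^sub>2 * (4 * r powr (-\<alpha>)))
      = c * C\<^sub>2 * 4 * 2 ^ DIM('a) / ?\<omega> * r powr (-\<alpha>) / r ^ DIM('a)"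
    by (simp add: power_divide)
  finally show ?thesis using c C2 \<omega> r by (subst (asm) ennreal_le_iff) auto
qed

lemma jump_const_ge: "C\<^sub>1 \<le> C" "C\<^sub>2 \<le> C" "c * C\<^sub>2 * 4 * 2 ^ DIM('a) / unit_ball_vol DIM('a) \<le> C"
  "c / unit_ball_vol DIM('a) \<le> C" "1 \<le> C"
proof -
  have "0 < unit_ball_vol (real DIM('a))" by simp
  then have "0 \<le> c * C\<^sub>2 * 4 * 2 ^ DIM('a) / unit_ball_vol DIM('a)" "0 \<le> c / unit_ball_vol DIM('a)" using c C2 by auto
  then show "C\<^sub>1 \<le> C" "C\<^sub>2 \<le> C" "c * C\<^sub>2 * 4 * 2 ^ DIM('a) / unit_ball_vol DIM('a) \<le> C"
    "c / unit_ball_vol DIM('a) \<le> C" "1 \<le> C"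
    unfolding C_eq jump_const_def using C1 C2 by linarith+
qed

lemma H_loc_borel:
  assumes v: "loc_space J E v"
  shows "v \<in> H_loc (kernel_of K) E"
  unfolding H_loc_def
proof (rule CollectI, intro allI impI conjI)
  fix D :: "'a set" assume D: "open D \<and> closure D \<subseteq> E"
  have vm: "v \<in> borel_measurable borel" using v by (simp add: loc_space_def)
  have fin: "(\<integral>\<^sup>+x\<in>D. ennreal ((v x)\<^sup>2) \<partial>lborel) < \<infinity>" "form_on J D v < \<infinity>"
    using v D unfolding loc_space_def by auto
  have vl: "v \<in> borel_measurable lebesgue" using vm by (intro measurable_completion) simp
  have "v \<in> borel_measurable (lebesgue_on D)" using vl by (rule measurable_restrict_space1)
  then show "v \<in> L2_on D" using fin(1) unfolding L2_on_def by (simp add: nn_integral_completion)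
  show "energy D (kernel_of K) v < \<infinity>"
    using fin(2) energy_eq_form_on[OF vl vm AE_I2] D by simp
qed

sublocale jump_form J \<alpha> C E
proof (rule jump_form.intro)
  show "sets J = sets (borel \<Otimes>\<^sub>M borel)" by (rule sets_J)
  show "sigma_finite_measure J"
    unfolding J_def lborel_prod
    by (rule sigma_finite_measure.sigma_finite_iff_density_finite'[OF sigma_finite_lborel, THEN iffD2])
      (use KB(1) in auto)
  show "(\<integral>\<^sup>+p. F (snd p, fst p) \<partial>J) = (\<integral>\<^sup>+p. F p \<partial>J)"
    if [measurable]: "F \<in> borel_measurable (borel \<Otimes>\<^sub>M borel)" for F :: "'a \<times> 'a \<Rightarrow> ennreal"
    by (subst nn_integral_J_borel, measurable, subst nn_integral_J_snd, measurable)
  show "AE p in J. P (fst p)" if P: "AE x in lborel. P x" for P :: "'a \<Rightarrow> bool"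
  proof -
    obtain N where N: "{x. \<not> P x} \<subseteq> N" "emeasure lborel N = 0" "N \<in> sets lborel"
      using P by (auto elim: AE_E)
    have "emeasure (lborel \<Otimes>\<^sub>M lborel) (N \<times> (UNIV :: 'a set)) = 0"
      using N(2,3) by (subst lborel.emeasure_pair_measure_Times) auto
    then have "N \<times> UNIV \<in> null_sets (lborel \<Otimes>\<^sub>M (lborel :: 'a measure))"
      using N(3) by (auto simp: null_sets_def)
    then have "AE p in lborel \<Otimes>\<^sub>M (lborel :: 'a measure). p \<notin> N \<times> UNIV" by (rule AE_not_in)
    then have "AE p in lborel \<Otimes>\<^sub>M (lborel :: 'a measure). P (fst p)"
      by (rule AE_mp, intro AE_I2 impI) (use N(1) in auto)
    then show ?thesis unfolding J_def by (subst AE_density) (auto elim!: AE_mp)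
  qed
  show "bounded E" by (rule bounded_E)
  show "0 < \<alpha>" "\<alpha> < 2" by (rule \<alpha>)+
  show "1 \<le> C" by (rule jump_const_ge)
  show "(\<integral>\<^sup>+p. f (fst p) * indicator {p. r \<le> dist (fst p) (snd p)} p \<partial>J) \<le> ennreal (C * r powr (-\<alpha>)) * (\<integral>\<^sup>+x. f x \<partial>lborel)"
    if [measurable]: "f \<in> borel_measurable borel" and r: "0 < r" for f :: "'a \<Rightarrow> ennreal" and r
  proof -
    have "(\<integral>\<^sup>+p. f (fst p) * indicator {p. r \<le> dist (fst p) (snd p)} p \<partial>J)
        = (\<integral>\<^sup>+x. (\<integral>\<^sup>+y. f x * indicator (- ball x r) y \<partial>kernel_of K x) \<partial>lborel)"
      by (subst nn_integral_J_borel, measurable) (auto intro!: nn_integral_cong split: split_indicator)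
    also have "\<dots> = (\<integral>\<^sup>+x. f x * emeasure (kernel_of K x) (- ball x r) \<partial>lborel)"
      by (intro nn_integral_cong nn_integral_cmult_indicator) (simp add: kernel_of_def)
    also have "\<dots> \<le> (\<integral>\<^sup>+x. f x * ennreal (C * r powr (-\<alpha>)) \<partial>lborel)"
    proof (intro nn_integral_mono mult_left_mono)
      fix x
      have "emeasure (kernel_of K x) (- ball x r) \<le> ennreal (C\<^sub>2 * r powr (-\<alpha>))" by (rule decay_le[OF r])
      also have "\<dots> \<le> ennreal (C * r powr (-\<alpha>))" by (intro ennreal_leI mult_right_mono jump_const_ge) simp
      finally show "emeasure (kernel_of K x) (- ball x r) \<le> ennreal (C * r powr (-\<alpha>))" .
    qed simp
    also have "\<dots> = ennreal (C * r powr (-\<alpha>)) * (\<integral>\<^sup>+x. f x \<partial>lborel)"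
      by (simp add: nn_integral_multc mult.commute)
    finally show ?thesis .
  qed
  show "(\<integral>\<^sup>+p. f (fst p) * g (snd p) * indicator {p. r \<le> dist (fst p) (snd p)} p \<partial>J)
      \<le> ennreal (C * r powr (-\<alpha>) / r ^ DIM('a)) * ((\<integral>\<^sup>+x. f x \<partial>lborel) * (\<integral>\<^sup>+x. g x \<partial>lborel))"
    if [measurable]: "f \<in> borel_measurable borel" "g \<in> borel_measurable borel" and r: "0 < r"
    for f g :: "'a \<Rightarrow> ennreal" and r
  proof -
    let ?b = "ennreal (C * r powr (-\<alpha>) / r ^ DIM('a))"
    have "(\<integral>\<^sup>+p. f (fst p) * g (snd p) * indicator {p. r \<le> dist (fst p) (snd p)} p \<partial>J)
        = (\<integral>\<^sup>+x. (\<integral>\<^sup>+y. f x * g y * indicator (- ball x r) y \<partial>kernel_of K x) \<partial>lborel)"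
      by (subst nn_integral_J_borel, measurable) (auto intro!: nn_integral_cong split: split_indicator)
    also have "\<dots> = (\<integral>\<^sup>+x. (\<integral>\<^sup>+y. ennreal (K x y) * (f x * g y * indicator (- ball x r) y) \<partial>lborel) \<partial>lborel)"
      by (intro nn_integral_cong nn_integral_kernel measurable_completion) measurable
    also have "\<dots> \<le> (\<integral>\<^sup>+x. (\<integral>\<^sup>+y. ?b * f x * g y \<partial>lborel) \<partial>lborel)"
    proof (intro nn_integral_mono)
      fix x y
      show "ennreal (K x y) * (f x * g y * indicator (- ball x r) y) \<le> ?b * f x * g y"
      proof (cases "r \<le> dist x y")
        case True
        have "K x y \<le> c * C\<^sub>2 * 4 * 2 ^ DIM('a) / unit_ball_vol DIM('a) * r powr (-\<alpha>) / r ^ DIM('a)"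
          by (rule K_upper[OF r True])
        also have "\<dots> \<le> C * r powr (-\<alpha>) / r ^ DIM('a)"
          using r by (intro divide_right_mono mult_right_mono jump_const_ge) auto
        finally have "ennreal (K x y) * (f x * g y) \<le> ?b * (f x * g y)" by (intro mult_right_mono ennreal_leI) auto
        then show ?thesis using True by (simp add: mult.assoc)
      qed simp
    qed
    also have "\<dots> = (\<integral>\<^sup>+x. ?b * f x * (\<integral>\<^sup>+y. g y \<partial>lborel) \<partial>lborel)"
      by (intro nn_integral_cong nn_integral_cmult) measurable
    also have "\<dots> = (\<integral>\<^sup>+x. ?b * f x \<partial>lborel) * (\<integral>\<^sup>+y. g y \<partial>lborel)"
      by (rule nn_integral_multc) measurable
    also have "(\<integral>\<^sup>+x. ?b * f x \<partial>lborel) = ?b * (\<integral>\<^sup>+x. f x \<partial>lborel)" by (rule nn_integral_cmult) measurable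
    finally show ?thesis by (simp add: mult.assoc)
  qed
  show "(\<integral>\<^sup>+p. f (fst p) * g (snd p) * indicator (ball x\<^sub>1 \<rho> \<times> - ball x\<^sub>1 (6 * \<rho>)) p \<partial>J)
      \<le> ennreal (C / \<rho> ^ DIM('a)) * ((\<integral>\<^sup>+x. f x \<partial>lborel) *
         (\<integral>\<^sup>+p. g (snd p) * indicator (ball x\<^sub>1 (2 * \<rho>) \<times> - ball x\<^sub>1 (6 * \<rho>)) p \<partial>J))"
    if [measurable]: "f \<in> borel_measurable borel" "g \<in> borel_measurable borel" and \<rho>: "0 < \<rho>"
    for f g :: "'a \<Rightarrow> ennreal" and x\<^sub>1 \<rho>
  proof -
    let ?b = "ennreal (C / \<rho> ^ DIM('a))"
    let ?O = "- ball x\<^sub>1 (6 * \<rho>)" and ?B2 = "ball x\<^sub>1 (2 * \<rho>)"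
    \<comment> \<open>The average over \<open>ball x \<rho>\<close> is enlarged to the ball of
      radius \<open>2 * \<rho>\<close> about \<open>x\<^sub>1\<close>, which does not depend on x;
      the double integral then factorizes into the integral of \<open>f\<close> and an integral over
      y.\<close>
    define H where "H = (\<lambda>y. \<integral>\<^sup>+z\<in>?B2. ennreal (KB (z, y)) \<partial>lborel)"
    have [measurable]: "H \<in> borel_measurable borel" unfolding H_def by measurable
    have HK: "AE y in lborel. (\<integral>\<^sup>+z\<in>?B2. ennreal (K y z) \<partial>lborel) = H y"
      using AE_KB_swap
    proof eventually_elim
      case (elim y)
      show ?case unfolding H_def by (rule nn_integral_cong_AE) (use elim in eventually_elim, simp)
    qed
    have "(\<integral>\<^sup>+p. f (fst p) * g (snd p) * indicator (ball x\<^sub>1 \<rho> \<times> ?O) p \<partial>J)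
        = (\<integral>\<^sup>+x. (\<integral>\<^sup>+y. f x * g y * (indicator (ball x\<^sub>1 \<rho>) x * indicator ?O y) \<partial>kernel_of K x) \<partial>lborel)"
      by (subst nn_integral_J_borel, measurable) (simp add: indicator_times)
    also have "\<dots> = (\<integral>\<^sup>+x. (\<integral>\<^sup>+y. ennreal (K x y) * (f x * g y * (indicator (ball x\<^sub>1 \<rho>) x * indicator ?O y)) \<partial>lborel) \<partial>lborel)"
      by (intro nn_integral_cong nn_integral_kernel measurable_completion) measurable
    also have "\<dots> \<le> (\<integral>\<^sup>+x. (\<integral>\<^sup>+y. ?b * f x * (g y * indicator ?O y * H y) \<partial>lborel) \<partial>lborel)"
    proof (rule nn_integral_mono, rule nn_integral_mono_AE, use HK in eventually_elim)
      case (elim x y)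
      show ?case
      proof (cases "x \<in> ball x\<^sub>1 \<rho> \<and> y \<in> ?O")
        case True
        then have d: "2 * \<rho> \<le> dist x y" using \<rho> dist_triangle[of x\<^sub>1 y x] by auto
        have sub: "ball x \<rho> \<subseteq> ?B2"
        proof
          fix z assume "z \<in> ball x \<rho>"
          then show "z \<in> ?B2" using True dist_triangle[of x\<^sub>1 z x] by auto
        qed
        have "ennreal (K x y) \<le> ennreal (c / (unit_ball_vol DIM('a) * \<rho> ^ DIM('a))) * (\<integral>\<^sup>+z\<in>ball x \<rho>. ennreal (K y z) \<partial>lborel)"
          by (rule K_average[OF \<rho> d])
        also have "\<dots> \<le> ?b * (\<integral>\<^sup>+z\<in>?B2. ennreal (K y z) \<partial>lborel)"
        proof (intro mult_mono ennreal_leI nn_integral_mono)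
          have "c / unit_ball_vol DIM('a) / \<rho> ^ DIM('a) \<le> C / \<rho> ^ DIM('a)"
            using \<rho> by (intro divide_right_mono jump_const_ge) auto
          then show "c / (unit_ball_vol DIM('a) * \<rho> ^ DIM('a)) \<le> C / \<rho> ^ DIM('a)" by simp
        qed (use sub in \<open>auto split: split_indicator\<close>)
        finally have "ennreal (K x y) \<le> ?b * H y" unfolding elim .
        then have "ennreal (K x y) * (f x * g y) \<le> ?b * H y * (f x * g y)" by (rule mult_right_mono) simp
        then show ?thesis using True by (simp add: mult_ac)
      qed auto
    qed
    also have "\<dots> = (\<integral>\<^sup>+x. ?b * f x * (\<integral>\<^sup>+y. g y * indicator ?O y * H y \<partial>lborel) \<partial>lborel)"
      by (intro nn_integral_cong nn_integral_cmult) measurable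
    also have "\<dots> = (\<integral>\<^sup>+x. ?b * f x \<partial>lborel) * (\<integral>\<^sup>+y. g y * indicator ?O y * H y \<partial>lborel)"
      by (rule nn_integral_multc) measurable
    also have "(\<integral>\<^sup>+x. ?b * f x \<partial>lborel) = ?b * (\<integral>\<^sup>+x. f x \<partial>lborel)" by (rule nn_integral_cmult) measurable
    also have "(\<integral>\<^sup>+y. g y * indicator ?O y * H y \<partial>lborel) = (\<integral>\<^sup>+p. g (snd p) * indicator (?B2 \<times> ?O) p \<partial>J)"
    proof -
      have "(\<integral>\<^sup>+p. g (snd p) * indicator (?B2 \<times> ?O) p \<partial>J)
          = (\<integral>\<^sup>+y. (\<integral>\<^sup>+x. g y * indicator ?O y * indicator ?B2 x \<partial>kernel_of K y) \<partial>lborel)"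
        by (subst nn_integral_J_snd, measurable) (simp add: indicator_times mult_ac)
      also have "\<dots> = (\<integral>\<^sup>+y. g y * indicator ?O y * H y \<partial>lborel)"
      proof (rule nn_integral_cong_AE, use HK in eventually_elim)
        case (elim y)
        have "(\<integral>\<^sup>+x. g y * indicator ?O y * indicator ?B2 x \<partial>kernel_of K y)
            = g y * indicator ?O y * (\<integral>\<^sup>+x. indicator ?B2 x \<partial>kernel_of K y)"
          by (rule nn_integral_cmult) (auto simp: kernel_of_def intro!: borel_measurable_indicator)
        also have "(\<integral>\<^sup>+x. indicator ?B2 x \<partial>kernel_of K y) = (\<integral>\<^sup>+z\<in>?B2. ennreal (K y z) \<partial>lborel)"
          by (rule nn_integral_kernel) (auto intro!: measurable_completion)
        finally show ?case unfolding elim .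
      qed
      finally show ?thesis ..
    qed
    finally show ?thesis by (simp add: mult.assoc)
  qed
  show "\<exists>a::real. (\<integral>\<^sup>+x\<in>ball x\<^sub>1 \<rho>. ennreal ((v x - a)\<^sup>2) \<partial>lborel) \<le> ennreal (C * \<rho> powr \<alpha>) * form_on J (ball x\<^sub>1 \<rho>) v"
    if \<rho>: "0 < \<rho>" and B: "ball x\<^sub>1 \<rho> \<subseteq> E" and v: "loc_space J E v" for x\<^sub>1 \<rho> and v :: "'a \<Rightarrow> real"
  proof -
    have vm: "v \<in> borel_measurable borel" using v by (simp add: loc_space_def)
    have vl: "v \<in> borel_measurable lebesgue" using vm by (intro measurable_completion) simp
    have "(\<integral>\<^sup>+x\<in>ball x\<^sub>1 \<rho>. ennreal ((v x - avg_on (ball x\<^sub>1 \<rho>) v)\<^sup>2) \<partial>lebesgue) \<le> ennreal (C\<^sub>1 * \<rho> powr \<alpha>) * energy (ball x\<^sub>1 \<rho>) (kernel_of K) v"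
      using PI \<rho> B H_loc_borel[OF v] unfolding poincare_inequality_def by blast
    also have "energy (ball x\<^sub>1 \<rho>) (kernel_of K) v = form_on J (ball x\<^sub>1 \<rho>) v"
      by (rule energy_eq_form_on[OF vl vm]) auto
    also have "ennreal (C\<^sub>1 * \<rho> powr \<alpha>) * form_on J (ball x\<^sub>1 \<rho>) v \<le> ennreal (C * \<rho> powr \<alpha>) * form_on J (ball x\<^sub>1 \<rho>) v"
      by (intro mult_right_mono ennreal_leI jump_const_ge) auto
    finally show ?thesis unfolding nn_integral_completion ..
  qed
qed

end

section \<open>From local weak solutions for the kernel to weak solutions for the jump
  measure\<close>

context symmetric_jump_kernel
begin

lemma sets_kernel_of [measurable_cong]: "sets (kernel_of K x) = sets lebesgue"
  unfolding kernel_of_def by simp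

text \<open>A bound for every single x in \<open>A\<close> is integrated against \<open>f\<close>.
  The integrand may be a Lebesgue measurable \<open>u\<close>, while the conclusion concerns its
  Borel version \<open>g\<close>.\<close>

lemma tail_leI_kernel:
  fixes u g :: "'a \<Rightarrow> real"
  assumes u: "u \<in> borel_measurable lebesgue" and [measurable]: "g \<in> borel_measurable borel"
    and ug: "AE x in lborel. u x = g x" and A: "A \<in> sets borel" and B: "B \<in> sets borel"
    and T: "\<And>x. x \<in> A \<Longrightarrow> (\<integral>\<^sup>+y\<in>B. ennreal (u y) \<partial>kernel_of K x) \<le> ennreal T"
  shows "tail_le J g A B T"
  unfolding tail_le_def
proof (intro allI impI)
  fix f :: "'a \<Rightarrow> ennreal" assume [measurable]: "f \<in> borel_measurable borel"
  note [measurable] = A B u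
  have [measurable]: "B \<in> sets lebesgue" using B by simp
  have "(\<integral>\<^sup>+p. f (fst p) * ennreal (g (snd p)) * indicator (A \<times> B) p \<partial>J)
      = (\<integral>\<^sup>+x. (\<integral>\<^sup>+y. f x * indicator A x * (ennreal (u y) * indicator B y) \<partial>kernel_of K x) \<partial>lborel)"
  proof (rule nn_integral_J)
    show "AE x in lborel. AE y in lborel. f x * indicator A x * (ennreal (u y) * indicator B y)
        = f (fst (x, y)) * ennreal (g (snd (x, y))) * indicator (A \<times> B) (x, y)"
    proof (rule AE_I2)
      fix x
      show "AE y in lborel. f x * indicator A x * (ennreal (u y) * indicator B y)
        = f (fst (x, y)) * ennreal (g (snd (x, y))) * indicator (A \<times> B) (x, y)"
        using ug by eventually_elim (simp add: indicator_times mult_ac)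
    qed
  qed measurable
  also have "\<dots> = (\<integral>\<^sup>+x. f x * indicator A x * (\<integral>\<^sup>+y\<in>B. ennreal (u y) \<partial>kernel_of K x) \<partial>lborel)"
    by (intro nn_integral_cong nn_integral_cmult) measurable
  also have "\<dots> \<le> (\<integral>\<^sup>+x. f x * ennreal T \<partial>lborel)"
    by (intro nn_integral_mono) (auto split: split_indicator intro!: mult_left_mono T)
  also have "\<dots> = ennreal T * (\<integral>\<^sup>+x. f x \<partial>lborel)"
    unfolding mult.commute[of _ "ennreal T"] by (rule nn_integral_cmult) measurable
  finally show "(\<integral>\<^sup>+p. f (fst p) * ennreal (g (snd p)) * indicator (A \<times> B) p \<partial>J) \<le> ennreal T * (\<integral>\<^sup>+x. f x \<partial>lborel)" .
qed

text \<open>Joint integrability over \<open>J\<close> permits Fubini, so the iterated integral is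
  the true bilinear form and not affected by default values. The inner integral agrees with a Borel
  function only almost everywhere; completeness of Lebesgue measure makes it measurable.\<close>

lemma energy_form_eq_integral:
  assumes u: "u \<in> borel_measurable lebesgue" and [measurable]: "w \<in> borel_measurable borel"
    and uw: "AE x in lborel. u x = w x" and [measurable]: "\<phi> \<in> borel_measurable borel"
    and int: "integrable J (\<lambda>p. (w (fst p) - w (snd p)) * (\<phi> (fst p) - \<phi> (snd p)))"
  shows "energy_form UNIV (kernel_of K) u \<phi> = (LINT p|J. (w (fst p) - w (snd p)) * (\<phi> (fst p) - \<phi> (snd p)))"
proof -
  let ?P = "\<lambda>p. (w (fst p) - w (snd p)) * (\<phi> (fst p) - \<phi> (snd p))"
  let ?M = "lborel \<Otimes>\<^sub>M lborel :: ('a \<times> 'a) measure"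
  define \<psi> where "\<psi> = (\<lambda>x. LINT y|lborel. KB (x, y) * ?P (x, y))"
  define \<Phi> where "\<Phi> = (\<lambda>x. LINT y|kernel_of K x. (u y - u x) * (\<phi> y - \<phi> x))"
  have [measurable]: "\<psi> \<in> borel_measurable borel"
    unfolding \<psi>_def by measurable
  have int': "integrable ?M (\<lambda>p. KB p * ?P p)"
    using int unfolding J_def by (subst (asm) integrable_density) (auto simp: KB(2))
  have "(LINT p|J. ?P p) = (LINT p|?M. KB p * ?P p)"
    unfolding J_def by (subst integral_density) (auto simp: KB(2))
  also have "\<dots> = (LINT x|lborel. \<psi> x)"
    unfolding \<psi>_def by (rule lborel_pair.integral_fst'[OF int', symmetric])
  finally have 1: "(LINT p|J. ?P p) = (LINT x|lborel. \<psi> x)" .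
  have ae: "AE x in lborel. \<psi> x = \<Phi> x"
    using AE_KB uw
  proof eventually_elim
    case (elim x)
    have "(\<lambda>y. KB (x, y) * ((w x - w y) * (\<phi> x - \<phi> y))) \<in> borel_measurable borel" by measurable
    then have KBP: "(\<lambda>y. KB (x, y) * ?P (x, y)) \<in> borel_measurable lborel" by simp
    note [measurable] = u K_section[of x]
    have [measurable]: "\<phi> \<in> borel_measurable lebesgue" by (rule measurable_completion) simp
    have "\<Phi> x = (LINT y|lebesgue. K x y * ((u y - u x) * (\<phi> y - \<phi> x)))"
      unfolding \<Phi>_def kernel_of_def by (subst integral_density) (auto simp: K_nonneg)
    also have "\<dots> = (LINT y|lebesgue. KB (x, y) * ?P (x, y))"
    proof (rule integral_cong_AE)
      show "(\<lambda>y. KB (x, y) * ?P (x, y)) \<in> borel_measurable lebesgue"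
        by (rule measurable_completion[OF KBP])
      have "AE y in lborel. K x y * ((u y - u x) * (\<phi> y - \<phi> x)) = KB (x, y) * ?P (x, y)"
        using elim(1) uw by eventually_elim (use elim(2) in \<open>simp add: algebra_simps\<close>)
      then show "AE y in lebesgue. K x y * ((u y - u x) * (\<phi> y - \<phi> x)) = KB (x, y) * ?P (x, y)"
        by (rule AE_completion)
    qed measurable
    also have "\<dots> = \<psi> x" unfolding \<psi>_def by (rule integral_completion[OF KBP])
    finally show ?case ..
  qed
  have \<psi>l: "\<psi> \<in> borel_measurable lebesgue" by (rule measurable_completion) simp
  have "energy_form UNIV (kernel_of K) u \<phi> = (LINT x|lebesgue. \<Phi> x)"
    unfolding energy_form_def \<Phi>_def set_lebesgue_integral_def by simp
  also have "\<dots> = (LINT x|lebesgue. \<psi> x)"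
  proof (rule integral_cong_AE)
    show "\<Phi> \<in> borel_measurable lebesgue" by (rule borel_measurable_AE[OF \<psi>l AE_completion[OF ae]])
    show "AE x in lebesgue. \<Phi> x = \<psi> x" using AE_completion[OF ae] by eventually_elim simp
  qed (rule \<psi>l)
  also have "\<dots> = (LINT x|lborel. \<psi> x)" by (rule integral_completion) simp
  finally show ?thesis using 1 by simp
qed

lemma weak_sol_local_weak_solution:
  assumes u: "local_weak_solution (kernel_of K) E u" and w[measurable]: "w \<in> borel_measurable borel"
    and uw: "AE x in lborel. u x = w x"
  shows "weak_sol J E w"
  unfolding weak_sol_def
proof (intro conjI allI ballI impI)
  have um: "u \<in> borel_measurable lebesgue" and uH: "u \<in> H_loc (kernel_of K) E" and ut: "finite_tails (kernel_of K) E u"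
    and sub: "\<And>\<phi>. \<phi> \<in> test_functions (kernel_of K) E \<Longrightarrow> energy_form UNIV (kernel_of K) u \<phi> \<le> 0"
    and super: "\<And>\<phi>. \<phi> \<in> test_functions (kernel_of K) E \<Longrightarrow> energy_form UNIV (kernel_of K) u \<phi> \<ge> 0"
    using u unfolding local_weak_solution_def local_weak_subsolution_def local_weak_supersolution_def by auto
  show "loc_space J E w"
    unfolding loc_space_def
  proof (intro conjI allI impI w)
    fix D :: "'a set" assume D: "open D \<and> closure D \<subseteq> E"
    then have uD: "u \<in> L2_on D" "energy D (kernel_of K) u < \<infinity>" using uH unfolding H_loc_def by auto
    have "(\<integral>\<^sup>+x\<in>D. ennreal ((w x)\<^sup>2) \<partial>lborel) = (\<integral>\<^sup>+x\<in>D. ennreal ((u x)\<^sup>2) \<partial>lborel)"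
      by (rule nn_integral_cong_AE) (use uw in eventually_elim, simp)
    then show "(\<integral>\<^sup>+x\<in>D. ennreal ((w x)\<^sup>2) \<partial>lborel) < \<infinity>"
      using uD(1) unfolding L2_on_def by (simp add: nn_integral_completion)
    show "form_on J D w < \<infinity>" using energy_eq_form_on[OF um w uw] uD(2) D by simp
  qed
  show "\<exists>T. tail_le J (\<lambda>y. \<bar>w y\<bar>) (ball x (7/8 * R)) (- ball x R) T"
    if R: "0 < R \<and> ball x R \<subseteq> E" for x R
  proof -
    define S where "S = (SUP x'\<in>ball x (7/8 * R). \<integral>\<^sup>+y\<in>- ball x R. ennreal \<bar>u y\<bar> \<partial>kernel_of K x')"
    have "S < \<infinity>" using ut R unfolding finite_tails_def S_def by blast
    then have S: "ennreal (enn2real S) = S" by simp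
    have "tail_le J (\<lambda>y. \<bar>w y\<bar>) (ball x (7/8 * R)) (- ball x R) (enn2real S)"
    proof (rule tail_leI_kernel[where u = "\<lambda>y. \<bar>u y\<bar>"])
      show "(\<integral>\<^sup>+y\<in>- ball x R. ennreal \<bar>u y\<bar> \<partial>kernel_of K x') \<le> ennreal (enn2real S)" if "x' \<in> ball x (7/8 * R)" for x'
        unfolding S unfolding S_def using that by (rule SUP_upper)
      show "AE y in lborel. \<bar>u y\<bar> = \<bar>w y\<bar>" using uw by eventually_elim simp
    qed (use um in auto)
    then show ?thesis ..
  qed
  fix \<phi> assume \<phi>[measurable]: "\<phi> \<in> borel_measurable borel" and a: "(\<forall>x. 0 \<le> \<phi> x) \<and> (\<integral>\<^sup>+x. ennreal ((\<phi> x)\<^sup>2) \<partial>lborel) < \<infinity> \<and>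
        form_on J UNIV \<phi> < \<infinity> \<and> closure {x. \<phi> x \<noteq> 0} \<subseteq> E \<and>
        integrable J (\<lambda>p. (w (fst p) - w (snd p)) * (\<phi> (fst p) - \<phi> (snd p)))"
  have \<phi>l: "\<phi> \<in> borel_measurable lebesgue" by (rule measurable_completion) simp
  have "\<phi> \<in> L2_on UNIV"
    using a measurable_restrict_space1[OF \<phi>l, of UNIV] unfolding L2_on_def by (simp add: nn_integral_completion)
  moreover have "energy UNIV (kernel_of K) \<phi> < \<infinity>"
    using energy_eq_form_on[OF \<phi>l \<phi> AE_I2, of UNIV] a by simp
  ultimately have "\<phi> \<in> test_functions (kernel_of K) E"
    using a unfolding test_functions_def H_space_def by simp
  then have "energy_form UNIV (kernel_of K) u \<phi> = 0" using sub[of \<phi>] super[of \<phi>] by linarith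
  then show "(LINT p|J. (w (fst p) - w (snd p)) * (\<phi> (fst p) - \<phi> (snd p))) = 0"
    using energy_form_eq_integral[OF um w uw \<phi>] a by simp
qed

end

section \<open>Essential extrema and Harnack's inequality for kernels\<close>

lemma ess_sup_on_le:
  fixes u :: "'a::euclidean_space \<Rightarrow> real"
  assumes u: "u \<in> borel_measurable lebesgue" and A: "A \<in> sets lebesgue"
    and le: "AE x in lborel. x \<in> A \<longrightarrow> u x \<le> M"
  shows "ess_sup_on A u \<le> ereal M"
  unfolding ess_sup_on_def
proof (rule esssup_I)
  have "u \<in> borel_measurable (lebesgue_on A)" using u by (rule measurable_restrict_space1)
  then show "(\<lambda>x. ereal (u x)) \<in> borel_measurable (lebesgue_on A)" by simp
  show "AE x in lebesgue_on A. ereal (u x) \<le> ereal M"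
    using AE_completion[OF le] A by (subst AE_restrict_space_iff) auto
qed

lemma ess_inf_on_ge:
  fixes u :: "'a::euclidean_space \<Rightarrow> real"
  assumes u: "u \<in> borel_measurable lebesgue" and A: "A \<in> sets lebesgue"
    and ge: "AE x in lborel. x \<in> A \<longrightarrow> m \<le> u x"
  shows "ereal m \<le> ess_inf_on A u"
proof -
  have "ess_sup_on A (\<lambda>x. - u x) \<le> ereal (- m)"
    by (rule ess_sup_on_le) (use u A ge in auto)
  then have "esssup (lebesgue_on A) (\<lambda>x. - ereal (u x)) \<le> - ereal m"
    unfolding ess_sup_on_def by simp
  then have "- (- ereal m) \<le> - esssup (lebesgue_on A) (\<lambda>x. - ereal (u x))"
    by (rule ereal_minus_le_minus[THEN iffD2])
  then show ?thesis unfolding ess_inf_on_def by (simp only: ereal_uminus_uminus)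
qed

theorem theorem1p3:
  fixes \<alpha> C\<^sub>1 C\<^sub>2 c :: real
  assumes "CARD('n::finite) \<ge> 2"
    and "0 < \<alpha>" and "\<alpha> < 2" and "C\<^sub>1 \<ge> 1" and "C\<^sub>2 \<ge> 1" and "c > 0"
  shows "\<exists>\<gamma>>1. \<forall>(E :: (real^'n) set) (K :: real^'n \<Rightarrow> real^'n \<Rightarrow> real)
           (u :: real^'n \<Rightarrow> real) (x\<^sub>0 :: real^'n) (R :: real) (r :: real).
      open E \<and> connected E \<and> E \<noteq> {} \<and> bounded E \<and>
      (\<forall>x y. 0 \<le> K x y) \<and>
      (\<lambda>(x, y). K x y) \<in> borel_measurable lebesgue \<and>
      (\<forall>x. K x \<in> borel_measurable lebesgue) \<and>
      (\<forall>x y. K x y = K y x) \<and>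
      symmetric_kernel (kernel_of K) \<and>
      poincare_inequality (kernel_of K) \<alpha> E C\<^sub>1 \<and>
      decay_estimate (kernel_of K) \<alpha> C\<^sub>2 \<and>
      UJS K c \<and>
      ball x\<^sub>0 R \<subseteq> E \<and>
      local_weak_solution (kernel_of K) E u \<and>
      (AE x in lebesgue. x \<in> ball x\<^sub>0 R \<longrightarrow> 0 \<le> u x) \<and>
      0 < r \<and> r < R / 32
      \<longrightarrow>
      ess_sup_on (ball x\<^sub>0 r) u
        \<le> ereal \<gamma> * ess_inf_on (ball x\<^sub>0 r) u
          + ereal \<gamma> * ereal ((r / R) powr \<alpha>)
              * enn2ereal (Tail (kernel_of K) \<alpha> (\<lambda>y. ennreal (neg_part u y)) x\<^sub>0 (7/8 * R) R)"
proof -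
  let ?C = "jump_const DIM(real^'n) C\<^sub>1 C\<^sub>2 c"
  have \<omega>: "0 < unit_ball_vol (real DIM(real^'n))" by simp
  then have "0 \<le> c * C\<^sub>2 * 4 * 2 ^ DIM(real^'n) / unit_ball_vol DIM(real^'n)"
    "0 \<le> c / unit_ball_vol DIM(real^'n)"
    using assms(5,6) by simp_all
  then have C: "1 \<le> ?C" unfolding jump_const_def using assms(4,5) by linarith
  obtain \<gamma> where \<gamma>: "1 < \<gamma>" and H: "\<forall>(J :: ((real^'n) \<times> (real^'n)) measure) E w x\<^sub>0 r \<tau>.
      jump_form J \<alpha> ?C E \<longrightarrow> weak_sol J E w \<longrightarrow> 0 < r \<longrightarrow> ball x\<^sub>0 (28 * r) \<subseteq> E \<longrightarrow> 0 < \<tau> \<longrightarrow>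
      (\<forall>x\<in>ball x\<^sub>0 (28 * r). \<tau> \<le> w x) \<longrightarrow>
      tail_le J (\<lambda>y. max (- w y) 0) (ball x\<^sub>0 (28 * r)) UNIV (\<tau> * r powr (-\<alpha>)) \<longrightarrow>
      (\<exists>M. (AE x in lborel. x \<in> ball x\<^sub>0 r \<longrightarrow> w x \<le> M) \<and> (AE x in lborel. x \<in> ball x\<^sub>0 r \<longrightarrow> M \<le> \<gamma> * w x))"
    by (rule harnack_abstract[where 'a = "real^'n", OF assms(2,3) C]) (rule that)
  show ?thesis
  proof (rule exI[of _ \<gamma>], intro conjI \<gamma> allI impI)
    fix E :: "(real^'n) set" and K :: "real^'n \<Rightarrow> real^'n \<Rightarrow> real" and u x\<^sub>0 and R r :: real
    assume "open E \<and> connected E \<and> E \<noteq> {} \<and> bounded E \<and>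
      (\<forall>x y. 0 \<le> K x y) \<and>
      (\<lambda>(x, y). K x y) \<in> borel_measurable lebesgue \<and>
      (\<forall>x. K x \<in> borel_measurable lebesgue) \<and>
      (\<forall>x y. K x y = K y x) \<and>
      symmetric_kernel (kernel_of K) \<and>
      poincare_inequality (kernel_of K) \<alpha> E C\<^sub>1 \<and>
      decay_estimate (kernel_of K) \<alpha> C\<^sub>2 \<and>
      UJS K c \<and>
      ball x\<^sub>0 R \<subseteq> E \<and>
      local_weak_solution (kernel_of K) E u \<and>
      (AE x in lebesgue. x \<in> ball x\<^sub>0 R \<longrightarrow> 0 \<le> u x) \<and>
      0 < r \<and> r < R / 32"
    then have E: "bounded E" and K: "\<And>x y. 0 \<le> K x y" "(\<lambda>(x, y). K x y) \<in> borel_measurable lebesgue"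
        "\<And>x. K x \<in> borel_measurable lebesgue" "\<And>x y. K x y = K y x"
        "poincare_inequality (kernel_of K) \<alpha> E C\<^sub>1" "decay_estimate (kernel_of K) \<alpha> C\<^sub>2" "UJS K c"
      and BE: "ball x\<^sub>0 R \<subseteq> E" and u: "local_weak_solution (kernel_of K) E u"
      and u0: "AE x in lebesgue. x \<in> ball x\<^sub>0 R \<longrightarrow> 0 \<le> u x" and r: "0 < r" "r < R / 32"
      by auto
    interpret symmetric_jump_kernel K \<alpha> C\<^sub>1 C\<^sub>2 c ?C E
      by (rule symmetric_jump_kernel.intro[OF K assms(2-6) E refl])
    have R: "0 < R" using r by simp
    have um: "u \<in> borel_measurable lebesgue" and ut: "finite_tails (kernel_of K) E u"
      using u unfolding local_weak_solution_def local_weak_subsolution_def by auto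
    obtain u' where [measurable]: "u' \<in> borel_measurable borel" and u': "AE x in lborel. u x = u' x"
      using completion_ex_borel_measurable_real[OF um] by auto
    \<comment> \<open>The abstract result asks for a lower bound at every point of the ball, while
      \<open>u\<close> is non-negative only almost everywhere; the truncation alters the Borel
      version on a null set.\<close>
    define v where "v = (\<lambda>x. if x \<in> ball x\<^sub>0 R then max (u' x) 0 else u' x)"
    have [measurable]: "v \<in> borel_measurable borel" unfolding v_def by measurable
    have u0': "AE x in lborel. x \<in> ball x\<^sub>0 R \<longrightarrow> 0 \<le> u x" using u0 by (simp add: AE_completion_iff)
    have uv: "AE x in lborel. u x = v x"
      using u' u0' by eventually_elim (auto simp: v_def)
    have v: "weak_sol J E v" by (rule weak_sol_local_weak_solution[OF u _ uv]) simp
    define S where "S = (SUP x\<in>ball x\<^sub>0 (7/8 * R). \<integral>\<^sup>+y\<in>- ball x\<^sub>0 R. ennreal (neg_part u y) \<partial>kernel_of K x)"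
    have "S \<le> (SUP x\<in>ball x\<^sub>0 (7/8 * R). \<integral>\<^sup>+y\<in>- ball x\<^sub>0 R. ennreal \<bar>u y\<bar> \<partial>kernel_of K x)"
      unfolding S_def by (intro SUP_mono' nn_integral_mono mult_right_mono ennreal_leI) (auto simp: neg_part_def)
    also have "\<dots> < \<infinity>" using ut R BE unfolding finite_tails_def by blast
    finally have "S < \<infinity>" .
    then obtain s where s: "S = ennreal s" "0 \<le> s" by (cases S rule: ennreal_cases) auto
    \<comment> \<open>Equal to (r/R)^\<alpha> times the tail, as the factor R^\<alpha> in
      \<open>Tail\<close> cancels.\<close>
    define \<Theta> where "\<Theta> = r powr \<alpha> * s"
    have \<Theta>: "0 \<le> \<Theta>" unfolding \<Theta>_def using s by simp
    have tail: "ereal \<gamma> * ereal ((r / R) powr \<alpha>) * enn2ereal (Tail (kernel_of K) \<alpha> (\<lambda>y. ennreal (neg_part u y)) x\<^sub>0 (7/8 * R) R) = ereal (\<gamma> * \<Theta>)"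
    proof -
      have "Tail (kernel_of K) \<alpha> (\<lambda>y. ennreal (neg_part u y)) x\<^sub>0 (7/8 * R) R = ennreal (R powr \<alpha> * s)"
        unfolding Tail_def S_def[symmetric] s(1) using s(2) by (simp add: ennreal_mult)
      moreover have "(r / R) powr \<alpha> * (R powr \<alpha> * s) = \<Theta>"
        unfolding \<Theta>_def using r R by (simp add: powr_divide)
      ultimately show ?thesis using s(2) by (simp add: enn2ereal_ennreal mult.assoc)
    qed
    let ?B = "ball x\<^sub>0 r"
    \<comment> \<open>The shift must be strictly positive for the test function \<eta>^2/u, but
      \<open>\<Theta>\<close> may be 0; hence any \<open>\<tau> > \<Theta>\<close> is used, and a
      limit is taken at the end.\<close>
    have main: "ess_sup_on ?B u \<le> ereal \<gamma> * ess_inf_on ?B u + ereal (\<gamma> * \<tau>)" if \<tau>: "\<Theta> < \<tau>" for \<tau>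
    proof -
      have \<tau>0: "0 < \<tau>" using \<tau> \<Theta> by simp
      define w where "w = (\<lambda>x. v x + \<tau>)"
      have w: "weak_sol J E w" unfolding w_def
        by (rule weak_sol_add_const[OF jump_form_axioms v]) (use \<tau>0 in simp)
      have sub: "ball x\<^sub>0 (28 * r) \<subseteq> ball x\<^sub>0 (7/8 * R)" "ball x\<^sub>0 (28 * r) \<subseteq> ball x\<^sub>0 R" using r by auto
      \<comment> \<open>Inside \<open>ball x\<^sub>0 R\<close> the negative part is replaced by 0,
        so that the integral over the whole space reduces to the exterior one in
        \<open>Tail\<close>, with no contribution from the null set where \<open>u\<close> might be
        negative.\<close>
      have "tail_le J (\<lambda>y. max (- v y) 0) (ball x\<^sub>0 (7/8 * R)) UNIV s"
      proof (rule tail_leI_kernel[where u = "\<lambda>y. if y \<in> ball x\<^sub>0 R then 0 else neg_part u y"])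
        have [measurable]: "ball x\<^sub>0 R \<in> sets lebesgue" by simp
        show "(\<lambda>y. if y \<in> ball x\<^sub>0 R then 0 else neg_part u y) \<in> borel_measurable lebesgue"
          unfolding neg_part_def using um by measurable
        show "AE y in lborel. (if y \<in> ball x\<^sub>0 R then 0 else neg_part u y) = max (- v y) 0"
          using u' by eventually_elim (auto simp: v_def neg_part_def)
        show "(\<integral>\<^sup>+y\<in>UNIV. ennreal (if y \<in> ball x\<^sub>0 R then 0 else neg_part u y) \<partial>kernel_of K x) \<le> ennreal s"
          if "x \<in> ball x\<^sub>0 (7/8 * R)" for x
        proof -
          have "(\<integral>\<^sup>+y\<in>UNIV. ennreal (if y \<in> ball x\<^sub>0 R then 0 else neg_part u y) \<partial>kernel_of K x)
              = (\<integral>\<^sup>+y\<in>- ball x\<^sub>0 R. ennreal (neg_part u y) \<partial>kernel_of K x)"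
            by (intro nn_integral_cong) (auto split: split_indicator)
          also have "\<dots> \<le> S" unfolding S_def using that by (rule SUP_upper)
          finally show ?thesis unfolding s(1) .
        qed
      qed auto
      moreover have "s \<le> \<tau> * r powr (-\<alpha>)"
      proof -
        have "s = \<Theta> * r powr (-\<alpha>)" unfolding \<Theta>_def using r by (simp add: powr_minus)
        also have "\<dots> \<le> \<tau> * r powr (-\<alpha>)" using \<tau> by (intro mult_right_mono) auto
        finally show ?thesis .
      qed
      ultimately have tw: "tail_le J (\<lambda>y. max (- w y) 0) (ball x\<^sub>0 (28 * r)) UNIV (\<tau> * r powr (-\<alpha>))"
        using sub(1) \<tau>0 by (rule_tac tail_le_subset) (auto simp: w_def)
      have pos: "\<tau> \<le> w x" if "x \<in> ball x\<^sub>0 (28 * r)" for x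
        using that sub(2) unfolding w_def v_def by auto
      obtain M where M: "AE x in lborel. x \<in> ?B \<longrightarrow> w x \<le> M" "AE x in lborel. x \<in> ?B \<longrightarrow> M \<le> \<gamma> * w x"
        using H[rule_format, OF jump_form_axioms w r(1) subset_trans[OF sub(2) BE] \<tau>0 pos tw] by blast
      have "ess_sup_on ?B u \<le> ereal (M - \<tau>)"
      proof (rule ess_sup_on_le[OF um])
        show "AE x in lborel. x \<in> ?B \<longrightarrow> u x \<le> M - \<tau>"
          using M(1) uv by eventually_elim (auto simp: w_def)
      qed simp
      \<comment> \<open>The shift is undone: \<open>M / \<gamma> - \<tau>\<close> bounds
        \<open>u\<close> from below, and the amount lost there, multiplied by \<gamma>, is the tail
        term.\<close>
      also have "\<dots> \<le> ereal (\<gamma> * (M / \<gamma> - \<tau>)) + ereal (\<gamma> * \<tau>)"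
        using \<gamma> \<tau>0 by (simp add: algebra_simps)
      also have "\<dots> \<le> ereal \<gamma> * ess_inf_on ?B u + ereal (\<gamma> * \<tau>)"
      proof (rule add_right_mono)
        have "ereal (M / \<gamma> - \<tau>) \<le> ess_inf_on ?B u"
        proof (rule ess_inf_on_ge[OF um])
          show "AE x in lborel. x \<in> ?B \<longrightarrow> M / \<gamma> - \<tau> \<le> u x"
            using M(2) uv by eventually_elim (use \<gamma> in \<open>auto simp: w_def divide_le_eq mult.commute algebra_simps\<close>)
        qed simp
        then have "ereal \<gamma> * ereal (M / \<gamma> - \<tau>) \<le> ereal \<gamma> * ess_inf_on ?B u"
          using \<gamma> by (intro ereal_mult_left_mono) auto
        then show "ereal (\<gamma> * (M / \<gamma> - \<tau>)) \<le> ereal \<gamma> * ess_inf_on ?B u" by simp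
      qed
      finally show ?thesis .
    qed
    show "ess_sup_on ?B u \<le> ereal \<gamma> * ess_inf_on ?B u
          + ereal \<gamma> * ereal ((r / R) powr \<alpha>) * enn2ereal (Tail (kernel_of K) \<alpha> (\<lambda>y. ennreal (neg_part u y)) x\<^sub>0 (7/8 * R) R)"
      unfolding tail
    proof (rule ereal_le_epsilon2)
      fix e :: real assume e: "0 < e"
      have "ess_sup_on ?B u \<le> ereal \<gamma> * ess_inf_on ?B u + ereal (\<gamma> * (\<Theta> + e / \<gamma>))"
        by (rule main) (use e \<gamma> in simp)
      also have "\<gamma> * (\<Theta> + e / \<gamma>) = \<gamma> * \<Theta> + e" using \<gamma> by (simp add: distrib_left)
      finally show "ess_sup_on ?B u \<le> ereal \<gamma> * ess_inf_on ?B u + ereal (\<gamma> * \<Theta>) + ereal e"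
        by (simp add: add.assoc)
    qed
  qed
qed

end
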